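(* For a ring $A$, the following conditions are equivalent. (1) $A$ is a right automorphism-invariant right non-singular ring. (2) $A$ is a right automorphism-invariant (von Neumann) regular ring. (3) $A=S\times T$, where $S$ is a right injective regular ring and $T$ is a strongly regular ring which contains all invertible elements of its maximal right ring of quotients.
   Context: Rings are associative with nonzero identity, except that in the decomposition $A=S\times T$ one of the factors is allowed to be the zero ring; modules are unitary. A module $M$ is automorphism-invariant if $f(M)\subseteq M$ for every automorphism $f$ of the injective hull of $M$. A ring $A$ is right automorphism-invariant (resp. right injective) if the right module $A_A$ is automorphism-invariant (resp. injective). For a right $A$-module $X$, $\operatorname{Sing} X$ is the set of all $x\in X$ whose right annihilator $r(x)=\{a\in A: xa=0\}$ is an essential right ideal of $A$; $X$ is non-singular if $\operatorname{Sing}X=0$, and $A$ is right non-singular if $A_A$ is non-singular. A ring is regular if every principal right (left) ideal is generated by an idempotent, and strongly regular if every principal right (left) ideal is generated by a central idempotent. The maximal right ring of quotients of a right non-singular ring $T$ is the (essentially unique) overring $Q\supseteq T$ such that $Q_T$ is an injective hull of $T_T$. *)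

theory Defs
  imports Complex_Main "HOL-Algebra.Chinese_Remainder"
begin

section \<open>Right modules\<close>

text \<open>The locale \<^locale>\<open>module\<close> requires a commutative ring of scalars, so right modules over
  an arbitrary ring are introduced here. As in \<^locale>\<open>ring\<close>, the zero ring is admitted.\<close>

record ('a, 'b) rmodule = "'b ring" +
  rsmult :: "['b, 'a] \<Rightarrow> 'b" (infixl \<open>\<star>\<index>\<close> 70)

locale right_module = R?: ring R + M?: abelian_group M
  for R :: "('a, 'r) ring_scheme" (structure) and M :: "('a, 'b, 'm) rmodule_scheme" (structure) +
  assumes rsmult_closed [simp, intro]:
      "\<lbrakk> x \<in> carrier M; a \<in> carrier R \<rbrakk> \<Longrightarrow> x \<star>\<^bsub>M\<^esub> a \<in> carrier M"
    and rsmult_l_distr: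
      "\<lbrakk> x \<in> carrier M; y \<in> carrier M; a \<in> carrier R \<rbrakk> \<Longrightarrow>
      (x \<oplus>\<^bsub>M\<^esub> y) \<star>\<^bsub>M\<^esub> a = x \<star>\<^bsub>M\<^esub> a \<oplus>\<^bsub>M\<^esub> y \<star>\<^bsub>M\<^esub> a"
    and rsmult_r_distr:
      "\<lbrakk> x \<in> carrier M; a \<in> carrier R; b \<in> carrier R \<rbrakk> \<Longrightarrow>
      x \<star>\<^bsub>M\<^esub> (a \<oplus>\<^bsub>R\<^esub> b) = x \<star>\<^bsub>M\<^esub> a \<oplus>\<^bsub>M\<^esub> x \<star>\<^bsub>M\<^esub> b"
    and rsmult_assoc:
      "\<lbrakk> x \<in> carrier M; a \<in> carrier R; b \<in> carrier R \<rbrakk> \<Longrightarrow>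
      x \<star>\<^bsub>M\<^esub> (a \<otimes>\<^bsub>R\<^esub> b) = x \<star>\<^bsub>M\<^esub> a \<star>\<^bsub>M\<^esub> b"
    and rsmult_one [simp]: "x \<in> carrier M \<Longrightarrow> x \<star>\<^bsub>M\<^esub> \<one>\<^bsub>R\<^esub> = x"

definition right_regular_module :: "('a, 'r) ring_scheme \<Rightarrow> ('a, 'a) rmodule" where
  "right_regular_module R =
     \<lparr>carrier = carrier R, mult = mult R, one = one R, zero = zero R, add = add R,
      rsmult = mult R\<rparr>"

text \<open>A ring \<open>Q\<close> as a right module over a ring \<open>R\<close>, along a map \<open>\<iota>\<close> from \<open>R\<close> to \<open>Q\<close>.\<close>

definition restrict_scalars :: "('a \<Rightarrow> 'q) \<Rightarrow> ('q, 's) ring_scheme \<Rightarrow> ('a, 'q) rmodule" where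
  "restrict_scalars \<iota> Q =
     \<lparr>carrier = carrier Q, mult = mult Q, one = one Q, zero = zero Q, add = add Q,
      rsmult = (\<lambda>x a. x \<otimes>\<^bsub>Q\<^esub> \<iota> a)\<rparr>"

definition right_submodule ::
    "('a, 'r) ring_scheme \<Rightarrow> ('a, 'b, 'm) rmodule_scheme \<Rightarrow> 'b set \<Rightarrow> bool" where
  "right_submodule R M N \<longleftrightarrow>
     subgroup N (add_monoid M) \<and> (\<forall>x\<in>N. \<forall>a\<in>carrier R. x \<star>\<^bsub>M\<^esub> a \<in> N)"

definition right_module_hom ::
    "('a, 'r) ring_scheme \<Rightarrow> ('a, 'b, 'm) rmodule_scheme \<Rightarrow> ('a, 'c, 'n) rmodule_scheme
      \<Rightarrow> ('b \<Rightarrow> 'c) set" where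
  "right_module_hom R M N =
     {f \<in> carrier M \<rightarrow> carrier N.
        (\<forall>x\<in>carrier M. \<forall>y\<in>carrier M. f (x \<oplus>\<^bsub>M\<^esub> y) = f x \<oplus>\<^bsub>N\<^esub> f y) \<and>
        (\<forall>x\<in>carrier M. \<forall>a\<in>carrier R. f (x \<star>\<^bsub>M\<^esub> a) = f x \<star>\<^bsub>N\<^esub> a)}"

definition right_module_aut ::
    "('a, 'r) ring_scheme \<Rightarrow> ('a, 'b, 'm) rmodule_scheme \<Rightarrow> ('b \<Rightarrow> 'b) set" where
  "right_module_aut R M =
     {f \<in> right_module_hom R M M. bij_betw f (carrier M) (carrier M)}"

definition essential_submodule ::
    "('a, 'r) ring_scheme \<Rightarrow> ('a, 'b, 'm) rmodule_scheme \<Rightarrow> 'b set \<Rightarrow> bool" where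
  "essential_submodule R M N \<longleftrightarrow>
     right_submodule R M N \<and>
     (\<forall>K. right_submodule R M K \<and> N \<inter> K = {\<zero>\<^bsub>M\<^esub>} \<longrightarrow> K = {\<zero>\<^bsub>M\<^esub>})"


section \<open>Singular submodule\<close>

definition right_annihilator ::
    "('a, 'r) ring_scheme \<Rightarrow> ('a, 'b, 'm) rmodule_scheme \<Rightarrow> 'b \<Rightarrow> 'a set" where
  "right_annihilator R M x = {a \<in> carrier R. x \<star>\<^bsub>M\<^esub> a = \<zero>\<^bsub>M\<^esub>}"

definition Sing :: "('a, 'r) ring_scheme \<Rightarrow> ('a, 'b, 'm) rmodule_scheme \<Rightarrow> 'b set" where
  "Sing R M =
     {x \<in> carrier M. essential_submodule R (right_regular_module R) (right_annihilator R M x)}"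

definition nonsingular_module ::
    "('a, 'r) ring_scheme \<Rightarrow> ('a, 'b, 'm) rmodule_scheme \<Rightarrow> bool" where
  "nonsingular_module R M \<longleftrightarrow> Sing R M = {\<zero>\<^bsub>M\<^esub>}"

definition right_nonsingular_ring :: "('a, 'r) ring_scheme \<Rightarrow> bool" where
  "right_nonsingular_ring R \<longleftrightarrow> nonsingular_module R (right_regular_module R)"


section \<open>Injective modules\<close>

definition injective_wrt ::
    "('a, 'r) ring_scheme \<Rightarrow> ('a, 'b, 'm) rmodule_scheme \<Rightarrow> ('a, 'c, 'n) rmodule_scheme
      \<Rightarrow> bool" where
  "injective_wrt R E Y \<longleftrightarrow>
     (\<forall>N. \<forall>h. right_submodule R Y N \<and> h \<in> right_module_hom R (Y\<lparr>carrier := N\<rparr>) E \<longrightarrow>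
        (\<exists>g\<in>right_module_hom R Y E. \<forall>y\<in>N. g y = h y))"

text \<open>A quantifier over all modules cannot range over all types. Here it ranges over the modules
  whose elements are taken from the type of the ring elements; the theorem
  \<open>injective_module_imp_injective_wrt\<close> below shows that then extension holds for modules over
  every type, so that nothing is lost.\<close>

definition injective_module ::
    "('a, 'r) ring_scheme \<Rightarrow> ('a, 'b, 'm) rmodule_scheme \<Rightarrow> bool" where
  "injective_module R E \<longleftrightarrow>
     right_module R E \<and> (\<forall>Y :: ('a, 'a) rmodule. right_module R Y \<longrightarrow> injective_wrt R E Y)"

lemma right_module_regular:
  assumes "ring R" shows "right_module R (right_regular_module R)"
proof -
  interpret ring R by fact
  have "abelian_group (right_regular_module R)"
    by (rule abelian_groupI)
      (auto simp: right_regular_module_def a_ac intro: bexI[of _ "\<ominus>\<^bsub>R\<^esub> _"] l_neg)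
  then show ?thesis
    by (intro right_module.intro right_module_axioms.intro ring_axioms)
      (simp_all add: right_regular_module_def l_distr r_distr m_assoc)
qed

context right_module
begin

lemma rsmult_rzero [simp]: "x \<in> carrier M \<Longrightarrow> x \<star>\<^bsub>M\<^esub> \<zero>\<^bsub>R\<^esub> = \<zero>\<^bsub>M\<^esub>"
  using rsmult_r_distr[of x "\<zero>\<^bsub>R\<^esub>" "\<zero>\<^bsub>R\<^esub>"] by (simp add: M.add.l_cancel_one)

lemma rsmult_lzero [simp]: "a \<in> carrier R \<Longrightarrow> \<zero>\<^bsub>M\<^esub> \<star>\<^bsub>M\<^esub> a = \<zero>\<^bsub>M\<^esub>"
  using rsmult_l_distr[of "\<zero>\<^bsub>M\<^esub>" "\<zero>\<^bsub>M\<^esub>" a] by (simp add: M.add.l_cancel_one)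

lemma rsmult_minus_one: "x \<in> carrier M \<Longrightarrow> x \<star>\<^bsub>M\<^esub> (\<ominus>\<^bsub>R\<^esub> \<one>\<^bsub>R\<^esub>) = \<ominus>\<^bsub>M\<^esub> x"
  using rsmult_r_distr[of x "\<ominus>\<^bsub>R\<^esub> \<one>\<^bsub>R\<^esub>" "\<one>\<^bsub>R\<^esub>"]
  by (simp add: R.l_neg M.minus_equality)

lemma right_submodule_iff:
  "right_submodule R M N \<longleftrightarrow> N \<subseteq> carrier M \<and> \<zero>\<^bsub>M\<^esub> \<in> N \<and> (\<forall>x\<in>N. \<forall>y\<in>N. x \<oplus>\<^bsub>M\<^esub> y \<in> N) \<and>
     (\<forall>x\<in>N. \<forall>a\<in>carrier R. x \<star>\<^bsub>M\<^esub> a \<in> N)" (is "?L \<longleftrightarrow> ?P")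
proof
  assume L: ?L
  then have "subgroup N (add_monoid M)" by (simp add: right_submodule_def)
  then show ?P
    using L subgroup.subset subgroup.one_closed subgroup.m_closed
    by (fastforce simp: right_submodule_def)
next
  assume P: ?P
  have "\<ominus>\<^bsub>M\<^esub> x \<in> N" if "x \<in> N" for x
    using P that rsmult_minus_one[of x] by (metis R.a_inv_closed R.one_closed subsetD)
  then have "subgroup N (add_monoid M)"
    using P by (intro M.add.subgroupI) (auto simp: a_inv_def)
  then show ?L using P by (simp add: right_submodule_def)
qed

end


theorem injective_module_imp_injective_wrt:
  fixes E :: "('a, 'b, 'm) rmodule_scheme" and Y :: "('a, 'c, 'n) rmodule_scheme"
  assumes inj: "injective_module R E" and Y: "right_module R Y"
  shows "injective_wrt R E Y"
  unfolding injective_wrt_def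
proof (intro allI impI, elim conjE)
  fix N h
  assume N: "right_submodule R Y N" and h: "h \<in> right_module_hom R (Y\<lparr>carrier := N\<rparr>) E"
  interpret E: right_module R E using inj by (simp add: injective_module_def)
  interpret Y: right_module R Y by (rule Y)
  have NY: "N \<subseteq> carrier Y" and N0: "\<zero>\<^bsub>Y\<^esub> \<in> N"
    and Nadd: "\<And>x y. x \<in> N \<Longrightarrow> y \<in> N \<Longrightarrow> x \<oplus>\<^bsub>Y\<^esub> y \<in> N"
    and Nact: "\<And>x a. x \<in> N \<Longrightarrow> a \<in> carrier R \<Longrightarrow> x \<star>\<^bsub>Y\<^esub> a \<in> N"
    using N by (auto simp: Y.right_submodule_iff)
  have hE: "\<And>x. x \<in> N \<Longrightarrow> h x \<in> carrier E"
    and hadd: "\<And>x y. x \<in> N \<Longrightarrow> y \<in> N \<Longrightarrow> h (x \<oplus>\<^bsub>Y\<^esub> y) = h x \<oplus>\<^bsub>E\<^esub> h y"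
    and hact: "\<And>x a. x \<in> N \<Longrightarrow> a \<in> carrier R \<Longrightarrow> h (x \<star>\<^bsub>Y\<^esub> a) = h x \<star>\<^bsub>E\<^esub> a"
    using h by (auto simp: right_module_hom_def)
  have h0: "h \<zero>\<^bsub>Y\<^esub> = \<zero>\<^bsub>E\<^esub>"
    using hact[OF N0, of "\<zero>\<^bsub>R\<^esub>"] hE[OF N0] by simp
  define P where "P = (\<lambda>G. G \<subseteq> carrier Y \<times> carrier E \<and> (\<forall>y\<in>N. (y, h y) \<in> G) \<and>
     (\<forall>x m y n. (x, m) \<in> G \<and> (y, n) \<in> G \<longrightarrow> (x \<oplus>\<^bsub>Y\<^esub> y, m \<oplus>\<^bsub>E\<^esub> n) \<in> G) \<and>
     (\<forall>x m. \<forall>a\<in>carrier R. (x, m) \<in> G \<longrightarrow> (x \<star>\<^bsub>Y\<^esub> a, m \<star>\<^bsub>E\<^esub> a) \<in> G) \<and>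
     (\<forall>m. (\<zero>\<^bsub>Y\<^esub>, m) \<in> G \<longrightarrow> m = \<zero>\<^bsub>E\<^esub>))"
  have "\<exists>G\<in>Collect P. \<forall>X\<in>Collect P. G \<subseteq> X \<longrightarrow> X = G"
  proof (rule subset_Zorn_nonempty)
    have "P ((\<lambda>y. (y, h y)) ` N)"
      unfolding P_def using NY hE Nadd Nact hadd hact h0 by (auto simp: image_iff)
    then show "Collect P \<noteq> {}" by blast
  next
    fix C assume ne: "C \<noteq> {}" and C: "subset.chain (Collect P) C"
    have CP: "\<And>X. X \<in> C \<Longrightarrow> P X" and ch: "\<And>X X'. X \<in> C \<Longrightarrow> X' \<in> C \<Longrightarrow> X \<subseteq> X' \<or> X' \<subseteq> X"
      using C by (auto simp: subset_chain_def)
    have 1: "\<Union>C \<subseteq> carrier Y \<times> carrier E" using CP unfolding P_def by blast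
    have 2: "\<forall>y\<in>N. (y, h y) \<in> \<Union>C" using CP ne unfolding P_def by blast
    have 3: "(x \<oplus>\<^bsub>Y\<^esub> y, m \<oplus>\<^bsub>E\<^esub> n) \<in> \<Union>C" if xm: "(x, m) \<in> \<Union>C" and yn: "(y, n) \<in> \<Union>C" for x m y n
    proof -
      obtain X X' where X: "X \<in> C" "(x, m) \<in> X" "X' \<in> C" "(y, n) \<in> X'" using xm yn by blast
      then obtain Z where "Z \<in> C" "(x, m) \<in> Z" "(y, n) \<in> Z" using ch[of X X'] by blast
      then show ?thesis using CP[of Z] unfolding P_def by blast
    qed
    have 4: "(x \<star>\<^bsub>Y\<^esub> a, m \<star>\<^bsub>E\<^esub> a) \<in> \<Union>C" if "a \<in> carrier R" "(x, m) \<in> \<Union>C" for x m a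
      using that CP unfolding P_def by blast
    have 5: "m = \<zero>\<^bsub>E\<^esub>" if "(\<zero>\<^bsub>Y\<^esub>, m) \<in> \<Union>C" for m
      using that CP unfolding P_def by blast
    show "\<Union>C \<in> Collect P"
      unfolding mem_Collect_eq P_def using 1 2 3 4 5 by blast
  qed
  then obtain G where PG: "P G" and max: "\<And>X. P X \<Longrightarrow> G \<subseteq> X \<Longrightarrow> X = G" by blast
  have GY: "\<And>x m. (x, m) \<in> G \<Longrightarrow> x \<in> carrier Y" and GE: "\<And>x m. (x, m) \<in> G \<Longrightarrow> m \<in> carrier E"
    and Gh: "\<And>y. y \<in> N \<Longrightarrow> (y, h y) \<in> G"
    and Gadd: "\<And>x m y n. (x, m) \<in> G \<Longrightarrow> (y, n) \<in> G \<Longrightarrow> (x \<oplus>\<^bsub>Y\<^esub> y, m \<oplus>\<^bsub>E\<^esub> n) \<in> G"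
    and Gact: "\<And>x m a. a \<in> carrier R \<Longrightarrow> (x, m) \<in> G \<Longrightarrow> (x \<star>\<^bsub>Y\<^esub> a, m \<star>\<^bsub>E\<^esub> a) \<in> G"
    and G0: "\<And>m. (\<zero>\<^bsub>Y\<^esub>, m) \<in> G \<Longrightarrow> m = \<zero>\<^bsub>E\<^esub>"
    using PG unfolding P_def by blast+
  have G00: "(\<zero>\<^bsub>Y\<^esub>, \<zero>\<^bsub>E\<^esub>) \<in> G" using Gh[OF N0] h0 by simp
  have Gminus: "(\<ominus>\<^bsub>Y\<^esub> x, \<ominus>\<^bsub>E\<^esub> m) \<in> G" if "(x, m) \<in> G" for x m
    using Gact[of "\<ominus>\<^bsub>R\<^esub> \<one>\<^bsub>R\<^esub>", OF _ that] GY[OF that] GE[OF that]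
    by (simp add: E.rsmult_minus_one Y.rsmult_minus_one)
  have Guniq: "m = n" if "(x, m) \<in> G" "(x, n) \<in> G" for x m n
  proof -
    have "(\<zero>\<^bsub>Y\<^esub>, m \<oplus>\<^bsub>E\<^esub> \<ominus>\<^bsub>E\<^esub> n) \<in> G"
      using Gadd[OF that(1) Gminus[OF that(2)]] GY[OF that(1)] by (simp add: Y.M.r_neg)
    then have "m \<oplus>\<^bsub>E\<^esub> \<ominus>\<^bsub>E\<^esub> n = \<zero>\<^bsub>E\<^esub>" by (rule G0)
    then show ?thesis using GE that E.M.minus_equality[of m "\<ominus>\<^bsub>E\<^esub> n"] by auto
  qed
  have total: "\<exists>m. (y, m) \<in> G" if y: "y \<in> carrier Y" for y
  proof -
    define I where "I = {a \<in> carrier R. \<exists>m. (y \<star>\<^bsub>Y\<^esub> a, m) \<in> G}"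
    define k where "k = (\<lambda>a. THE m. (y \<star>\<^bsub>Y\<^esub> a, m) \<in> G)"
    have kI: "k a = m" if "(y \<star>\<^bsub>Y\<^esub> a, m) \<in> G" for a m
      unfolding k_def using that Guniq by blast
    let ?A = "right_regular_module R"
    interpret A: right_module R ?A by (rule right_module_regular) (rule right_module.axioms(1)[OF Y])
    have A: "carrier ?A = carrier R" "zero ?A = \<zero>\<^bsub>R\<^esub>" "add ?A = add R" "rsmult ?A = mult R"
      by (simp_all add: right_regular_module_def)
    have Isub: "right_submodule R ?A I"
      unfolding A.right_submodule_iff A
    proof (intro conjI ballI)
      show "\<zero>\<^bsub>R\<^esub> \<in> I" using G00 y by (auto simp: I_def)
      show "I \<subseteq> carrier R" by (auto simp: I_def)
      show "a \<oplus>\<^bsub>R\<^esub> b \<in> I" if a: "a \<in> I" and b: "b \<in> I" for a b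
      proof -
        obtain m n where mn: "a \<in> carrier R" "b \<in> carrier R"
          "(y \<star>\<^bsub>Y\<^esub> a, m) \<in> G" "(y \<star>\<^bsub>Y\<^esub> b, n) \<in> G" using a b by (auto simp: I_def)
        then have "(y \<star>\<^bsub>Y\<^esub> (a \<oplus>\<^bsub>R\<^esub> b), m \<oplus>\<^bsub>E\<^esub> n) \<in> G"
          using Gadd[OF mn(3,4)] y by (simp add: Y.rsmult_r_distr)
        then show ?thesis using mn by (auto simp: I_def)
      qed
      show "a \<otimes>\<^bsub>R\<^esub> b \<in> I" if a: "a \<in> I" and b: "b \<in> carrier R" for a b
      proof -
        obtain m where m: "a \<in> carrier R" "(y \<star>\<^bsub>Y\<^esub> a, m) \<in> G" using a by (auto simp: I_def)
        then have "(y \<star>\<^bsub>Y\<^esub> (a \<otimes>\<^bsub>R\<^esub> b), m \<star>\<^bsub>E\<^esub> b) \<in> G"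
          using Gact[OF b m(2)] y b by (simp add: Y.rsmult_assoc)
        then show ?thesis using m b by (auto simp: I_def)
      qed
    qed
    have khom: "k \<in> right_module_hom R (?A\<lparr>carrier := I\<rparr>) E"
      unfolding right_module_hom_def
    proof (intro CollectI conjI ballI, goal_cases)
      case 1
      then show ?case using kI GE by (auto simp: I_def)
    next
      case (2 a b)
      then obtain m n where mn: "a \<in> carrier R" "b \<in> carrier R"
        "(y \<star>\<^bsub>Y\<^esub> a, m) \<in> G" "(y \<star>\<^bsub>Y\<^esub> b, n) \<in> G" by (auto simp: I_def)
      have "k (a \<oplus>\<^bsub>R\<^esub> b) = m \<oplus>\<^bsub>E\<^esub> n"
        using Gadd[OF mn(3,4)] mn y by (intro kI) (simp add: Y.rsmult_r_distr)
      then show ?case using kI[OF mn(3)] kI[OF mn(4)] by (simp add: A)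
    next
      case (3 a b)
      then obtain m where m: "a \<in> carrier R" "b \<in> carrier R" "(y \<star>\<^bsub>Y\<^esub> a, m) \<in> G"
        by (auto simp: I_def)
      have "k (a \<otimes>\<^bsub>R\<^esub> b) = m \<star>\<^bsub>E\<^esub> b"
        using Gact[OF m(2,3)] m y by (intro kI) (simp add: Y.rsmult_assoc)
      then show ?case using kI[OF m(3)] by (simp add: A)
    qed
    have "injective_wrt R E ?A"
      using inj A.right_module_axioms by (simp add: injective_module_def)
    then obtain g where g: "g \<in> right_module_hom R ?A E" and gk: "\<forall>a\<in>I. g a = k a"
      using Isub khom unfolding injective_wrt_def by blast
    define e where "e = g \<one>\<^bsub>R\<^esub>"
    have e: "e \<in> carrier E" using g by (auto simp: e_def right_module_hom_def A)
    have ge: "g a = e \<star>\<^bsub>E\<^esub> a" if "a \<in> carrier R" for a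
    proof -
      have "g (\<one>\<^bsub>R\<^esub> \<otimes>\<^bsub>R\<^esub> a) = g \<one>\<^bsub>R\<^esub> \<star>\<^bsub>E\<^esub> a"
        using g that unfolding right_module_hom_def A by blast
      then show ?thesis using that by (simp add: e_def)
    qed
    define G' where
      "G' = {(x \<oplus>\<^bsub>Y\<^esub> y \<star>\<^bsub>Y\<^esub> a, m \<oplus>\<^bsub>E\<^esub> e \<star>\<^bsub>E\<^esub> a) | x m a. (x, m) \<in> G \<and> a \<in> carrier R}"
    have G'I: "(z, n) \<in> G'" if "(x, m) \<in> G" "a \<in> carrier R" "z = x \<oplus>\<^bsub>Y\<^esub> y \<star>\<^bsub>Y\<^esub> a"
      "n = m \<oplus>\<^bsub>E\<^esub> e \<star>\<^bsub>E\<^esub> a" for z n x m a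
      using that unfolding G'_def by blast
    have sub: "G \<subseteq> G'"
    proof
      fix p assume "p \<in> G"
      then obtain x m where p: "p = (x, m)" "(x, m) \<in> G" by (cases p) auto
      show "p \<in> G'" unfolding p(1)
        by (rule G'I[OF p(2), of "\<zero>\<^bsub>R\<^esub>"]) (use p(2) GY GE y e in auto)
    qed
    have "P G'"
      unfolding P_def
    proof (intro conjI allI ballI impI)
      show "G' \<subseteq> carrier Y \<times> carrier E" unfolding G'_def using GY GE y e by auto
      show "(x, h x) \<in> G'" if "x \<in> N" for x using Gh[OF that] sub by blast
      show "(x \<oplus>\<^bsub>Y\<^esub> z, m \<oplus>\<^bsub>E\<^esub> n) \<in> G'" if xz: "(x, m) \<in> G' \<and> (z, n) \<in> G'" for x m z n
      proof -
        obtain x1 m1 a where 1: "(x1, m1) \<in> G" "a \<in> carrier R" "x = x1 \<oplus>\<^bsub>Y\<^esub> y \<star>\<^bsub>Y\<^esub> a"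
          "m = m1 \<oplus>\<^bsub>E\<^esub> e \<star>\<^bsub>E\<^esub> a" using xz unfolding G'_def by blast
        obtain z1 n1 b where 2: "(z1, n1) \<in> G" "b \<in> carrier R" "z = z1 \<oplus>\<^bsub>Y\<^esub> y \<star>\<^bsub>Y\<^esub> b"
          "n = n1 \<oplus>\<^bsub>E\<^esub> e \<star>\<^bsub>E\<^esub> b" using xz unfolding G'_def by blast
        note c = GY[OF 1(1)] GY[OF 2(1)] GE[OF 1(1)] GE[OF 2(1)]
        show ?thesis
          by (rule G'I[OF Gadd[OF 1(1) 2(1)], of "a \<oplus>\<^bsub>R\<^esub> b"])
            (use 1 2 c y e in \<open>simp_all add: Y.rsmult_r_distr E.rsmult_r_distr Y.M.a_ac E.M.a_ac\<close>)
      qed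
      show "(x \<star>\<^bsub>Y\<^esub> b, m \<star>\<^bsub>E\<^esub> b) \<in> G'" if b: "b \<in> carrier R" and x: "(x, m) \<in> G'" for x m b
      proof -
        obtain x1 m1 a where 1: "(x1, m1) \<in> G" "a \<in> carrier R" "x = x1 \<oplus>\<^bsub>Y\<^esub> y \<star>\<^bsub>Y\<^esub> a"
          "m = m1 \<oplus>\<^bsub>E\<^esub> e \<star>\<^bsub>E\<^esub> a" using x unfolding G'_def by blast
        note c = GY[OF 1(1)] GE[OF 1(1)]
        show ?thesis
          by (rule G'I[OF Gact[OF b 1(1)], of "a \<otimes>\<^bsub>R\<^esub> b"])
            (use 1 b c y e in \<open>simp_all add: Y.rsmult_l_distr E.rsmult_l_distr Y.rsmult_assoc E.rsmult_assoc\<close>)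
      qed
      show "m = \<zero>\<^bsub>E\<^esub>" if m: "(\<zero>\<^bsub>Y\<^esub>, m) \<in> G'" for m
      proof -
        obtain x n a where 1: "(x, n) \<in> G" "a \<in> carrier R" "\<zero>\<^bsub>Y\<^esub> = x \<oplus>\<^bsub>Y\<^esub> y \<star>\<^bsub>Y\<^esub> a"
          "m = n \<oplus>\<^bsub>E\<^esub> e \<star>\<^bsub>E\<^esub> a" using m unfolding G'_def by blast
        note c = GY[OF 1(1)] GE[OF 1(1)]
        have "\<ominus>\<^bsub>Y\<^esub> x = y \<star>\<^bsub>Y\<^esub> a"
          using 1 c y by (intro Y.M.minus_equality) (auto simp: Y.M.a_comm)
        then have ya: "(y \<star>\<^bsub>Y\<^esub> a, \<ominus>\<^bsub>E\<^esub> n) \<in> G" using Gminus[OF 1(1)] by simp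
        then have "a \<in> I" using 1 by (auto simp: I_def)
        then have "e \<star>\<^bsub>E\<^esub> a = \<ominus>\<^bsub>E\<^esub> n" using gk ge[OF 1(2)] kI[OF ya] by auto
        then show ?thesis using 1 c by (simp add: E.M.r_neg)
      qed
    qed
    from max[OF this sub] have "G' = G" .
    moreover have "(y, e) \<in> G'"
      by (rule G'I[OF G00, of "\<one>\<^bsub>R\<^esub>"]) (use y e in simp_all)
    ultimately show ?thesis by blast
  qed
  define g where "g = (\<lambda>y. THE m. (y, m) \<in> G)"
  have gI: "g y = m" if "(y, m) \<in> G" for y m
    unfolding g_def using that Guniq by blast
  have gG: "(y, g y) \<in> G" if "y \<in> carrier Y" for y
    using total[OF that] gI by auto
  have "g \<in> right_module_hom R Y E"
    unfolding right_module_hom_def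
  proof (intro CollectI conjI ballI)
    show "g \<in> carrier Y \<rightarrow> carrier E" using GE[OF gG] by blast
    show "g (x \<oplus>\<^bsub>Y\<^esub> y) = g x \<oplus>\<^bsub>E\<^esub> g y" if "x \<in> carrier Y" "y \<in> carrier Y" for x y
      by (rule gI[OF Gadd[OF gG[OF that(1)] gG[OF that(2)]]])
    show "g (x \<star>\<^bsub>Y\<^esub> a) = g x \<star>\<^bsub>E\<^esub> a" if "x \<in> carrier Y" "a \<in> carrier R" for x a
      by (rule gI[OF Gact[OF that(2) gG[OF that(1)]]])
  qed
  then show "\<exists>g\<in>right_module_hom R Y E. \<forall>y\<in>N. g y = h y"
    using gI[OF Gh] by blast
qed


section \<open>Injective hulls and automorphism-invariance\<close>

text \<open>\<open>\<iota>\<close> embeds \<open>M\<close> as an essential submodule into the injective module \<open>E\<close>.\<close>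

definition is_injective_hull ::
    "('a, 'r) ring_scheme \<Rightarrow> ('a, 'b, 'm) rmodule_scheme \<Rightarrow> ('a, 'c, 'n) rmodule_scheme
      \<Rightarrow> ('b \<Rightarrow> 'c) \<Rightarrow> bool" where
  "is_injective_hull R M E \<iota> \<longleftrightarrow>
     injective_module R E \<and> \<iota> \<in> right_module_hom R M E \<and> inj_on \<iota> (carrier M) \<and>
     essential_submodule R E (\<iota> ` carrier M)"

text \<open>A type in which every right module \<open>M\<close> (with elements in \<open>'b\<close>) over a ring \<open>A\<close> (with
  elements in \<open>'a\<close>) has an injective hull. Indeed, the additive group of \<open>M\<close> is a quotient \<open>F/K\<close>
  of the group \<open>F\<close> of finitely supported integer-valued functions on \<open>M\<close>; it embeds in the
  divisible group \<open>D = V/K\<close>, where \<open>V\<close> is the group of finitely supported rational-valued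
  functions on \<open>M\<close>, and whose elements are cosets, of type \<open>('b \<Rightarrow> rat) set\<close>. The additive maps
  from \<open>A\<close> to \<open>D\<close> form an injective right \<open>A\<close>-module containing \<open>M\<close> (via \<open>m \<mapsto> (a \<mapsto> ma)\<close>), which
  therefore contains an injective hull of \<open>M\<close>. As hulls are unique up to isomorphism over \<open>M\<close>,
  it is enough to consider those over this type.\<close>

type_synonym ('a, 'b) hull_elem = "'a \<Rightarrow> ('b \<Rightarrow> rat) set"

definition automorphism_invariant ::
    "('a, 'r) ring_scheme \<Rightarrow> ('a, 'b, 'm) rmodule_scheme \<Rightarrow> bool" where
  "automorphism_invariant R M \<longleftrightarrow>
     (\<forall>(E :: ('a, ('a, 'b) hull_elem) rmodule) \<iota>. is_injective_hull R M E \<iota> \<longrightarrow>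
        (\<forall>f\<in>right_module_aut R E. f ` \<iota> ` carrier M \<subseteq> \<iota> ` carrier M))"

definition right_automorphism_invariant_ring :: "('a, 'r) ring_scheme \<Rightarrow> bool" where
  "right_automorphism_invariant_ring R \<longleftrightarrow> automorphism_invariant R (right_regular_module R)"

definition right_injective_ring :: "('a, 'r) ring_scheme \<Rightarrow> bool" where
  "right_injective_ring R \<longleftrightarrow> injective_module R (right_regular_module R)"


section \<open>Regular and strongly regular rings\<close>

definition principal_right_ideal :: "('a, 'r) ring_scheme \<Rightarrow> 'a \<Rightarrow> 'a set" where
  "principal_right_ideal R a = {a \<otimes>\<^bsub>R\<^esub> x | x. x \<in> carrier R}"

definition principal_left_ideal :: "('a, 'r) ring_scheme \<Rightarrow> 'a \<Rightarrow> 'a set" where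
  "principal_left_ideal R a = {x \<otimes>\<^bsub>R\<^esub> a | x. x \<in> carrier R}"

definition idempotents :: "('a, 'r) ring_scheme \<Rightarrow> 'a set" where
  "idempotents R = {e \<in> carrier R. e \<otimes>\<^bsub>R\<^esub> e = e}"

definition central_idempotents :: "('a, 'r) ring_scheme \<Rightarrow> 'a set" where
  "central_idempotents R = {e \<in> idempotents R. \<forall>x\<in>carrier R. e \<otimes>\<^bsub>R\<^esub> x = x \<otimes>\<^bsub>R\<^esub> e}"

definition regular_ring :: "('a, 'r) ring_scheme \<Rightarrow> bool" where
  "regular_ring R \<longleftrightarrow>
     (\<forall>a\<in>carrier R.
        (\<exists>e\<in>idempotents R. principal_right_ideal R a = principal_right_ideal R e) \<and>
        (\<exists>e\<in>idempotents R. principal_left_ideal R a = principal_left_ideal R e))"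

definition strongly_regular_ring :: "('a, 'r) ring_scheme \<Rightarrow> bool" where
  "strongly_regular_ring R \<longleftrightarrow>
     (\<forall>a\<in>carrier R.
        (\<exists>e\<in>central_idempotents R. principal_right_ideal R a = principal_right_ideal R e) \<and>
        (\<exists>e\<in>central_idempotents R. principal_left_ideal R a = principal_left_ideal R e))"


section \<open>Maximal right ring of quotients\<close>

text \<open>Only meaningful for right non-singular \<open>T\<close>, which strongly regular rings are.\<close>

definition is_max_right_quotient_ring ::
    "('a, 'r) ring_scheme \<Rightarrow> ('q, 's) ring_scheme \<Rightarrow> ('a \<Rightarrow> 'q) \<Rightarrow> bool" where
  "is_max_right_quotient_ring T Q \<iota> \<longleftrightarrow>
     ring Q \<and> \<iota> \<in> ring_hom T Q \<and> inj_on \<iota> (carrier T) \<and>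
     is_injective_hull T (right_regular_module T) (restrict_scalars \<iota> Q) \<iota>"

text \<open>For right non-singular \<open>T\<close> every injective hull of \<open>T\<^sub>T\<close> carries the ring structure of a
  maximal right ring of quotients, so the type of hull elements is again large enough; and these rings
  are unique up to isomorphism over \<open>T\<close>.\<close>

definition contains_units_of_max_right_quotient_ring :: "('a, 'r) ring_scheme \<Rightarrow> bool" where
  "contains_units_of_max_right_quotient_ring T \<longleftrightarrow>
     (\<forall>(Q :: ('a, 'a) hull_elem ring) \<iota>. is_max_right_quotient_ring T Q \<iota> \<longrightarrow>
        Units Q \<subseteq> \<iota> ` carrier T)"

end

theory Submission
  imports Defs
begin

text \<open>
The proof translates every condition into one that mentions neither hulls nor quotient rings. Say that
partial automorphisms of a ring extend if every isomorphism between two essential right ideals is left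
multiplication by a ring element. For a right non-singular ring this is the same as
automorphism-invariance, and also the same as containing all units of the maximal right ring of
quotients: an automorphism of the injective hull restricts to an isomorphism between two essential
right ideals and, the hull being non-singular, is determined by it
(\<open>automorphism_invariant_if_partial_automorphisms_extend\<close>); left multiplication by a unit of the
quotient ring is an automorphism of the hull (\<open>contains_units_if_automorphism_invariant\<close>); and
an isomorphism between essential right ideals is left multiplication by a unit of the quotient ring
(\<open>partial_automorphisms_extend_if_contains_units\<close>). For the last step the quotient ring is
built as the ring of those homomorphisms from essential right ideals to the ring that cannot be
extended further.

A regular ring is right non-singular, and in a right injective ring all homomorphisms from right ideals
are left multiplications. As both regularity and the extension of partial automorphisms pass from two
rings to their product, the third condition implies the second, and the second implies the first.

It remains to decompose a right non-singular ring \<open>A\<close> whose partial automorphisms extend. The tool is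
\<open>homomorphism_into_disjoint_ideal_extends\<close>: if \<open>h\<close> maps a right ideal \<open>I\<close> to a right ideal that meets
\<open>I\<close> in zero, and \<open>M\<close> is a complement of \<open>I\<close> containing that ideal, then \<open>i + m \<mapsto> i + h i + m\<close> is a
partial automorphism; it is given by an element \<open>1 + x\<close>, and so \<open>h\<close> is left multiplication by \<open>x\<close>.

By Zorn's lemma there is a maximal isomorphism between two right ideals that meet in zero. It and its
inverse are given by elements \<open>u\<close> and \<open>v\<close> of square zero; \<open>e = vu\<close> and \<open>f = uv\<close> are orthogonal
idempotents, and for \<open>g = 1 - e - f\<close> maximality says that \<open>gA\<close> is square-free: it does not contain two
non-zero isomorphic right ideals that meet in zero. Next choose a maximal isomorphism \<open>z\<close> from a right
ideal inside \<open>gA\<close> to one inside \<open>eA\<close>, with inverse \<open>w\<close>, and put \<open>d = g - wz\<close>. There are no non-zero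
homomorphisms from \<open>dA\<close> to \<open>(e - zw)A\<close> by maximality, none to \<open>wzA\<close> by square-freeness, hence none to
\<open>zwA\<close>, to \<open>eA\<close> and to \<open>fA\<close>; the same holds in the other direction, and therefore \<open>d\<close> is central. Now
\<open>1 - d = e + f + wz\<close> is a sum of three idempotents each of which generates a right ideal that is
isomorphic to one inside its complement. A homomorphism from an essential right ideal of \<open>(1 - d)A\<close>
thus splits into pieces between right ideals meeting in zero, all of them left multiplications, so
that \<open>(1 - d)A\<close> is a right injective ring
(\<open>right_injective_if_one_is_sum_of_embedding_idempotents\<close>), and with it regular. The ring \<open>dA\<close> is
square-free, hence reduced. Given \<open>a\<close> in \<open>dA\<close> with annihilator \<open>I\<close> and a complement \<open>K\<close> of \<open>I\<close>, the
inverse of \<open>i + k \<mapsto> i + ak\<close> is a partial automorphism, and the element giving it is a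
von Neumann inverse of \<open>a\<close>. A reduced regular ring is strongly regular
(\<open>square_free_imp_strongly_regular\<close>).
\<close>

section \<open>Submodules\<close>

abbreviation right_ideal :: "('a, 'r) ring_scheme \<Rightarrow> 'a set \<Rightarrow> bool" where
  "right_ideal R \<equiv> right_submodule R (right_regular_module R)"

abbreviation essential_right_ideal :: "('a, 'r) ring_scheme \<Rightarrow> 'a set \<Rightarrow> bool" where
  "essential_right_ideal R \<equiv> essential_submodule R (right_regular_module R)"

lemma right_regular_module_simps [simp]:
  "carrier (right_regular_module R) = carrier R" "zero (right_regular_module R) = zero R"
  "add (right_regular_module R) = add R" "rsmult (right_regular_module R) = mult R"
  by (simp_all add: right_regular_module_def)

lemma set_add_right_regular_module [simp]:
  "A <+>\<^bsub>right_regular_module R\<^esub> B = A <+>\<^bsub>R\<^esub> B"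
  by (simp add: set_add_defs)

lemma set_addI: "x \<in> A \<Longrightarrow> y \<in> B \<Longrightarrow> x \<oplus>\<^bsub>M\<^esub> y \<in> A <+>\<^bsub>M\<^esub> B"
  by (auto simp: set_add_defs)

lemma set_addE:
  assumes "z \<in> A <+>\<^bsub>M\<^esub> B"
  obtains x y where "x \<in> A" "y \<in> B" "z = x \<oplus>\<^bsub>M\<^esub> y"
  using assms by (auto simp: set_add_defs)

context right_module
begin

lemma submodule_zero: "right_submodule R M {\<zero>\<^bsub>M\<^esub>}"
  by (simp add: right_submodule_iff)

lemma submodule_memD: "right_submodule R M N \<Longrightarrow> x \<in> N \<Longrightarrow> x \<in> carrier M"
  by (auto simp: right_submodule_iff)

lemma submodule_zero_mem: "right_submodule R M N \<Longrightarrow> \<zero>\<^bsub>M\<^esub> \<in> N"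
  by (auto simp: right_submodule_iff)

lemma submodule_add: "right_submodule R M N \<Longrightarrow> x \<in> N \<Longrightarrow> y \<in> N \<Longrightarrow> x \<oplus>\<^bsub>M\<^esub> y \<in> N"
  by (auto simp: right_submodule_iff)

lemma submodule_rsmult: "right_submodule R M N \<Longrightarrow> x \<in> N \<Longrightarrow> a \<in> carrier R \<Longrightarrow> x \<star>\<^bsub>M\<^esub> a \<in> N"
  by (auto simp: right_submodule_iff)

lemma submodule_neg: "right_submodule R M N \<Longrightarrow> x \<in> N \<Longrightarrow> \<ominus>\<^bsub>M\<^esub> x \<in> N"
  by (metis R.a_inv_closed R.one_closed rsmult_minus_one submodule_memD submodule_rsmult)

lemma submodule_cyclic: "x \<in> carrier M \<Longrightarrow> right_submodule R M {x \<star>\<^bsub>M\<^esub> a | a. a \<in> carrier R}"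
  unfolding right_submodule_iff
proof (intro conjI ballI)
  assume x: "x \<in> carrier M"
  let ?C = "{x \<star>\<^bsub>M\<^esub> a | a. a \<in> carrier R}"
  show "?C \<subseteq> carrier M" using x by auto
  show "\<zero>\<^bsub>M\<^esub> \<in> ?C" using x rsmult_rzero[of x] R.zero_closed by (metis (mono_tags, lifting) mem_Collect_eq)
  show "p \<oplus>\<^bsub>M\<^esub> q \<in> ?C" if "p \<in> ?C" "q \<in> ?C" for p q
    using that x rsmult_r_distr[OF x] R.add.m_closed by (smt (verit) mem_Collect_eq)
  show "p \<star>\<^bsub>M\<^esub> b \<in> ?C" if "p \<in> ?C" "b \<in> carrier R" for p b
    using that x rsmult_assoc[OF x] R.m_closed by (smt (verit) mem_Collect_eq)
qed

lemma submodule_set_add: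
  assumes N: "right_submodule R M N" and K: "right_submodule R M K"
  shows "right_submodule R M (N <+>\<^bsub>M\<^esub> K)"
  unfolding right_submodule_iff
proof (intro conjI ballI)
  show "N <+>\<^bsub>M\<^esub> K \<subseteq> carrier M"
    using N K by (auto elim!: set_addE dest: submodule_memD)
  show "\<zero>\<^bsub>M\<^esub> \<in> N <+>\<^bsub>M\<^esub> K"
    using set_addI[OF submodule_zero_mem[OF N] submodule_zero_mem[OF K], of M] by simp
next
  fix x y assume "x \<in> N <+>\<^bsub>M\<^esub> K" "y \<in> N <+>\<^bsub>M\<^esub> K"
  then obtain n k n' k' where *: "n \<in> N" "k \<in> K" "x = n \<oplus>\<^bsub>M\<^esub> k" "n' \<in> N" "k' \<in> K" "y = n' \<oplus>\<^bsub>M\<^esub> k'"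
    by (elim set_addE)
  then have "x \<oplus>\<^bsub>M\<^esub> y = (n \<oplus>\<^bsub>M\<^esub> n') \<oplus>\<^bsub>M\<^esub> (k \<oplus>\<^bsub>M\<^esub> k')"
    using N K submodule_memD by (simp add: M.a_ac)
  then show "x \<oplus>\<^bsub>M\<^esub> y \<in> N <+>\<^bsub>M\<^esub> K"
    using * N K by (auto intro!: set_addI submodule_add)
next
  fix x a assume x: "x \<in> N <+>\<^bsub>M\<^esub> K" and a: "a \<in> carrier R"
  from x obtain n k where *: "n \<in> N" "k \<in> K" "x = n \<oplus>\<^bsub>M\<^esub> k" by (rule set_addE)
  then have "x \<star>\<^bsub>M\<^esub> a = n \<star>\<^bsub>M\<^esub> a \<oplus>\<^bsub>M\<^esub> k \<star>\<^bsub>M\<^esub> a"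
    using N K a submodule_memD by (simp add: rsmult_l_distr)
  then show "x \<star>\<^bsub>M\<^esub> a \<in> N <+>\<^bsub>M\<^esub> K"
    using * N K a by (auto intro!: set_addI submodule_rsmult)
qed

lemma set_add_left: "right_submodule R M N \<Longrightarrow> right_submodule R M K \<Longrightarrow> x \<in> N \<Longrightarrow> x \<in> N <+>\<^bsub>M\<^esub> K"
  using set_addI[of x N "\<zero>\<^bsub>M\<^esub>" K M] by (simp add: submodule_memD submodule_zero_mem)

lemma set_add_right: "right_submodule R M N \<Longrightarrow> right_submodule R M K \<Longrightarrow> x \<in> K \<Longrightarrow> x \<in> N <+>\<^bsub>M\<^esub> K"
  using set_addI[of "\<zero>\<^bsub>M\<^esub>" N x K M] by (simp add: submodule_memD submodule_zero_mem)

lemma essential_submodule_iff: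
  "essential_submodule R M N \<longleftrightarrow> right_submodule R M N \<and>
     (\<forall>x\<in>carrier M. x \<noteq> \<zero>\<^bsub>M\<^esub> \<longrightarrow> (\<exists>a\<in>carrier R. x \<star>\<^bsub>M\<^esub> a \<noteq> \<zero>\<^bsub>M\<^esub> \<and> x \<star>\<^bsub>M\<^esub> a \<in> N))"
proof
  assume L: "essential_submodule R M N"
  then have N: "right_submodule R M N"
    and ess: "\<And>K. right_submodule R M K \<Longrightarrow> N \<inter> K = {\<zero>\<^bsub>M\<^esub>} \<Longrightarrow> K = {\<zero>\<^bsub>M\<^esub>}"
    by (auto simp: essential_submodule_def)
  have "\<exists>a\<in>carrier R. x \<star>\<^bsub>M\<^esub> a \<noteq> \<zero>\<^bsub>M\<^esub> \<and> x \<star>\<^bsub>M\<^esub> a \<in> N"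
    if x: "x \<in> carrier M" "x \<noteq> \<zero>\<^bsub>M\<^esub>" for x
  proof (rule ccontr)
    assume no: "\<not> ?thesis"
    let ?K = "{x \<star>\<^bsub>M\<^esub> a | a. a \<in> carrier R}"
    have K: "right_submodule R M ?K" by (rule submodule_cyclic) (rule x)
    moreover have "N \<inter> ?K = {\<zero>\<^bsub>M\<^esub>}"
      using no submodule_zero_mem[OF N] submodule_zero_mem[OF K] by blast
    ultimately have "?K = {\<zero>\<^bsub>M\<^esub>}" by (rule ess)
    moreover have "x \<in> ?K" using x rsmult_one[of x] R.one_closed by (metis (mono_tags, lifting) mem_Collect_eq)
    ultimately show False using x by blast
  qed
  then show "right_submodule R M N \<and>
     (\<forall>x\<in>carrier M. x \<noteq> \<zero>\<^bsub>M\<^esub> \<longrightarrow> (\<exists>a\<in>carrier R. x \<star>\<^bsub>M\<^esub> a \<noteq> \<zero>\<^bsub>M\<^esub> \<and> x \<star>\<^bsub>M\<^esub> a \<in> N))"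
    using N by blast
next
  assume R: "right_submodule R M N \<and>
     (\<forall>x\<in>carrier M. x \<noteq> \<zero>\<^bsub>M\<^esub> \<longrightarrow> (\<exists>a\<in>carrier R. x \<star>\<^bsub>M\<^esub> a \<noteq> \<zero>\<^bsub>M\<^esub> \<and> x \<star>\<^bsub>M\<^esub> a \<in> N))"
  show "essential_submodule R M N"
    unfolding essential_submodule_def
  proof (intro conjI allI impI)
    fix K assume K: "right_submodule R M K \<and> N \<inter> K = {\<zero>\<^bsub>M\<^esub>}"
    have "x = \<zero>\<^bsub>M\<^esub>" if "x \<in> K" for x
      using R K that submodule_memD[of K x] submodule_rsmult[of K x] by blast
    then show "K = {\<zero>\<^bsub>M\<^esub>}" using K by blast
  qed (use R in blast)
qed

text \<open>All submodules below that need Zorn's lemma (complements, extensions of homomorphisms, maximal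
isomorphisms between right ideals) are maximal among the submodules whose elements pairwise satisfy
some relation \<open>\<Phi>\<close>: such a relation holds on the union of a chain if it holds on its members.\<close>

lemma maximal_submodule:
  assumes N0: "right_submodule R M N0" and \<Phi>: "\<And>p q. p \<in> N0 \<Longrightarrow> q \<in> N0 \<Longrightarrow> \<Phi> p q"
  shows "\<exists>N. right_submodule R M N \<and> N0 \<subseteq> N \<and> (\<forall>p\<in>N. \<forall>q\<in>N. \<Phi> p q) \<and>
    (\<forall>N'. right_submodule R M N' \<and> N \<subseteq> N' \<and> (\<forall>p\<in>N'. \<forall>q\<in>N'. \<Phi> p q) \<longrightarrow> N' = N)"
proof -
  define F where "F = {N. right_submodule R M N \<and> N0 \<subseteq> N \<and> (\<forall>p\<in>N. \<forall>q\<in>N. \<Phi> p q)}"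
  have "\<exists>N\<in>F. \<forall>X\<in>F. N \<subseteq> X \<longrightarrow> X = N"
  proof (rule subset_Zorn_nonempty)
    show "F \<noteq> {}" using assms unfolding F_def by blast
  next
    fix C assume ne: "C \<noteq> {}" and C: "subset.chain F C"
    have CF: "\<And>X. X \<in> C \<Longrightarrow> X \<in> F"
      using C by (auto simp: subset_chain_def)
    have ch: "\<And>X X'. X \<in> C \<Longrightarrow> X' \<in> C \<Longrightarrow> X \<subseteq> X' \<or> X' \<subseteq> X"
      using C by (auto simp: subset_chain_def)
    have both: "\<exists>X\<in>C. p \<in> X \<and> q \<in> X" if pq: "p \<in> \<Union>C" "q \<in> \<Union>C" for p q
    proof -
      obtain X X' where "X \<in> C" "p \<in> X" "X' \<in> C" "q \<in> X'" using pq by blast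
      then show ?thesis using ch[of X X'] by blast
    qed
    have "right_submodule R M (\<Union>C)"
      unfolding right_submodule_iff
    proof (intro conjI ballI)
      show "\<Union>C \<subseteq> carrier M" using CF unfolding F_def right_submodule_iff by blast
      show "\<zero>\<^bsub>M\<^esub> \<in> \<Union>C" using CF ne unfolding F_def right_submodule_iff by blast
      show "x \<oplus>\<^bsub>M\<^esub> y \<in> \<Union>C" if "x \<in> \<Union>C" "y \<in> \<Union>C" for x y
        using both[OF that] CF unfolding F_def right_submodule_iff by blast
      show "x \<star>\<^bsub>M\<^esub> a \<in> \<Union>C" if "x \<in> \<Union>C" "a \<in> carrier R" for x a
        using that CF unfolding F_def right_submodule_iff by blast
    qed
    moreover have "\<Phi> p q" if "p \<in> \<Union>C" "q \<in> \<Union>C" for p q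
      using both[OF that] CF unfolding F_def by blast
    moreover have "N0 \<subseteq> \<Union>C" using CF ne unfolding F_def by blast
    ultimately show "\<Union>C \<in> F" unfolding F_def by blast
  qed
  then obtain N where N: "N \<in> F" and mx: "\<And>X. X \<in> F \<Longrightarrow> N \<subseteq> X \<Longrightarrow> X = N" by blast
  show ?thesis
  proof (rule exI[of _ N], intro conjI allI impI)
    fix N' assume "right_submodule R M N' \<and> N \<subseteq> N' \<and> (\<forall>p\<in>N'. \<forall>q\<in>N'. \<Phi> p q)"
    then show "N' = N" using mx[of N'] N unfolding F_def by blast
  qed (use N in \<open>auto simp: F_def\<close>)
qed

text \<open>A submodule maximal among those that meet \<open>N\<close> in zero is a complement: if \<open>xR\<close> met \<open>N + K\<close> in zero,
then \<open>K + xR\<close> would still meet \<open>N\<close> in zero. Starting from \<open>J\<close> serves to have a prescribed submodule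
inside the complement.\<close>

lemma complement_submodule:
  assumes N: "right_submodule R M N" and J: "right_submodule R M J" and NJ: "N \<inter> J = {\<zero>\<^bsub>M\<^esub>}"
  obtains K where "right_submodule R M K" "J \<subseteq> K" "N \<inter> K = {\<zero>\<^bsub>M\<^esub>}" "essential_submodule R M (N <+>\<^bsub>M\<^esub> K)"
proof -
  have "\<exists>K. right_submodule R M K \<and> J \<subseteq> K \<and> (\<forall>p\<in>K. \<forall>q\<in>K. p \<in> N \<longrightarrow> p = \<zero>\<^bsub>M\<^esub>) \<and>
    (\<forall>K'. right_submodule R M K' \<and> K \<subseteq> K' \<and> (\<forall>p\<in>K'. \<forall>q\<in>K'. p \<in> N \<longrightarrow> p = \<zero>\<^bsub>M\<^esub>) \<longrightarrow> K' = K)"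
    by (rule maximal_submodule[OF J, of "\<lambda>p q. p \<in> N \<longrightarrow> p = \<zero>\<^bsub>M\<^esub>"]) (use NJ in blast)
  then obtain K where K: "right_submodule R M K" and JK: "J \<subseteq> K"
    and dis': "\<forall>p\<in>K. \<forall>q\<in>K. p \<in> N \<longrightarrow> p = \<zero>\<^bsub>M\<^esub>"
    and mx': "\<forall>K'. right_submodule R M K' \<and> K \<subseteq> K' \<and> (\<forall>p\<in>K'. \<forall>q\<in>K'. p \<in> N \<longrightarrow> p = \<zero>\<^bsub>M\<^esub>) \<longrightarrow> K' = K"
    by (elim exE conjE)
  have dis: "p = \<zero>\<^bsub>M\<^esub>" if "p \<in> K" "p \<in> N" for p
    using dis' that by blast
  have mx: "K' = K" if "right_submodule R M K'" "K \<subseteq> K'" "\<And>p. p \<in> K' \<Longrightarrow> p \<in> N \<Longrightarrow> p = \<zero>\<^bsub>M\<^esub>" for K'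
    by (rule mx'[rule_format]) (use that JK in auto)
  note sub = submodule_set_add[OF N K]
  have "\<exists>a\<in>carrier R. x \<star>\<^bsub>M\<^esub> a \<noteq> \<zero>\<^bsub>M\<^esub> \<and> x \<star>\<^bsub>M\<^esub> a \<in> N <+>\<^bsub>M\<^esub> K"
    if x: "x \<in> carrier M" "x \<noteq> \<zero>\<^bsub>M\<^esub>" for x
  proof -
    let ?C = "{x \<star>\<^bsub>M\<^esub> a | a. a \<in> carrier R}"
    have xC: "x \<in> ?C" using x rsmult_one[of x] R.one_closed by (metis (mono_tags, lifting) mem_Collect_eq)
    have C: "right_submodule R M ?C" by (rule submodule_cyclic) (rule x)
    show ?thesis
    proof (cases "\<exists>p \<in> K <+>\<^bsub>M\<^esub> ?C. p \<in> N \<and> p \<noteq> \<zero>\<^bsub>M\<^esub>")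
      case False
      then have "K <+>\<^bsub>M\<^esub> ?C = K"
        using mx[OF submodule_set_add[OF K C]] set_add_left[OF K C] by blast
      then have "x \<in> K" using set_add_right[OF K C xC] by simp
      then show ?thesis using x set_add_right[OF N K] by (intro bexI[of _ "\<one>\<^bsub>R\<^esub>"]) auto
    next
      case True
      then obtain p k a where p: "p \<in> N" "p \<noteq> \<zero>\<^bsub>M\<^esub>" "k \<in> K" "a \<in> carrier R" "p = k \<oplus>\<^bsub>M\<^esub> x \<star>\<^bsub>M\<^esub> a"
        by (auto elim!: set_addE)
      note c = submodule_memD[OF N p(1)] submodule_memD[OF K p(3)]
      have "p \<oplus>\<^bsub>M\<^esub> \<ominus>\<^bsub>M\<^esub> k = x \<star>\<^bsub>M\<^esub> a"
        using p(4) c x unfolding p(5) by (simp add: M.a_ac M.r_neg1 M.r_neg2)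
      then have "x \<star>\<^bsub>M\<^esub> a \<in> N <+>\<^bsub>M\<^esub> K"
        using set_addI[OF p(1) submodule_neg[OF K p(3)], of M] by simp
      moreover have "x \<star>\<^bsub>M\<^esub> a \<noteq> \<zero>\<^bsub>M\<^esub>"
        using p dis[of p] c x by auto
      ultimately show ?thesis using p(4) by blast
    qed
  qed
  then have "essential_submodule R M (N <+>\<^bsub>M\<^esub> K)"
    using sub by (simp add: essential_submodule_iff)
  moreover have "N \<inter> K = {\<zero>\<^bsub>M\<^esub>}"
    using dis submodule_zero_mem[OF N] submodule_zero_mem[OF K] by blast
  ultimately show thesis using K JK that by blast
qed

end

section \<open>Right ideals and linear maps defined on them\<close>

text \<open>Homomorphisms from a right ideal are represented by functions that are only constrained on that ideal.\<close>

definition right_linear_on ::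
    "('a, 'r) ring_scheme \<Rightarrow> ('a, 'b, 'm) rmodule_scheme \<Rightarrow> 'a set \<Rightarrow> ('a \<Rightarrow> 'b) \<Rightarrow> bool" where
  "right_linear_on R M I h \<longleftrightarrow>
     (\<forall>x\<in>I. h x \<in> carrier M) \<and>
     (\<forall>x\<in>I. \<forall>y\<in>I. h (x \<oplus>\<^bsub>R\<^esub> y) = h x \<oplus>\<^bsub>M\<^esub> h y) \<and>
     (\<forall>x\<in>I. \<forall>a\<in>carrier R. h (x \<otimes>\<^bsub>R\<^esub> a) = h x \<star>\<^bsub>M\<^esub> a)"

abbreviation right_linear :: "('a, 'r) ring_scheme \<Rightarrow> 'a set \<Rightarrow> ('a \<Rightarrow> 'a) \<Rightarrow> bool" where
  "right_linear R \<equiv> right_linear_on R (right_regular_module R)"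

lemma right_linear_onI:
  assumes "\<And>x. x \<in> I \<Longrightarrow> h x \<in> carrier M"
    "\<And>x y. x \<in> I \<Longrightarrow> y \<in> I \<Longrightarrow> h (x \<oplus>\<^bsub>R\<^esub> y) = h x \<oplus>\<^bsub>M\<^esub> h y"
    "\<And>x a. x \<in> I \<Longrightarrow> a \<in> carrier R \<Longrightarrow> h (x \<otimes>\<^bsub>R\<^esub> a) = h x \<star>\<^bsub>M\<^esub> a"
  shows "right_linear_on R M I h"
  using assms by (simp add: right_linear_on_def)

lemma right_linear_on_closed: "right_linear_on R M I h \<Longrightarrow> x \<in> I \<Longrightarrow> h x \<in> carrier M"
  by (simp add: right_linear_on_def)

lemma right_linear_on_add:
  "right_linear_on R M I h \<Longrightarrow> x \<in> I \<Longrightarrow> y \<in> I \<Longrightarrow> h (x \<oplus>\<^bsub>R\<^esub> y) = h x \<oplus>\<^bsub>M\<^esub> h y"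
  by (simp add: right_linear_on_def)

lemma right_linear_on_mult:
  "right_linear_on R M I h \<Longrightarrow> x \<in> I \<Longrightarrow> a \<in> carrier R \<Longrightarrow> h (x \<otimes>\<^bsub>R\<^esub> a) = h x \<star>\<^bsub>M\<^esub> a"
  by (simp add: right_linear_on_def)

context ring
begin

interpretation reg: right_module R "right_regular_module R"
  by (rule right_module_regular) (rule ring_axioms)

lemmas right_ideal_iff = reg.right_submodule_iff[simplified]
lemmas essential_right_ideal_iff = reg.essential_submodule_iff[simplified]
lemmas right_ideal_zero = reg.submodule_zero[simplified]
lemmas right_ideal_memD = reg.submodule_memD[simplified]
lemmas right_ideal_zero_mem = reg.submodule_zero_mem[simplified]
lemmas right_ideal_add = reg.submodule_add[simplified]
lemmas right_ideal_mult = reg.submodule_rsmult[simplified]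
lemmas right_ideal_set_add = reg.submodule_set_add[simplified]
lemmas right_ideal_set_add_left = reg.set_add_left[simplified]
lemmas right_ideal_set_add_right = reg.set_add_right[simplified]
lemmas complement_right_ideal = reg.complement_submodule[simplified]

lemma right_ideal_neg: "right_ideal R I \<Longrightarrow> x \<in> I \<Longrightarrow> \<ominus> x \<in> I"
  using right_ideal_mult[of I x "\<ominus> \<one>"] right_ideal_memD[of I x] by (simp add: r_minus)

lemma right_ideal_diff: "right_ideal R I \<Longrightarrow> x \<in> I \<Longrightarrow> y \<in> I \<Longrightarrow> x \<ominus> y \<in> I"
  unfolding a_minus_def by (intro right_ideal_add right_ideal_neg)

lemma right_ideal_principal: "x \<in> carrier R \<Longrightarrow> right_ideal R (principal_right_ideal R x)"
  using reg.submodule_cyclic[of x] by (simp add: principal_right_ideal_def)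

lemma right_ideal_carrier: "right_ideal R (carrier R)"
  by (simp add: right_ideal_iff)

lemma essential_imp_right_ideal: "essential_right_ideal R I \<Longrightarrow> right_ideal R I"
  by (simp add: essential_submodule_def)

lemma essential_carrier: "essential_right_ideal R (carrier R)"
  unfolding essential_right_ideal_iff
  by (intro conjI right_ideal_carrier ballI impI bexI[of _ "\<one>"]) auto

lemma essential_superset:
  "essential_right_ideal R I \<Longrightarrow> right_ideal R J \<Longrightarrow> I \<subseteq> J \<Longrightarrow> essential_right_ideal R J"
  unfolding essential_right_ideal_iff by blast

text \<open>Serves to compare two maps at \<open>x\<close> after multiplying \<open>x\<close> into a right ideal on which they are known.
If \<open>xb = 0\<close>, then \<open>b\<close> itself belongs to the set; otherwise a multiple of \<open>xb\<close> is used.\<close>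

lemma essential_colon:
  assumes I: "essential_right_ideal R I" and x: "x \<in> carrier R"
  shows "essential_right_ideal R {a \<in> carrier R. x \<otimes> a \<in> I}"
  unfolding essential_right_ideal_iff
proof (intro conjI ballI impI)
  note rI = essential_imp_right_ideal[OF I]
  show "right_ideal R {a \<in> carrier R. x \<otimes> a \<in> I}"
    using x right_ideal_zero_mem[OF rI] right_ideal_add[OF rI] right_ideal_mult[OF rI]
    unfolding right_ideal_iff by (auto simp: r_distr m_assoc[symmetric])
  fix b assume b: "b \<in> carrier R" "b \<noteq> \<zero>"
  show "\<exists>a\<in>carrier R. b \<otimes> a \<noteq> \<zero> \<and> b \<otimes> a \<in> {a \<in> carrier R. x \<otimes> a \<in> I}"
  proof (cases "x \<otimes> b = \<zero>")
    case True
    then show ?thesis using b right_ideal_zero_mem[OF rI] by (intro bexI[of _ "\<one>"]) auto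
  next
    case False
    then obtain a where a: "a \<in> carrier R" "x \<otimes> b \<otimes> a \<noteq> \<zero>" "x \<otimes> b \<otimes> a \<in> I"
      using I x b unfolding essential_right_ideal_iff by blast
    then show ?thesis using b x by (intro bexI[of _ a]) (auto simp: m_assoc)
  qed
qed

lemma essential_Int:
  assumes I: "essential_right_ideal R I" and J: "essential_right_ideal R J"
  shows "essential_right_ideal R (I \<inter> J)"
  unfolding essential_right_ideal_iff
proof (intro conjI ballI impI)
  show "right_ideal R (I \<inter> J)"
    using I J unfolding essential_right_ideal_iff right_ideal_iff by blast
  fix x assume x: "x \<in> carrier R" "x \<noteq> \<zero>"
  then obtain a where a: "a \<in> carrier R" "x \<otimes> a \<noteq> \<zero>" "x \<otimes> a \<in> I"
    using I unfolding essential_right_ideal_iff by blast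
  then obtain b where b: "b \<in> carrier R" "x \<otimes> a \<otimes> b \<noteq> \<zero>" "x \<otimes> a \<otimes> b \<in> J"
    using J x unfolding essential_right_ideal_iff by blast
  show "\<exists>a\<in>carrier R. x \<otimes> a \<noteq> \<zero> \<and> x \<otimes> a \<in> I \<inter> J"
    using a b x right_ideal_mult[OF essential_imp_right_ideal[OF I] a(3) b(1)]
    by (intro bexI[of _ "a \<otimes> b"]) (auto simp: m_assoc)
qed

lemma right_linear_left_mult: "c \<in> carrier R \<Longrightarrow> I \<subseteq> carrier R \<Longrightarrow> right_linear R I ((\<otimes>) c)"
  by (intro right_linear_onI) (auto simp: r_distr m_assoc subset_iff)

lemma eq_if_minus_eq_zero:
  assumes "x \<in> carrier R" "y \<in> carrier R" "x \<ominus> y = \<zero>" shows "x = y"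
proof -
  have "x = (x \<ominus> y) \<oplus> y" using assms(1,2) by algebra
  then show ?thesis using assms by simp
qed

lemma direct_sum_unique:
  assumes "right_ideal R I" "right_ideal R J" "I \<inter> J = {\<zero>}"
    and "i \<in> I" "i' \<in> I" "j \<in> J" "j' \<in> J" "i \<oplus> j = i' \<oplus> j'"
  shows "i = i'" "j = j'"
proof -
  have c: "i \<in> carrier R" "i' \<in> carrier R" "j \<in> carrier R" "j' \<in> carrier R"
    using assms right_ideal_memD by blast+
  have "i \<ominus> i' = (i \<oplus> j) \<ominus> (i' \<oplus> j)" using c by algebra
  also have "\<dots> = j' \<ominus> j" unfolding assms(8) using c by algebra
  finally have "i \<ominus> i' = j' \<ominus> j" .
  then have "i \<ominus> i' \<in> I \<inter> J"
    using right_ideal_diff[OF assms(1,4,5)] right_ideal_diff[OF assms(2,7,6)] by simp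
  then have "i \<ominus> i' = \<zero>" using assms(3) by blast
  then show "i = i'" by (rule eq_if_minus_eq_zero[OF c(1,2)])
  then show "j = j'" using assms(8) c by simp
qed

end

locale nonsingular_ring = ring R for R (structure) +
  assumes right_nonsingular: "right_nonsingular_ring R"
begin

lemma essential_cancel:
  assumes I: "essential_right_ideal R I" and x: "x \<in> carrier R" and "\<And>a. a \<in> I \<Longrightarrow> x \<otimes> a = \<zero>"
  shows "x = \<zero>"
proof -
  have "essential_right_ideal R {a \<in> carrier R. x \<otimes> a \<in> {\<zero>}}"
    by (rule essential_superset[OF I])
      (use assms in \<open>auto simp: right_ideal_iff essential_right_ideal_iff r_distr m_assoc[symmetric]\<close>)
  then have "x \<in> Sing R (right_regular_module R)"
    using x by (simp add: Sing_def right_annihilator_def)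
  then show ?thesis
    using right_nonsingular by (simp add: right_nonsingular_ring_def nonsingular_module_def)
qed

lemma essential_nonzero:
  assumes "essential_right_ideal R I" "x \<in> carrier R" "x \<noteq> \<zero>"
  obtains a where "a \<in> I" "a \<in> carrier R" "x \<otimes> a \<noteq> \<zero>"
proof -
  have "\<exists>a\<in>I. x \<otimes> a \<noteq> \<zero>" by (rule ccontr) (use essential_cancel[OF assms(1,2)] assms(3) in blast)
  then show thesis using that right_ideal_memD[OF essential_imp_right_ideal[OF assms(1)]] by blast
qed

text \<open>This is the form in which non-singularity is mostly used: identities between elements are verified on
an essential sum of right ideals, on each of which the values are known.\<close>

lemma essential_eqI:
  assumes I: "essential_right_ideal R I" and x: "x \<in> carrier R" "y \<in> carrier R"
    and eq: "\<And>a. a \<in> I \<Longrightarrow> x \<otimes> a = y \<otimes> a"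
  shows "x = y"
proof -
  have "x \<ominus> y = \<zero>"
  proof (rule essential_cancel[OF I])
    fix a assume "a \<in> I"
    then show "(x \<ominus> y) \<otimes> a = \<zero>"
      using x eq[of a] right_ideal_memD[OF essential_imp_right_ideal[OF I]]
      by (simp add: a_minus_def l_distr l_minus r_neg)
  qed (use x in simp)
  then show ?thesis by (rule eq_if_minus_eq_zero[OF x])
qed

text \<open>The annihilator of a non-zero \<open>x\<close> is not essential, so some non-zero \<open>kR\<close> meets it in zero, and left
multiplication by \<open>x\<close> embeds \<open>kR\<close>.\<close>

lemma left_mult_injective_somewhere:
  assumes x: "x \<in> carrier R" "x \<noteq> \<zero>"
  obtains k where "k \<in> carrier R" "k \<noteq> \<zero>"
    "\<And>a. a \<in> carrier R \<Longrightarrow> x \<otimes> (k \<otimes> a) = \<zero> \<Longrightarrow> k \<otimes> a = \<zero>"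
proof -
  let ?I = "{a \<in> carrier R. x \<otimes> a = \<zero>}"
  have "right_ideal R ?I"
    using x by (auto simp: right_ideal_iff r_distr m_assoc[symmetric])
  moreover have "\<not> essential_right_ideal R ?I"
    using essential_cancel[of ?I x] x by blast
  ultimately obtain k where k: "k \<in> carrier R" "k \<noteq> \<zero>"
    "\<forall>a\<in>carrier R. k \<otimes> a \<noteq> \<zero> \<longrightarrow> k \<otimes> a \<notin> ?I"
    unfolding essential_right_ideal_iff by blast
  show thesis by (rule that[OF k(1,2)]) (use k x in auto)
qed

end

context right_module
begin

lemma right_linear_on_zero:
  assumes "right_ideal R I" "right_linear_on R M I h" shows "h \<zero>\<^bsub>R\<^esub> = \<zero>\<^bsub>M\<^esub>"
proof -
  have z: "\<zero>\<^bsub>R\<^esub> \<in> I" using assms(1) by (rule R.right_ideal_zero_mem)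
  have "h (\<zero>\<^bsub>R\<^esub> \<otimes>\<^bsub>R\<^esub> \<zero>\<^bsub>R\<^esub>) = h \<zero>\<^bsub>R\<^esub> \<star>\<^bsub>M\<^esub> \<zero>\<^bsub>R\<^esub>"
    by (rule right_linear_on_mult[OF assms(2) z]) simp
  then show ?thesis using right_linear_on_closed[OF assms(2) z] by simp
qed

lemma right_linear_on_zero_map: "right_linear_on R M I (\<lambda>x. \<zero>\<^bsub>M\<^esub>)"
  by (intro right_linear_onI) auto

lemma right_linear_on_glue:
  assumes I: "right_ideal R I" and J: "right_ideal R J" and IJ: "I \<inter> J = {\<zero>\<^bsub>R\<^esub>}"
    and f: "right_linear_on R M I f" and g: "right_linear_on R M J g"
  obtains k where "right_linear_on R M (I <+>\<^bsub>R\<^esub> J) k"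
    "\<And>i j. i \<in> I \<Longrightarrow> j \<in> J \<Longrightarrow> k (i \<oplus>\<^bsub>R\<^esub> j) = f i \<oplus>\<^bsub>M\<^esub> g j"
    "\<And>i. i \<in> I \<Longrightarrow> k i = f i" "\<And>j. j \<in> J \<Longrightarrow> k j = g j"
proof -
  define k where "k = (\<lambda>x. THE m. \<exists>i\<in>I. \<exists>j\<in>J. x = i \<oplus>\<^bsub>R\<^esub> j \<and> m = f i \<oplus>\<^bsub>M\<^esub> g j)"
  have k: "k (i \<oplus>\<^bsub>R\<^esub> j) = f i \<oplus>\<^bsub>M\<^esub> g j" if "i \<in> I" "j \<in> J" for i j
    unfolding k_def
  proof (rule the_equality)
    fix m assume "\<exists>i'\<in>I. \<exists>j'\<in>J. i \<oplus>\<^bsub>R\<^esub> j = i' \<oplus>\<^bsub>R\<^esub> j' \<and> m = f i' \<oplus>\<^bsub>M\<^esub> g j'"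
    then obtain i' j' where *: "i' \<in> I" "j' \<in> J" "i \<oplus>\<^bsub>R\<^esub> j = i' \<oplus>\<^bsub>R\<^esub> j'" "m = f i' \<oplus>\<^bsub>M\<^esub> g j'"
      by blast
    have "i = i'" "j = j'"
      using R.direct_sum_unique[OF I J IJ that(1) *(1) that(2) *(2) *(3)] by auto
    then show "m = f i \<oplus>\<^bsub>M\<^esub> g j" using * by simp
  qed (use that in blast)
  note c = R.right_ideal_memD[OF I] R.right_ideal_memD[OF J]
    right_linear_on_closed[OF f] right_linear_on_closed[OF g]
  note z = R.right_ideal_zero_mem[OF I] R.right_ideal_zero_mem[OF J]
  have lin: "right_linear_on R M (I <+>\<^bsub>R\<^esub> J) k"
  proof (rule right_linear_onI)
    show "k x \<in> carrier M" if "x \<in> I <+>\<^bsub>R\<^esub> J" for x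
      using that c by (auto elim!: set_addE simp: k)
    show "k (x \<oplus>\<^bsub>R\<^esub> y) = k x \<oplus>\<^bsub>M\<^esub> k y" if x: "x \<in> I <+>\<^bsub>R\<^esub> J" and y: "y \<in> I <+>\<^bsub>R\<^esub> J" for x y
    proof -
      obtain i j where ij: "i \<in> I" "j \<in> J" "x = i \<oplus>\<^bsub>R\<^esub> j" using x by (rule set_addE)
      obtain i' j' where ij': "i' \<in> I" "j' \<in> J" "y = i' \<oplus>\<^bsub>R\<^esub> j'" using y by (rule set_addE)
      have "x \<oplus>\<^bsub>R\<^esub> y = (i \<oplus>\<^bsub>R\<^esub> i') \<oplus>\<^bsub>R\<^esub> (j \<oplus>\<^bsub>R\<^esub> j')"
        using ij ij' c by (simp add: R.a_ac)
      then have "k (x \<oplus>\<^bsub>R\<^esub> y) = f (i \<oplus>\<^bsub>R\<^esub> i') \<oplus>\<^bsub>M\<^esub> g (j \<oplus>\<^bsub>R\<^esub> j')"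
        using k[OF R.right_ideal_add[OF I ij(1) ij'(1)] R.right_ideal_add[OF J ij(2) ij'(2)]] by simp
      then show ?thesis
        using ij ij' c by (simp add: k right_linear_on_add[OF f] right_linear_on_add[OF g] M.a_ac)
    qed
    show "k (x \<otimes>\<^bsub>R\<^esub> a) = k x \<star>\<^bsub>M\<^esub> a" if x: "x \<in> I <+>\<^bsub>R\<^esub> J" and a: "a \<in> carrier R" for x a
    proof -
      obtain i j where ij: "i \<in> I" "j \<in> J" "x = i \<oplus>\<^bsub>R\<^esub> j" using x by (rule set_addE)
      have "x \<otimes>\<^bsub>R\<^esub> a = i \<otimes>\<^bsub>R\<^esub> a \<oplus>\<^bsub>R\<^esub> j \<otimes>\<^bsub>R\<^esub> a"
        using ij c a by (simp add: R.l_distr)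
      then have "k (x \<otimes>\<^bsub>R\<^esub> a) = f (i \<otimes>\<^bsub>R\<^esub> a) \<oplus>\<^bsub>M\<^esub> g (j \<otimes>\<^bsub>R\<^esub> a)"
        using k[OF R.right_ideal_mult[OF I ij(1) a] R.right_ideal_mult[OF J ij(2) a]] by simp
      then show ?thesis
        using ij c a by (simp add: k right_linear_on_mult[OF f] right_linear_on_mult[OF g] rsmult_l_distr)
    qed
  qed
  have "k i = f i" if "i \<in> I" for i
    using k[OF that z(2)] that c right_linear_on_zero[OF J g] by simp
  moreover have "k j = g j" if "j \<in> J" for j
    using k[OF z(1) that] that c right_linear_on_zero[OF I f] by simp
  ultimately show thesis using that[OF lin k] by blast
qed

end

text \<open>The record \<open>rmodule\<close> extends that of rings, hence the fields \<open>mult\<close> and \<open>one\<close>, which have no meaning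
for a module. Submodules of the product serve as graphs of partially defined homomorphisms.\<close>

definition module_product ::
    "('a, 'b, 'm) rmodule_scheme \<Rightarrow> ('a, 'c, 'n) rmodule_scheme \<Rightarrow> ('a, 'b \<times> 'c) rmodule" where
  "module_product M N =
     \<lparr>carrier = carrier M \<times> carrier N, mult = undefined, one = undefined,
      zero = (\<zero>\<^bsub>M\<^esub>, \<zero>\<^bsub>N\<^esub>), add = (\<lambda>p q. (fst p \<oplus>\<^bsub>M\<^esub> fst q, snd p \<oplus>\<^bsub>N\<^esub> snd q)),
      rsmult = (\<lambda>p a. (fst p \<star>\<^bsub>M\<^esub> a, snd p \<star>\<^bsub>N\<^esub> a))\<rparr>"

lemma module_product_simps [simp]:
  "carrier (module_product M N) = carrier M \<times> carrier N"
  "zero (module_product M N) = (\<zero>\<^bsub>M\<^esub>, \<zero>\<^bsub>N\<^esub>)"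
  "p \<oplus>\<^bsub>module_product M N\<^esub> q = (fst p \<oplus>\<^bsub>M\<^esub> fst q, snd p \<oplus>\<^bsub>N\<^esub> snd q)"
  "p \<star>\<^bsub>module_product M N\<^esub> a = (fst p \<star>\<^bsub>M\<^esub> a, snd p \<star>\<^bsub>N\<^esub> a)"
  by (simp_all add: module_product_def)

lemma right_module_product:
  assumes "right_module R M" "right_module R N"
  shows "right_module R (module_product M N)"
proof -
  interpret M: right_module R M by fact
  interpret N: right_module R N by fact
  have "abelian_group (module_product M N)"
  proof (rule abelian_groupI)
    fix p assume p: "p \<in> carrier (module_product M N)"
    then show "\<exists>q\<in>carrier (module_product M N). q \<oplus>\<^bsub>module_product M N\<^esub> p = \<zero>\<^bsub>module_product M N\<^esub>"
      by (intro bexI[of _ "(\<ominus>\<^bsub>M\<^esub> fst p, \<ominus>\<^bsub>N\<^esub> snd p)"]) (auto simp: M.M.l_neg N.M.l_neg)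
  qed (auto simp: M.M.a_ac N.M.a_ac)
  then show ?thesis
    by (intro right_module.intro right_module_axioms.intro M.R.ring_axioms)
      (auto simp: M.rsmult_l_distr N.rsmult_l_distr M.rsmult_r_distr N.rsmult_r_distr
        M.rsmult_assoc N.rsmult_assoc)
qed

section \<open>Baer's criterion\<close>

text \<open>This is Baer's criterion: if a maximal extension of a homomorphism were not defined at \<open>y\<close>, it could
be extended by sending \<open>y\<close> to the element that represents the map taking \<open>a\<close> to the image of \<open>ya\<close>, on
the right ideal of all \<open>a\<close> for which \<open>ya\<close> lies in the domain. Essential right ideals suffice because a homomorphism can
be continued by zero on a complement of its domain.\<close>

lemma (in right_module) injective_module_if_extends_from_essential:
  assumes ext: "\<And>I h. essential_right_ideal R I \<Longrightarrow> right_linear_on R M I h \<Longrightarrow>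
      \<exists>e\<in>carrier M. \<forall>x\<in>I. h x = e \<star>\<^bsub>M\<^esub> x"
  shows "injective_module R M"
  unfolding injective_module_def injective_wrt_def
proof (intro conjI right_module_axioms allI impI, elim conjE)
  fix Y :: "('a, 'a) rmodule" and N h
  assume Ymod: "right_module R Y" and N: "right_submodule R Y N"
    and h: "h \<in> right_module_hom R (Y\<lparr>carrier := N\<rparr>) M"
  interpret Y: right_module R Y by (rule Ymod)
  interpret P: right_module R "module_product Y M"
    by (rule right_module_product[OF Ymod right_module_axioms])
  have ext': "\<exists>e\<in>carrier M. \<forall>x\<in>I. h x = e \<star>\<^bsub>M\<^esub> x"
    if I: "right_ideal R I" and h: "right_linear_on R M I h" for I h
  proof -
    have "I \<inter> {\<zero>\<^bsub>R\<^esub>} = {\<zero>\<^bsub>R\<^esub>}" using R.right_ideal_zero_mem[OF I] by blast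
    then obtain K where K: "right_ideal R K" "I \<inter> K = {\<zero>\<^bsub>R\<^esub>}" "essential_right_ideal R (I <+>\<^bsub>R\<^esub> K)"
      using R.complement_right_ideal[OF I R.right_ideal_zero] by blast
    obtain k where "right_linear_on R M (I <+>\<^bsub>R\<^esub> K) k" "\<And>i. i \<in> I \<Longrightarrow> k i = h i"
      by (rule right_linear_on_glue[OF I K(1,2) h right_linear_on_zero_map]) blast
    then show ?thesis
      using ext[OF K(3)] R.right_ideal_set_add_left[OF I K(1)] by metis
  qed
  have hM: "\<And>x. x \<in> N \<Longrightarrow> h x \<in> carrier M"
    and hadd: "\<And>x y. x \<in> N \<Longrightarrow> y \<in> N \<Longrightarrow> h (x \<oplus>\<^bsub>Y\<^esub> y) = h x \<oplus>\<^bsub>M\<^esub> h y"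
    and hact: "\<And>x a. x \<in> N \<Longrightarrow> a \<in> carrier R \<Longrightarrow> h (x \<star>\<^bsub>Y\<^esub> a) = h x \<star>\<^bsub>M\<^esub> a"
    using h by (auto simp: right_module_hom_def)
  have h0: "h \<zero>\<^bsub>Y\<^esub> = \<zero>\<^bsub>M\<^esub>"
    using hact[OF Y.submodule_zero_mem[OF N], of "\<zero>\<^bsub>R\<^esub>"] hM[OF Y.submodule_zero_mem[OF N]] by simp
  \<comment> \<open>The extensions of \<open>h\<close> are the single-valued submodules of the product above its graph.\<close>
  let ?G0 = "(\<lambda>y. (y, h y)) ` N"
  have G0: "right_submodule R (module_product Y M) ?G0"
    using Y.submodule_memD[OF N] Y.submodule_zero_mem[OF N] Y.submodule_add[OF N]
      Y.submodule_rsmult[OF N] hM hadd hact h0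
    unfolding P.right_submodule_iff by (auto simp: image_iff)
  have "\<exists>G. right_submodule R (module_product Y M) G \<and> ?G0 \<subseteq> G \<and>
      (\<forall>p\<in>G. \<forall>q\<in>G. fst p = \<zero>\<^bsub>Y\<^esub> \<longrightarrow> snd p = \<zero>\<^bsub>M\<^esub>) \<and>
      (\<forall>G'. right_submodule R (module_product Y M) G' \<and> G \<subseteq> G' \<and>
        (\<forall>p\<in>G'. \<forall>q\<in>G'. fst p = \<zero>\<^bsub>Y\<^esub> \<longrightarrow> snd p = \<zero>\<^bsub>M\<^esub>) \<longrightarrow> G' = G)"
    by (rule P.maximal_submodule[OF G0, of "\<lambda>p q. fst p = \<zero>\<^bsub>Y\<^esub> \<longrightarrow> snd p = \<zero>\<^bsub>M\<^esub>"])
      (auto simp: h0)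
  then obtain G where G: "right_submodule R (module_product Y M) G" and sub: "?G0 \<subseteq> G"
    and sv: "\<forall>p\<in>G. \<forall>q\<in>G. fst p = \<zero>\<^bsub>Y\<^esub> \<longrightarrow> snd p = \<zero>\<^bsub>M\<^esub>"
    and mx: "\<forall>G'. right_submodule R (module_product Y M) G' \<and> G \<subseteq> G' \<and>
        (\<forall>p\<in>G'. \<forall>q\<in>G'. fst p = \<zero>\<^bsub>Y\<^esub> \<longrightarrow> snd p = \<zero>\<^bsub>M\<^esub>) \<longrightarrow> G' = G"
    by (elim exE conjE)
  have GY: "x \<in> carrier Y" "m \<in> carrier M" if "(x, m) \<in> G" for x m
    using P.submodule_memD[OF G that] by auto
  have Gadd: "(x \<oplus>\<^bsub>Y\<^esub> y, m \<oplus>\<^bsub>M\<^esub> n) \<in> G" if "(x, m) \<in> G" "(y, n) \<in> G" for x m y n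
    using P.submodule_add[OF G that] by simp
  have Gact: "(x \<star>\<^bsub>Y\<^esub> a, m \<star>\<^bsub>M\<^esub> a) \<in> G" if "(x, m) \<in> G" "a \<in> carrier R" for x m a
    using P.submodule_rsmult[OF G that] by simp
  have Gneg: "(\<ominus>\<^bsub>Y\<^esub> x, \<ominus>\<^bsub>M\<^esub> m) \<in> G" if "(x, m) \<in> G" for x m
    using Gact[OF that, of "\<ominus>\<^bsub>R\<^esub> \<one>\<^bsub>R\<^esub>"] GY[OF that] by (simp add: rsmult_minus_one Y.rsmult_minus_one)
  have Guniq: "m = n" if "(x, m) \<in> G" "(x, n) \<in> G" for x m n
  proof -
    have "(\<zero>\<^bsub>Y\<^esub>, m \<oplus>\<^bsub>M\<^esub> \<ominus>\<^bsub>M\<^esub> n) \<in> G"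
      using Gadd[OF that(1) Gneg[OF that(2)]] GY[OF that(1)] by (simp add: Y.M.r_neg)
    then have "m \<oplus>\<^bsub>M\<^esub> \<ominus>\<^bsub>M\<^esub> n = \<zero>\<^bsub>M\<^esub>" using sv by fastforce
    then show ?thesis using GY that M.minus_equality[of m "\<ominus>\<^bsub>M\<^esub> n"] by auto
  qed
  have total: "\<exists>m. (y, m) \<in> G" if y: "y \<in> carrier Y" for y
  proof -
    define I where "I = {a \<in> carrier R. \<exists>m. (y \<star>\<^bsub>Y\<^esub> a, m) \<in> G}"
    define k where "k = (\<lambda>a. THE m. (y \<star>\<^bsub>Y\<^esub> a, m) \<in> G)"
    have kI: "k a = m" if "(y \<star>\<^bsub>Y\<^esub> a, m) \<in> G" for a m
      unfolding k_def using that Guniq by blast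
    have kG: "(y \<star>\<^bsub>Y\<^esub> a, k a) \<in> G" "a \<in> carrier R" if "a \<in> I" for a
      using that kI unfolding I_def by auto
    have addG: "(y \<star>\<^bsub>Y\<^esub> (a \<oplus>\<^bsub>R\<^esub> b), k a \<oplus>\<^bsub>M\<^esub> k b) \<in> G" if "a \<in> I" "b \<in> I" for a b
      using Gadd[OF kG(1)[OF that(1)] kG(1)[OF that(2)]] y kG(2) that by (simp add: Y.rsmult_r_distr)
    have actG: "(y \<star>\<^bsub>Y\<^esub> (a \<otimes>\<^bsub>R\<^esub> b), k a \<star>\<^bsub>M\<^esub> b) \<in> G" if "a \<in> I" "b \<in> carrier R" for a b
      using Gact[OF kG(1)[OF that(1)] that(2)] y kG(2) that by (simp add: Y.rsmult_assoc)
    have zG: "(y \<star>\<^bsub>Y\<^esub> \<zero>\<^bsub>R\<^esub>, \<zero>\<^bsub>M\<^esub>) \<in> G" using P.submodule_zero_mem[OF G] y by simp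
    have I: "right_ideal R I"
      unfolding R.right_ideal_iff
      using addG actG zG kG(2) unfolding I_def by blast
    have "right_linear_on R M I k"
      by (rule right_linear_onI) (use GY(2)[OF kG(1)] kI[OF addG] kI[OF actG] in auto)
    from ext'[OF I this] obtain e where e: "e \<in> carrier M" "\<And>a. a \<in> I \<Longrightarrow> k a = e \<star>\<^bsub>M\<^esub> a" by blast
    \<comment> \<open>Adjoining \<open>(y, e)\<close> keeps the graph single-valued, so it is in the graph by maximality.\<close>
    let ?C = "{(y, e) \<star>\<^bsub>module_product Y M\<^esub> a | a. a \<in> carrier R}"
    have C: "right_submodule R (module_product Y M) ?C"
      by (rule P.submodule_cyclic) (use e y in simp)
    have ye: "(y, e) \<in> ?C" using e y R.one_closed by force
    have "snd p = \<zero>\<^bsub>M\<^esub>" if pG: "p \<in> G <+>\<^bsub>module_product Y M\<^esub> ?C" and p0: "fst p = \<zero>\<^bsub>Y\<^esub>" for p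
    proof -
      obtain x m a where a: "a \<in> carrier R" and xm: "(x, m) \<in> G"
        and p: "p = (x \<oplus>\<^bsub>Y\<^esub> y \<star>\<^bsub>Y\<^esub> a, m \<oplus>\<^bsub>M\<^esub> e \<star>\<^bsub>M\<^esub> a)"
        using pG by (auto elim!: set_addE)
      have "\<ominus>\<^bsub>Y\<^esub> x = y \<star>\<^bsub>Y\<^esub> a"
        using p0 p GY[OF xm] y a by (intro Y.M.minus_equality) (auto simp: Y.M.a_comm)
      then have *: "(y \<star>\<^bsub>Y\<^esub> a, \<ominus>\<^bsub>M\<^esub> m) \<in> G" using Gneg[OF xm] by simp
      then have "a \<in> I" using a unfolding I_def by blast
      then have "e \<star>\<^bsub>M\<^esub> a = \<ominus>\<^bsub>M\<^esub> m" using e(2) kI[OF *] by simp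
      then show ?thesis using p GY[OF xm] by (simp add: M.r_neg)
    qed
    then have "G <+>\<^bsub>module_product Y M\<^esub> ?C = G"
      using P.submodule_set_add[OF G C] P.set_add_left[OF G C] by (intro mx[rule_format]) blast
    then show ?thesis using P.set_add_right[OF G C ye] by auto
  qed
  define g where "g = (\<lambda>y. THE m. (y, m) \<in> G)"
  have gI: "g y = m" if "(y, m) \<in> G" for y m
    unfolding g_def using that Guniq by blast
  have gG: "(y, g y) \<in> G" if "y \<in> carrier Y" for y
    using total[OF that] gI by auto
  have "g \<in> right_module_hom R Y M"
    unfolding right_module_hom_def
    using GY(2)[OF gG] gI[OF Gadd[OF gG gG]] gI[OF Gact[OF gG]] by blast
  moreover have "g y = h y" if "y \<in> N" for y
    using gI[of y "h y"] sub that by blast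
  ultimately show "\<exists>g\<in>right_module_hom R Y M. \<forall>y\<in>N. g y = h y" by blast
qed

section \<open>Regularity, automorphism-invariance and partial automorphisms\<close>

text \<open>The intrinsic form of automorphism-invariance: an isomorphism between essential right ideals is a
partial automorphism of the ring.\<close>

definition partial_automorphisms_extend :: "('a, 'r) ring_scheme \<Rightarrow> bool" where
  "partial_automorphisms_extend R \<longleftrightarrow>
     (\<forall>I h. essential_right_ideal R I \<and> right_linear R I h \<and> inj_on h I \<and>
        essential_right_ideal R (h ` I) \<longrightarrow> (\<exists>c\<in>carrier R. \<forall>x\<in>I. h x = c \<otimes>\<^bsub>R\<^esub> x))"

lemma partial_automorphisms_extendD:
  assumes "partial_automorphisms_extend R" "essential_right_ideal R I" "right_linear R I h"
    "inj_on h I" "essential_right_ideal R (h ` I)"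
  obtains c where "c \<in> carrier R" "\<And>x. x \<in> I \<Longrightarrow> h x = c \<otimes>\<^bsub>R\<^esub> x"
proof -
  have "\<exists>c\<in>carrier R. \<forall>x\<in>I. h x = c \<otimes>\<^bsub>R\<^esub> x"
    by (rule assms(1)[unfolded partial_automorphisms_extend_def, THEN spec[of _ I],
          THEN spec[of _ h], THEN mp]) (intro conjI assms)
  then show thesis using that by blast
qed

context ring
begin

interpretation reg: right_module R "right_regular_module R"
  by (rule right_module_regular) (rule ring_axioms)

lemma principal_right_ideal_subset:
  assumes "a \<in> principal_right_ideal R b" "b \<in> carrier R"
  shows "principal_right_ideal R a \<subseteq> principal_right_ideal R b"
  using assms unfolding principal_right_ideal_def by (force simp: m_assoc)

lemma principal_left_ideal_subset:
  assumes "a \<in> principal_left_ideal R b" "b \<in> carrier R"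
  shows "principal_left_ideal R a \<subseteq> principal_left_ideal R b"
proof -
  obtain c where "a = c \<otimes> b" "c \<in> carrier R" using assms unfolding principal_left_ideal_def by blast
  then show ?thesis
    using assms(2) by (auto simp: principal_left_ideal_def m_assoc[symmetric])
qed

lemma mem_principal_right_ideal: "b \<in> carrier R \<Longrightarrow> b \<in> principal_right_ideal R b"
  unfolding principal_right_ideal_def by (auto intro!: exI[of _ \<one>])

lemma principal_ideals_generated_by_idempotents:
  assumes a: "a \<in> carrier R" and b: "b \<in> carrier R" and aba: "a \<otimes> b \<otimes> a = a"
  shows "a \<otimes> b \<in> idempotents R" "principal_right_ideal R a = principal_right_ideal R (a \<otimes> b)"
    "b \<otimes> a \<in> idempotents R" "principal_left_ideal R a = principal_left_ideal R (b \<otimes> a)"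
proof -
  show "a \<otimes> b \<in> idempotents R" "b \<otimes> a \<in> idempotents R"
    using a b aba by (auto simp: idempotents_def m_assoc[symmetric]) (simp add: m_assoc)
  have r: "x \<otimes> y \<in> principal_right_ideal R x" "x \<otimes> y \<in> principal_left_ideal R y"
    if "x \<in> carrier R" "y \<in> carrier R" for x y
    using that unfolding principal_right_ideal_def principal_left_ideal_def by blast+
  show "principal_right_ideal R a = principal_right_ideal R (a \<otimes> b)"
    using a b aba r(1)[of "a \<otimes> b" a] r(1)[of a b] by (intro equalityI principal_right_ideal_subset) simp_all
  show "principal_left_ideal R a = principal_left_ideal R (b \<otimes> a)"
    using a b aba r(2)[of a "b \<otimes> a"] r(2)[of b a]
    by (intro equalityI principal_left_ideal_subset) (simp_all add: m_assoc)
qed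

text \<open>The elementwise form of von Neumann regularity is the one that transfers along products and that the
constructions below produce.\<close>

lemma regular_ring_iff:
  "regular_ring R \<longleftrightarrow> (\<forall>a\<in>carrier R. \<exists>b\<in>carrier R. a \<otimes> b \<otimes> a = a)"
proof
  assume reg: "regular_ring R"
  show "\<forall>a\<in>carrier R. \<exists>b\<in>carrier R. a \<otimes> b \<otimes> a = a"
  proof
    fix a assume a: "a \<in> carrier R"
    then obtain e where e: "e \<in> carrier R" "e \<otimes> e = e" "principal_right_ideal R a = principal_right_ideal R e"
      using reg by (auto simp: regular_ring_def idempotents_def)
    obtain y where y: "y \<in> carrier R" "e = a \<otimes> y"
      using mem_principal_right_ideal[OF e(1)] e(3) by (auto simp: principal_right_ideal_def)
    obtain x where x: "x \<in> carrier R" "a = e \<otimes> x"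
      using mem_principal_right_ideal[OF a] e(3) by (auto simp: principal_right_ideal_def)
    have "e \<otimes> a = a" unfolding x(2) using e x by (simp add: m_assoc[symmetric])
    then show "\<exists>b\<in>carrier R. a \<otimes> b \<otimes> a = a" using y by auto
  qed
next
  assume ex: "\<forall>a\<in>carrier R. \<exists>b\<in>carrier R. a \<otimes> b \<otimes> a = a"
  show "regular_ring R"
    unfolding regular_ring_def
  proof
    fix a assume a: "a \<in> carrier R"
    then obtain b where b: "b \<in> carrier R" "a \<otimes> b \<otimes> a = a" using ex by blast
    note * = principal_ideals_generated_by_idempotents[OF a b]
    show "(\<exists>e\<in>idempotents R. principal_right_ideal R a = principal_right_ideal R e) \<and>
      (\<exists>e\<in>idempotents R. principal_left_ideal R a = principal_left_ideal R e)"
      using * by blast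
  qed
qed

text \<open>If \<open>xyx = x\<close> then \<open>x\<close> and the idempotent \<open>yx\<close> have the same annihilator, and it meets \<open>yxR\<close> in zero;
so it is not essential unless \<open>x = 0\<close>.\<close>

lemma regular_ring_imp_right_nonsingular:
  assumes "regular_ring R" shows "right_nonsingular_ring R"
proof -
  have "x = \<zero>" if x: "x \<in> carrier R" and ess: "essential_right_ideal R {a \<in> carrier R. x \<otimes> a = \<zero>}" for x
  proof (rule ccontr)
    assume x0: "x \<noteq> \<zero>"
    obtain y where y: "y \<in> carrier R" "x \<otimes> y \<otimes> x = x"
      using assms x by (auto simp: regular_ring_iff)
    have "y \<otimes> x \<noteq> \<zero>" using x0 x y by (auto simp: m_assoc)
    then obtain a where a: "a \<in> carrier R" "y \<otimes> x \<otimes> a \<noteq> \<zero>" "x \<otimes> (y \<otimes> x \<otimes> a) = \<zero>"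
      using ess x y unfolding essential_right_ideal_iff by blast
    then have "x \<otimes> y \<otimes> x \<otimes> a = \<zero>" using x y(1) a by (simp add: m_assoc)
    then have "x \<otimes> a = \<zero>" unfolding y(2) .
    then show False using a x y by (simp add: m_assoc)
  qed
  moreover have "\<zero> \<in> Sing R (right_regular_module R)"
  proof -
    have "{a \<in> carrier R. \<zero> \<otimes> a = \<zero>} = carrier R" by auto
    then show ?thesis using essential_carrier by (simp add: Sing_def right_annihilator_def)
  qed
  ultimately show ?thesis
    by (auto simp: right_nonsingular_ring_def nonsingular_module_def Sing_def right_annihilator_def)
qed

lemma right_linear_image:
  assumes I: "right_ideal R I" and h: "right_linear R I h"
  shows "right_ideal R (h ` I)"
  unfolding right_ideal_iff
proof (intro conjI ballI)
  show "h ` I \<subseteq> carrier R" using right_linear_on_closed[OF h] by auto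
  show "\<zero> \<in> h ` I"
    using reg.right_linear_on_zero[OF I h] right_ideal_zero_mem[OF I] by (force simp: image_iff)
  show "x \<oplus> y \<in> h ` I" if "x \<in> h ` I" "y \<in> h ` I" for x y
    using that right_linear_on_add[OF h] right_ideal_add[OF I] by (force simp: image_iff)
  show "x \<otimes> a \<in> h ` I" if "x \<in> h ` I" "a \<in> carrier R" for x a
    using that right_linear_on_mult[OF h] right_ideal_mult[OF I] by (force simp: image_iff)
qed

lemma right_linear_inj_on:
  assumes I: "right_ideal R I" and h: "right_linear R I h" and ker: "\<And>x. x \<in> I \<Longrightarrow> h x = \<zero> \<Longrightarrow> x = \<zero>"
  shows "inj_on h I"
proof (rule inj_onI)
  fix x y assume xy: "x \<in> I" "y \<in> I" "h x = h y"
  note c = right_ideal_memD[OF I xy(1)] right_ideal_memD[OF I xy(2)]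
  have d: "x \<ominus> y \<in> I" using right_ideal_diff[OF I] xy by blast
  have "h x = h (x \<ominus> y) \<oplus> h y"
    using right_linear_on_add[OF h d xy(2)] c by (simp add: a_minus_def a_assoc l_neg)
  then have "h (x \<ominus> y) = \<zero>"
    using right_linear_on_closed[OF h d] right_linear_on_closed[OF h xy(2)] xy(3) by simp
  then show "x = y" using ker[OF d] eq_if_minus_eq_zero[OF c] by simp
qed

end

lemma right_module_homD:
  assumes "f \<in> right_module_hom R M N"
  shows "x \<in> carrier M \<Longrightarrow> f x \<in> carrier N"
    and "x \<in> carrier M \<Longrightarrow> y \<in> carrier M \<Longrightarrow> f (x \<oplus>\<^bsub>M\<^esub> y) = f x \<oplus>\<^bsub>N\<^esub> f y"
    and "x \<in> carrier M \<Longrightarrow> a \<in> carrier R \<Longrightarrow> f (x \<star>\<^bsub>M\<^esub> a) = f x \<star>\<^bsub>N\<^esub> a"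
  using assms by (auto simp: right_module_hom_def)

lemma right_module_hom_zero:
  assumes f: "f \<in> right_module_hom R M N" and M: "right_module R M" and N: "right_module R N"
  shows "f \<zero>\<^bsub>M\<^esub> = \<zero>\<^bsub>N\<^esub>"
proof -
  interpret M: right_module R M by fact
  interpret N: right_module R N by fact
  show ?thesis
    using right_module_homD(3)[OF f, of "\<zero>\<^bsub>M\<^esub>" "\<zero>\<^bsub>R\<^esub>"] right_module_homD(1)[OF f, of "\<zero>\<^bsub>M\<^esub>"] by simp
qed

text \<open>Both \<open>I = {a. f a \<in> R}\<close> and \<open>f I\<close> are essential because \<open>R\<close> is essential in its hull, so the restriction
of \<open>f\<close> is left multiplication by some \<open>c\<close>. Then \<open>f 1 - c\<close> is annihilated by \<open>I\<close>, and the hull inherits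
non-singularity from its essential submodule \<open>R\<close>; so \<open>f 1 = c\<close>, and \<open>f\<close> maps \<open>a\<close> to \<open>ca\<close>.\<close>

lemma (in nonsingular_ring) automorphism_invariant_if_partial_automorphisms_extend:
  assumes P: "partial_automorphisms_extend R"
  shows "right_automorphism_invariant_ring R"
  unfolding right_automorphism_invariant_ring_def automorphism_invariant_def
proof (intro allI impI ballI subsetI)
  fix E :: "('a, ('a, 'a) hull_elem) rmodule" and \<iota> f v
  assume hull: "is_injective_hull R (right_regular_module R) E \<iota>"
    and f: "f \<in> right_module_aut R E" and v: "v \<in> f ` \<iota> ` carrier (right_regular_module R)"
  have reg: "right_module R (right_regular_module R)"
    by (rule right_module_regular) (rule ring_axioms)
  have Emod: "right_module R E" using hull by (simp add: is_injective_hull_def injective_module_def)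
  interpret E: right_module R E by (rule Emod)
  have i: "\<iota> \<in> right_module_hom R (right_regular_module R) E" and inj: "inj_on \<iota> (carrier R)"
    and ess: "\<And>x. x \<in> carrier E \<Longrightarrow> x \<noteq> \<zero>\<^bsub>E\<^esub> \<Longrightarrow>
        \<exists>a\<in>carrier R. x \<star>\<^bsub>E\<^esub> a \<noteq> \<zero>\<^bsub>E\<^esub> \<and> x \<star>\<^bsub>E\<^esub> a \<in> \<iota> ` carrier R"
    using hull by (auto simp: is_injective_hull_def E.essential_submodule_iff)
  note ih = right_module_homD[OF i, simplified] and i0 = right_module_hom_zero[OF i reg Emod, simplified]
  have f': "f \<in> right_module_hom R E E" and bij: "bij_betw f (carrier E) (carrier E)"
    using f by (auto simp: right_module_aut_def)
  note fh = right_module_homD[OF f'] and f0 = right_module_hom_zero[OF f' Emod Emod]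
  have inji: "a = b" if "\<iota> a = \<iota> b" "a \<in> carrier R" "b \<in> carrier R" for a b
    using inj that by (auto dest: inj_onD)
  have injf: "x = y" if "f x = f y" "x \<in> carrier E" "y \<in> carrier E" for x y
    using bij that by (auto simp: bij_betw_def dest: inj_onD)
  define I where "I = {a \<in> carrier R. f (\<iota> a) \<in> \<iota> ` carrier R}"
  define h where "h = (\<lambda>a. inv_into (carrier R) \<iota> (f (\<iota> a)))"
  have h: "\<iota> (h a) = f (\<iota> a)" "h a \<in> carrier R" if "a \<in> I" for a
    using that by (auto simp: I_def h_def f_inv_into_f inv_into_into)
  have Ic: "a \<in> carrier R" if "a \<in> I" for a using that by (simp add: I_def)
  have II: "a \<in> I" "h a = b" if "f (\<iota> a) = \<iota> b" "a \<in> carrier R" "b \<in> carrier R" for a b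
  proof -
    show "a \<in> I" using that by (simp add: I_def)
    then show "h a = b" using h that inji by auto
  qed
  have addI: "f (\<iota> (a \<oplus> b)) = \<iota> (h a \<oplus> h b)" if "a \<in> I" "b \<in> I" for a b
    using that h Ic by (simp add: ih fh)
  have multI: "f (\<iota> (a \<otimes> b)) = \<iota> (h a \<otimes> b)" if "a \<in> I" "b \<in> carrier R" for a b
    using that h Ic by (simp add: ih fh)
  have rI: "right_ideal R I"
    unfolding right_ideal_iff
  proof (intro conjI ballI subsetI)
    show "\<zero> \<in> I" by (rule II(1)[of \<zero> \<zero>]) (simp_all add: i0 f0)
    show "a \<oplus> b \<in> I" if "a \<in> I" "b \<in> I" for a b
      by (rule II(1)[OF addI[OF that]]) (use that Ic h in auto)
    show "a \<otimes> b \<in> I" if "a \<in> I" "b \<in> carrier R" for a b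
      by (rule II(1)[OF multI[OF that]]) (use that Ic h in auto)
  qed (rule Ic)
  have linh: "right_linear R I h"
    by (rule right_linear_onI) (use h II(2)[OF addI] II(2)[OF multI] Ic in auto)
  have essI: "essential_right_ideal R I"
    unfolding essential_right_ideal_iff
  proof (intro conjI rI ballI impI)
    fix b assume b: "b \<in> carrier R" "b \<noteq> \<zero>"
    have fb: "f (\<iota> b) \<in> carrier E" by (rule fh(1)[OF ih(1)[OF b(1)]])
    have "f (\<iota> b) \<noteq> \<zero>\<^bsub>E\<^esub>"
      using b ih injf[of "\<iota> b" "\<zero>\<^bsub>E\<^esub>"] inji[of b \<zero>] by (auto simp: f0 i0)
    then obtain a where a: "a \<in> carrier R" "f (\<iota> b) \<star>\<^bsub>E\<^esub> a \<noteq> \<zero>\<^bsub>E\<^esub>" "f (\<iota> b) \<star>\<^bsub>E\<^esub> a \<in> \<iota> ` carrier R"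
      using ess[OF fb] by blast
    have eq: "f (\<iota> b) \<star>\<^bsub>E\<^esub> a = f (\<iota> (b \<otimes> a))" using a b by (simp add: ih fh)
    show "\<exists>a\<in>carrier R. b \<otimes> a \<noteq> \<zero> \<and> b \<otimes> a \<in> I"
      using a b unfolding eq by (intro bexI[of _ a]) (auto simp: I_def f0 i0)
  qed
  have injh: "inj_on h I"
  proof (rule right_linear_inj_on[OF rI linh])
    fix x assume x: "x \<in> I" "h x = \<zero>"
    have "f (\<iota> x) = f \<zero>\<^bsub>E\<^esub>" using h(1)[OF x(1)] unfolding x(2) i0 f0 by simp
    then have "\<iota> x = \<iota> \<zero>"
      unfolding i0 by (rule injf) (use ih(1)[OF Ic[OF x(1)]] in auto)
    then show "x = \<zero>" by (rule inji) (use Ic[OF x(1)] in auto)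
  qed
  have essh: "essential_right_ideal R (h ` I)"
    unfolding essential_right_ideal_iff
  proof (intro conjI right_linear_image[OF rI linh] ballI impI)
    fix b assume b: "b \<in> carrier R" "b \<noteq> \<zero>"
    have "\<iota> b \<in> f ` carrier E" using bij ih(1)[OF b(1)] by (simp add: bij_betw_def)
    then obtain x where x: "x \<in> carrier E" "f x = \<iota> b" by (elim imageE) auto
    have "\<iota> b \<noteq> \<zero>\<^bsub>E\<^esub>" using b inji[of b \<zero>] by (auto simp: i0)
    then have "x \<noteq> \<zero>\<^bsub>E\<^esub>" using x(2) f0 by auto
    then obtain a where a: "a \<in> carrier R" "x \<star>\<^bsub>E\<^esub> a \<noteq> \<zero>\<^bsub>E\<^esub>" "x \<star>\<^bsub>E\<^esub> a \<in> \<iota> ` carrier R"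
      using ess[OF x(1)] by blast
    then obtain c where c: "c \<in> carrier R" "x \<star>\<^bsub>E\<^esub> a = \<iota> c" by blast
    have "f (\<iota> c) = \<iota> (b \<otimes> a)" using c(2)[symmetric] x a b by (simp add: ih fh)
    then have "c \<in> I" "h c = b \<otimes> a" using II[of c "b \<otimes> a"] c(1) a(1) b(1) by auto
    moreover have "b \<otimes> a \<noteq> \<zero>"
    proof
      assume "b \<otimes> a = \<zero>"
      then have "f (x \<star>\<^bsub>E\<^esub> a) = f \<zero>\<^bsub>E\<^esub>"
        unfolding c(2) \<open>f (\<iota> c) = \<iota> (b \<otimes> a)\<close> by (simp add: i0 f0)
      then have "x \<star>\<^bsub>E\<^esub> a = \<zero>\<^bsub>E\<^esub>" by (rule injf) (use a x in auto)
      then show False using a by simp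
    qed
    ultimately show "\<exists>a\<in>carrier R. b \<otimes> a \<noteq> \<zero> \<and> b \<otimes> a \<in> h ` I" using a(1) by (intro bexI[of _ a] conjI image_eqI[of _ _ c]) simp_all
  qed
  obtain c where c: "c \<in> carrier R" "\<And>x. x \<in> I \<Longrightarrow> h x = c \<otimes> x"
    by (rule partial_automorphisms_extendD[OF P essI linh injh essh]) blast
  define d where "d = f (\<iota> \<one>) \<oplus>\<^bsub>E\<^esub> \<ominus>\<^bsub>E\<^esub> \<iota> c"
  have dE: "d \<in> carrier E" using c ih fh by (simp add: d_def)
  have dI: "d \<star>\<^bsub>E\<^esub> a = \<zero>\<^bsub>E\<^esub>" if "a \<in> I" for a
  proof -
    have "f (\<iota> \<one>) \<star>\<^bsub>E\<^esub> a = f (\<iota> (\<one> \<otimes> a))" using Ic[OF that] by (subst ih) (simp_all add: ih fh)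
    also have "\<dots> = \<iota> c \<star>\<^bsub>E\<^esub> a" using c h(1)[OF that] Ic[OF that] that by (simp add: ih)
    finally have 1: "f (\<iota> \<one>) \<star>\<^bsub>E\<^esub> a = \<iota> c \<star>\<^bsub>E\<^esub> a" .
    have "d \<star>\<^bsub>E\<^esub> a = f (\<iota> \<one>) \<star>\<^bsub>E\<^esub> a \<oplus>\<^bsub>E\<^esub> (\<ominus>\<^bsub>E\<^esub> \<iota> c) \<star>\<^bsub>E\<^esub> a"
      unfolding d_def using Ic[OF that] c by (intro E.rsmult_l_distr) (auto simp: ih fh)
    also have "\<dots> = (\<iota> c \<oplus>\<^bsub>E\<^esub> \<ominus>\<^bsub>E\<^esub> \<iota> c) \<star>\<^bsub>E\<^esub> a"
      unfolding 1 using Ic[OF that] c by (intro E.rsmult_l_distr[symmetric]) (auto simp: ih fh)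
    also have "\<dots> = \<zero>\<^bsub>E\<^esub>" using Ic[OF that] c ih by (simp add: E.M.r_neg)
    finally show ?thesis .
  qed
  \<comment> \<open>A non-zero multiple of \<open>d\<close> inside \<open>R\<close> would also be annihilated by an essential right ideal.\<close>
  have "d = \<zero>\<^bsub>E\<^esub>"
  proof (rule ccontr)
    assume "d \<noteq> \<zero>\<^bsub>E\<^esub>"
    from ess[OF dE this] obtain a b where ab: "a \<in> carrier R" "d \<star>\<^bsub>E\<^esub> a \<noteq> \<zero>\<^bsub>E\<^esub>"
      "d \<star>\<^bsub>E\<^esub> a = \<iota> b" "b \<in> carrier R" by (elim bexE conjE imageE)
    have "b = \<zero>"
    proof (rule essential_cancel[OF essential_colon[OF essI ab(1)] ab(4)])
      fix r assume "r \<in> {r \<in> carrier R. a \<otimes> r \<in> I}"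
      then have r: "r \<in> carrier R" "a \<otimes> r \<in> I" by auto
      have "\<iota> (b \<otimes> r) = d \<star>\<^bsub>E\<^esub> a \<star>\<^bsub>E\<^esub> r" unfolding ab(3) using ab(4) r(1) by (rule ih(3))
      also have "\<dots> = \<iota> \<zero>"
        unfolding E.rsmult_assoc[OF dE ab(1) r(1), symmetric] i0 using r(2) by (rule dI)
      finally show "b \<otimes> r = \<zero>" by (rule inji) (use ab(4) r(1) in auto)
    qed
    then show False using ab i0 by simp
  qed
  then have f1: "f (\<iota> \<one>) = \<iota> c"
    unfolding d_def using c ih fh E.M.minus_equality[of "f (\<iota> \<one>)" "\<ominus>\<^bsub>E\<^esub> \<iota> c"] by simp
  obtain a where a: "a \<in> carrier R" "v = f (\<iota> a)" using v by auto
  have "v = f (\<iota> (\<one> \<otimes> a))" using a by simp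
  also have "\<dots> = \<iota> (c \<otimes> a)" using a c by (simp only: ih fh f1 one_closed)
  finally show "v \<in> \<iota> ` carrier (right_regular_module R)" using a c by simp
qed

text \<open>Left multiplication by a unit \<open>u\<close> of \<open>Q\<close> is an automorphism of the hull \<open>Q\<close>, and it maps \<open>1\<close> to \<open>u\<close>.\<close>

lemma contains_units_if_automorphism_invariant:
  assumes ai: "right_automorphism_invariant_ring R"
  shows "contains_units_of_max_right_quotient_ring R"
  unfolding contains_units_of_max_right_quotient_ring_def
proof (intro allI impI subsetI)
  fix Q :: "('a, 'a) hull_elem ring" and \<iota> u
  assume Q: "is_max_right_quotient_ring R Q \<iota>" and u: "u \<in> Units Q"
  interpret Q: ring Q using Q by (simp add: is_max_right_quotient_ring_def)
  have hull: "is_injective_hull R (right_regular_module R) (restrict_scalars \<iota> Q) \<iota>"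
    and hom: "\<iota> \<in> ring_hom R Q"
    using Q by (simp_all add: is_max_right_quotient_ring_def)
  interpret R: ring R using hull
    by (simp add: is_injective_hull_def injective_module_def right_module_def)
  have uQ: "u \<in> carrier Q" using u by (rule Q.Units_closed)
  have "bij_betw ((\<otimes>\<^bsub>Q\<^esub>) u) (carrier Q) (carrier Q)"
    by (rule bij_betw_byWitness[where f' = "(\<otimes>\<^bsub>Q\<^esub>) (inv\<^bsub>Q\<^esub> u)"])
      (use u uQ in \<open>auto simp: Q.m_assoc[symmetric]\<close>)
  then have "(\<otimes>\<^bsub>Q\<^esub>) u \<in> right_module_aut R (restrict_scalars \<iota> Q)"
    using uQ ring_hom_closed[OF hom]
    by (auto simp: right_module_aut_def right_module_hom_def restrict_scalars_def Q.r_distr Q.m_assoc)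
  then have "(\<otimes>\<^bsub>Q\<^esub>) u ` \<iota> ` carrier R \<subseteq> \<iota> ` carrier R"
    using ai hull by (auto simp: right_automorphism_invariant_ring_def automorphism_invariant_def)
  moreover have "u = u \<otimes>\<^bsub>Q\<^esub> \<iota> \<one>\<^bsub>R\<^esub>" using uQ ring_hom_one[OF hom] by simp
  ultimately show "u \<in> \<iota> ` carrier R" using R.one_closed by blast
qed

section \<open>Homomorphisms between disjoint right ideals\<close>

abbreviation graph_submodule :: "('a, 'r) ring_scheme \<Rightarrow> ('a \<times> 'a) set \<Rightarrow> bool" where
  "graph_submodule R \<equiv>
     right_submodule R (module_product (right_regular_module R) (right_regular_module R))"

context ring
begin

interpretation reg: right_module R "right_regular_module R"
  by (rule right_module_regular) (rule ring_axioms)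

interpretation prod: right_module R "module_product (right_regular_module R) (right_regular_module R)"
  by (rule right_module_product) (rule reg.right_module_axioms)+

lemmas graph_submodule_iff = prod.right_submodule_iff[simplified]
lemmas maximal_graph_submodule = prod.maximal_submodule[simplified]

lemma graph_closed: "graph_submodule R H \<Longrightarrow> (x, y) \<in> H \<Longrightarrow> x \<in> carrier R"
    "graph_submodule R H \<Longrightarrow> (x, y) \<in> H \<Longrightarrow> y \<in> carrier R"
  by (auto simp: graph_submodule_iff)

lemma graph_zero: "graph_submodule R H \<Longrightarrow> (\<zero>, \<zero>) \<in> H"
  by (simp add: graph_submodule_iff)

lemma graph_add:
  assumes "graph_submodule R H" "(x, y) \<in> H" "(x', y') \<in> H" shows "(x \<oplus> x', y \<oplus> y') \<in> H"
  using prod.submodule_add[OF assms] by simp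

lemma graph_mult:
  assumes "graph_submodule R H" "(x, y) \<in> H" "a \<in> carrier R" shows "(x \<otimes> a, y \<otimes> a) \<in> H"
  using prod.submodule_rsmult[OF assms] by simp

lemma graph_submoduleI:
  assumes "\<And>x y. (x, y) \<in> H \<Longrightarrow> x \<in> carrier R \<and> y \<in> carrier R" "(\<zero>, \<zero>) \<in> H"
    "\<And>x y x' y'. (x, y) \<in> H \<Longrightarrow> (x', y') \<in> H \<Longrightarrow> (x \<oplus> x', y \<oplus> y') \<in> H"
    "\<And>x y a. (x, y) \<in> H \<Longrightarrow> a \<in> carrier R \<Longrightarrow> (x \<otimes> a, y \<otimes> a) \<in> H"
  shows "graph_submodule R H"
  using assms by (auto simp: graph_submodule_iff)

lemma graph_converse:
  assumes H: "graph_submodule R H" shows "graph_submodule R (H\<inverse>)"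
  by (rule graph_submoduleI)
    (use graph_closed[OF H] graph_zero[OF H] graph_add[OF H] graph_mult[OF H] in auto)

lemma graph_Domain:
  assumes H: "graph_submodule R H" shows "right_ideal R (Domain H)"
  unfolding right_ideal_iff
proof (intro conjI ballI subsetI)
  show "x \<in> carrier R" if "x \<in> Domain H" for x using that graph_closed[OF H] by auto
  show "\<zero> \<in> Domain H" using graph_zero[OF H] by blast
  show "x \<oplus> y \<in> Domain H" if "x \<in> Domain H" "y \<in> Domain H" for x y
    using that graph_add[OF H] by blast
  show "x \<otimes> a \<in> Domain H" if "x \<in> Domain H" "a \<in> carrier R" for x a
    using that graph_mult[OF H] by blast
qed

lemma graph_Range: "graph_submodule R H \<Longrightarrow> right_ideal R (Range H)"
  using graph_Domain[OF graph_converse, of H] by simp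

lemma graph_cyclic:
  assumes k: "k \<in> carrier R" "l \<in> carrier R"
  shows "graph_submodule R {(k \<otimes> a, l \<otimes> a) | a. a \<in> carrier R}"
  using prod.submodule_cyclic[of "(k, l)"] k by simp

text \<open>Serves to contradict the maximality of a graph \<open>H\<close>: the enlarged graph inherits a property of
\<open>H\<close> as soon as the two summands of its pairs can be told apart, for instance by idempotents.\<close>

lemma graph_adjoin:
  assumes H: "graph_submodule R H" and k: "k \<in> carrier R" "l \<in> carrier R"
  obtains H' where "graph_submodule R H'" "H \<subseteq> H'" "(k, l) \<in> H'"
    "\<And>p q. (p, q) \<in> H' \<Longrightarrow> \<exists>x y a. (x, y) \<in> H \<and> a \<in> carrier R \<and> p = x \<oplus> k \<otimes> a \<and> q = y \<oplus> l \<otimes> a"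
proof -
  let ?P = "module_product (right_regular_module R) (right_regular_module R)"
  let ?C = "{(k \<otimes> a, l \<otimes> a) | a. a \<in> carrier R}"
  have C: "graph_submodule R ?C" by (rule graph_cyclic) (rule k)+
  have "(k \<otimes> \<one>, l \<otimes> \<one>) \<in> ?C" by blast
  then have kl: "(k, l) \<in> ?C" using k by simp
  show thesis
  proof (rule that[of "H <+>\<^bsub>?P\<^esub> ?C"])
    show "graph_submodule R (H <+>\<^bsub>?P\<^esub> ?C)" by (rule prod.submodule_set_add[OF H C])
    show "H \<subseteq> H <+>\<^bsub>?P\<^esub> ?C" using prod.set_add_left[OF H C] by blast
    show "(k, l) \<in> H <+>\<^bsub>?P\<^esub> ?C" by (rule prod.set_add_right[OF H C kl])
    fix p q assume "(p, q) \<in> H <+>\<^bsub>?P\<^esub> ?C"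
    then obtain h c where h: "h \<in> H" and c: "c \<in> ?C" and pq: "(p, q) = h \<oplus>\<^bsub>?P\<^esub> c" by (rule set_addE)
    from c obtain a where "a \<in> carrier R" "c = (k \<otimes> a, l \<otimes> a)" by auto
    then show "\<exists>x y a. (x, y) \<in> H \<and> a \<in> carrier R \<and> p = x \<oplus> k \<otimes> a \<and> q = y \<oplus> l \<otimes> a"
      using h pq by (intro exI[of _ "fst h"] exI[of _ "snd h"] exI[of _ a]) simp
  qed
qed

lemma graph_function:
  assumes H: "graph_submodule R H" and sv: "\<And>y. (\<zero>, y) \<in> H \<Longrightarrow> y = \<zero>"
  obtains h where "right_linear R (Domain H) h" "\<And>x y. (x, y) \<in> H \<Longrightarrow> h x = y"
proof -
  define h where "h = (\<lambda>x. SOME y. (x, y) \<in> H)"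
  have hH: "(x, h x) \<in> H" if "(x, y) \<in> H" for x y
    unfolding h_def using that by (rule someI)
  have h: "h x = y" if xy: "(x, y) \<in> H" for x y
  proof -
    note c = graph_closed[OF H xy] graph_closed(2)[OF H hH[OF xy]]
    have "(x \<oplus> x \<otimes> (\<ominus> \<one>), h x \<oplus> y \<otimes> (\<ominus> \<one>)) \<in> H"
      by (rule graph_add[OF H hH[OF xy] graph_mult[OF H xy]]) simp
    moreover have "x \<oplus> x \<otimes> (\<ominus> \<one>) = \<zero>" "h x \<oplus> y \<otimes> (\<ominus> \<one>) = h x \<ominus> y"
      using c by (simp_all add: r_minus r_neg a_minus_def)
    ultimately have "h x \<ominus> y = \<zero>" using sv by simp
    then show ?thesis by (rule eq_if_minus_eq_zero[OF c(3) c(2)])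
  qed
  have "right_linear R (Domain H) h"
  proof (rule right_linear_onI)
    fix x assume x: "x \<in> Domain H"
    then have xh: "(x, h x) \<in> H" using hH by blast
    show "h x \<in> carrier (right_regular_module R)" using graph_closed(2)[OF H xh] by simp
    show "h (x \<otimes> a) = h x \<star>\<^bsub>right_regular_module R\<^esub> a" if "a \<in> carrier R" for a
      using h[OF graph_mult[OF H xh that]] by simp
    show "h (x \<oplus> y) = h x \<oplus>\<^bsub>right_regular_module R\<^esub> h y" if "y \<in> Domain H" for y
    proof -
      have "(y, h y) \<in> H" using that hH by blast
      then show ?thesis using h[OF graph_add[OF H xh]] by simp
    qed
  qed
  then show thesis using that h by blast
qed

end

context nonsingular_ring
begin

lemma eq_if_eq_on_direct_sum:
  assumes ess: "essential_right_ideal R (I <+>\<^bsub>R\<^esub> L)" and I: "I \<subseteq> carrier R" and L: "L \<subseteq> carrier R"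
    and x: "x \<in> carrier R" and y: "y \<in> carrier R"
    and "\<And>i. i \<in> I \<Longrightarrow> x \<otimes> i = y \<otimes> i" "\<And>l. l \<in> L \<Longrightarrow> x \<otimes> l = y \<otimes> l"
  shows "x = y"
proof (rule essential_eqI[OF ess x y])
  fix a assume "a \<in> I <+>\<^bsub>R\<^esub> L"
  then obtain i l where "i \<in> I" "l \<in> L" "a = i \<oplus> l" by (rule set_addE)
  then show "x \<otimes> a = y \<otimes> a" using assms by (simp add: r_distr subset_iff)
qed

end

locale partial_automorphism_extending_ring = nonsingular_ring +
  assumes partial_automorphisms_extend: "partial_automorphisms_extend R"
begin

interpretation reg: right_module R "right_regular_module R"
  by (rule right_module_regular) (rule ring_axioms)

text \<open>With \<open>M\<close> a complement of the domain that contains \<open>L\<close>, the map \<open>i + m \<mapsto> (i + h i) + m\<close> is a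
partial automorphism with inverse \<open>i + m \<mapsto> i + (m - h i)\<close>. If it is left multiplication by \<open>u\<close>,
then \<open>z = u - 1\<close> does what is required.\<close>

lemma homomorphism_into_disjoint_ideal_extends:
  assumes H: "graph_submodule R H" and sv: "\<And>y. (\<zero>, y) \<in> H \<Longrightarrow> y = \<zero>"
    and L: "right_ideal R L" and dis: "\<And>x. x \<in> Domain H \<Longrightarrow> x \<in> L \<Longrightarrow> x = \<zero>"
    and ran: "Range H \<subseteq> L"
  obtains z M where "z \<in> carrier R" "right_ideal R M" "L \<subseteq> M"
    "essential_right_ideal R (Domain H <+>\<^bsub>R\<^esub> M)"
    "\<And>x y. (x, y) \<in> H \<Longrightarrow> z \<otimes> x = y" "\<And>m. m \<in> M \<Longrightarrow> z \<otimes> m = \<zero>"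
proof -
  obtain h where h: "right_linear R (Domain H) h" and hH: "\<And>x y. (x, y) \<in> H \<Longrightarrow> h x = y"
    using graph_function[OF H sv] by blast
  note D = graph_Domain[OF H]
  have hL: "h x \<in> L" if "x \<in> Domain H" for x using that ran hH by auto
  have "Domain H \<inter> L = {\<zero>}"
    using dis right_ideal_zero_mem[OF D] right_ideal_zero_mem[OF L] by blast
  then obtain M where M: "right_ideal R M" "L \<subseteq> M" and DM: "Domain H \<inter> M = {\<zero>}"
    and ess: "essential_right_ideal R (Domain H <+>\<^bsub>R\<^esub> M)"
    using complement_right_ideal[OF D L] by blast
  note c = right_ideal_memD[OF D] right_ideal_memD[OF M(1)]
  have hM: "h x \<in> M" "h x \<in> carrier R" if "x \<in> Domain H" for x using hL[OF that] M c by auto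
  have f: "right_linear R (Domain H) (\<lambda>x. x \<oplus> h x)"
    using c hM right_linear_on_add[OF h] right_linear_on_mult[OF h]
    by (intro right_linear_onI) (simp_all add: a_ac l_distr)
  have g: "right_linear R M (\<lambda>x. x)"
    using c by (intro right_linear_onI) simp_all
  obtain k where k: "right_linear R (Domain H <+>\<^bsub>R\<^esub> M) k"
    and kv: "\<And>i j. i \<in> Domain H \<Longrightarrow> j \<in> M \<Longrightarrow> k (i \<oplus> j) = (i \<oplus> h i) \<oplus> j"
    and kD: "\<And>i. i \<in> Domain H \<Longrightarrow> k i = i \<oplus> h i" and kM: "\<And>j. j \<in> M \<Longrightarrow> k j = j"
    by (rule reg.right_linear_on_glue[OF D M(1) DM f g]) auto
  note S = essential_imp_right_ideal[OF ess]
  have inj: "inj_on k (Domain H <+>\<^bsub>R\<^esub> M)"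
  proof (rule right_linear_inj_on[OF S k])
    fix x assume x: "x \<in> Domain H <+>\<^bsub>R\<^esub> M" and kx: "k x = \<zero>"
    from x obtain i j where ij: "i \<in> Domain H" "j \<in> M" "x = i \<oplus> j" by (rule set_addE)
    have "i \<oplus> (h i \<oplus> j) = \<zero> \<oplus> \<zero>"
      using kx kv[OF ij(1,2)] ij c hM by (simp add: a_assoc)
    then have "i = \<zero>" "h i \<oplus> j = \<zero>"
      using direct_sum_unique[OF D M(1) DM ij(1) right_ideal_zero_mem[OF D]
          right_ideal_add[OF M(1) hM(1)[OF ij(1)] ij(2)] right_ideal_zero_mem[OF M(1)]] by blast+
    then show "x = \<zero>"
      using ij c reg.right_linear_on_zero[OF D h] by simp
  qed
  have "Domain H <+>\<^bsub>R\<^esub> M \<subseteq> k ` (Domain H <+>\<^bsub>R\<^esub> M)"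
  proof
    fix x assume "x \<in> Domain H <+>\<^bsub>R\<^esub> M"
    then obtain i j where ij: "i \<in> Domain H" "j \<in> M" "x = i \<oplus> j" by (rule set_addE)
    have j': "j \<ominus> h i \<in> M" by (rule right_ideal_diff[OF M(1) ij(2) hM(1)[OF ij(1)]])
    have "k (i \<oplus> (j \<ominus> h i)) = (i \<oplus> h i) \<oplus> (j \<ominus> h i)" by (rule kv[OF ij(1) j'])
    also have "\<dots> = x" unfolding ij(3) using c(1)[OF ij(1)] c(2)[OF ij(2)] hM(2)[OF ij(1)] by algebra
    finally show "x \<in> k ` (Domain H <+>\<^bsub>R\<^esub> M)"
      using set_addI[OF ij(1) j', of R] by (metis imageI)
  qed
  then have "essential_right_ideal R (k ` (Domain H <+>\<^bsub>R\<^esub> M))"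
    by (rule essential_superset[OF ess right_linear_image[OF S k]])
  then obtain u where u: "u \<in> carrier R" "\<And>x. x \<in> Domain H <+>\<^bsub>R\<^esub> M \<Longrightarrow> k x = u \<otimes> x"
    by (rule partial_automorphisms_extendD[OF partial_automorphisms_extend ess k inj]) blast
  have uD: "u \<otimes> i = i \<oplus> h i" if "i \<in> Domain H" for i
    using u(2)[OF right_ideal_set_add_left[OF D M(1) that]] kD[OF that] by simp
  have uM: "u \<otimes> j = j" if "j \<in> M" for j
    using u(2)[OF right_ideal_set_add_right[OF D M(1) that]] kM[OF that] by simp
  have um: "(u \<ominus> \<one>) \<otimes> x = u \<otimes> x \<ominus> x" if "x \<in> carrier R" for x
    using that u(1) by algebra
  show thesis
  proof (rule that[OF _ M ess, of "u \<ominus> \<one>"])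
    show "u \<ominus> \<one> \<in> carrier R" using u by simp
    show "(u \<ominus> \<one>) \<otimes> x = y" if xy: "(x, y) \<in> H" for x y
    proof -
      have x: "x \<in> Domain H" using xy by blast
      note c' = c(1)[OF x] hM(2)[OF x]
      have "(u \<ominus> \<one>) \<otimes> x = (x \<oplus> h x) \<ominus> x" by (simp only: um[OF c'(1)] uD[OF x])
      also have "\<dots> = h x" using c' by algebra
      finally show ?thesis using hH[OF xy] by simp
    qed
    show "(u \<ominus> \<one>) \<otimes> m = \<zero>" if m: "m \<in> M" for m
      using um[OF c(2)[OF m]] uM[OF m] c(2)[OF m] by (simp add: a_minus_def r_neg)
  qed
qed

text \<open>Both the isomorphism with graph \<open>H\<close> and its inverse are extended, each by zero on a complement; all the
identities between \<open>z\<close> and \<open>w\<close> hold because they hold on an essential sum of a domain and its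
complement. Prescribing parts \<open>L\<close> and \<open>L'\<close> of the complements controls how \<open>z\<close> and \<open>w\<close> interact with
idempotents that are already there.\<close>

lemma disjoint_isomorphic_ideals_give_generalized_inverses:
  assumes H: "graph_submodule R H" and bi: "\<And>x y. (x, y) \<in> H \<Longrightarrow> x = \<zero> \<longleftrightarrow> y = \<zero>"
    and L: "right_ideal R L" "\<And>x. x \<in> Domain H \<Longrightarrow> x \<in> L \<Longrightarrow> x = \<zero>" "Range H \<subseteq> L"
    and L': "right_ideal R L'" "\<And>y. y \<in> Range H \<Longrightarrow> y \<in> L' \<Longrightarrow> y = \<zero>" "Domain H \<subseteq> L'"
  obtains z w where "z \<in> carrier R" "w \<in> carrier R"
    "\<And>x y. (x, y) \<in> H \<Longrightarrow> z \<otimes> x = y \<and> w \<otimes> y = x"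
    "\<And>l. l \<in> L \<Longrightarrow> z \<otimes> l = \<zero>" "\<And>l. l \<in> L' \<Longrightarrow> w \<otimes> l = \<zero>"
    "z \<otimes> w \<otimes> z = z" "w \<otimes> z \<otimes> w = w" "z \<otimes> z = \<zero>" "w \<otimes> w = \<zero>"
    "\<And>a. a \<in> carrier R \<Longrightarrow> (\<And>y. y \<in> Range H \<Longrightarrow> a \<otimes> y = y) \<Longrightarrow> a \<otimes> z = z"
    "\<And>a. a \<in> carrier R \<Longrightarrow> (\<And>x. x \<in> Domain H \<Longrightarrow> a \<otimes> x = x) \<Longrightarrow> a \<otimes> w = w"
proof -
  note cl = graph_closed[OF H]
  have sv: "y = \<zero>" if "(\<zero>, y) \<in> H" for y using bi[OF that] by simp
  have sv': "y = \<zero>" if "(\<zero>, y) \<in> H\<inverse>" for y using bi[of y \<zero>] that by simp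
  obtain z M where z: "z \<in> carrier R" "right_ideal R M" "L \<subseteq> M"
    "essential_right_ideal R (Domain H <+>\<^bsub>R\<^esub> M)"
    "\<And>x y. (x, y) \<in> H \<Longrightarrow> z \<otimes> x = y" "\<And>m. m \<in> M \<Longrightarrow> z \<otimes> m = \<zero>"
    by (rule homomorphism_into_disjoint_ideal_extends[OF H sv L]) blast+
  obtain w M' where w: "w \<in> carrier R" "right_ideal R M'" "L' \<subseteq> M'"
    "essential_right_ideal R (Range H <+>\<^bsub>R\<^esub> M')"
    "\<And>x y. (x, y) \<in> H \<Longrightarrow> w \<otimes> y = x" "\<And>m. m \<in> M' \<Longrightarrow> w \<otimes> m = \<zero>"
    by (rule homomorphism_into_disjoint_ideal_extends[OF graph_converse[OF H] sv' L'(1)])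
      (use L' in auto)
  have eqz: "p = q" if "p \<in> carrier R" "q \<in> carrier R"
    "\<And>x y. (x, y) \<in> H \<Longrightarrow> p \<otimes> x = q \<otimes> x" "\<And>m. m \<in> M \<Longrightarrow> p \<otimes> m = q \<otimes> m" for p q
    by (rule eq_if_eq_on_direct_sum[OF z(4) _ _ that(1,2)])
      (use that(3,4) cl right_ideal_memD[OF z(2)] in auto)
  have eqw: "p = q" if "p \<in> carrier R" "q \<in> carrier R"
    "\<And>x y. (x, y) \<in> H \<Longrightarrow> p \<otimes> y = q \<otimes> y" "\<And>m. m \<in> M' \<Longrightarrow> p \<otimes> m = q \<otimes> m" for p q
    by (rule eq_if_eq_on_direct_sum[OF w(4) _ _ that(1,2)])
      (use that(3,4) cl right_ideal_memD[OF w(2)] in auto)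
  note Mc = right_ideal_memD[OF z(2)] right_ideal_memD[OF w(2)]
  note simps = m_assoc z(1) w(1) z(5,6) w(5,6) cl Mc
  have zy: "z \<otimes> y = \<zero>" if "(x, y) \<in> H" for x y
    using z(6)[of y] z(3) L(3) that by blast
  have wx: "w \<otimes> x = \<zero>" if "(x, y) \<in> H" for x y
    using w(6)[of x] w(3) L'(3) that by blast
  show thesis
  proof (rule that[OF z(1) w(1)])
    show "z \<otimes> x = y \<and> w \<otimes> y = x" if "(x, y) \<in> H" for x y using z(5) w(5) that by blast
    show "z \<otimes> l = \<zero>" if "l \<in> L" for l using z(3,6) that by blast
    show "w \<otimes> l = \<zero>" if "l \<in> L'" for l using w(3,6) that by blast
    show "z \<otimes> w \<otimes> z = z" by (rule eqz) (simp_all add: simps)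
    show "w \<otimes> z \<otimes> w = w" by (rule eqw) (simp_all add: simps)
    show "z \<otimes> z = \<zero>" by (rule eqz) (simp_all add: simps zy)
    show "w \<otimes> w = \<zero>" by (rule eqw) (simp_all add: simps wx)
    show "a \<otimes> z = z" if "a \<in> carrier R" "\<And>y. y \<in> Range H \<Longrightarrow> a \<otimes> y = y" for a
      by (rule eqz) (use that in \<open>auto simp: simps\<close>)
    show "a \<otimes> w = w" if "a \<in> carrier R" "\<And>x. x \<in> Domain H \<Longrightarrow> a \<otimes> x = x" for a
      by (rule eqw) (use that in \<open>auto simp: simps\<close>)
  qed
qed

end

section \<open>Maximal isomorphisms between right ideals\<close>

text \<open>For an idempotent \<open>g\<close> this says that \<open>gR\<close> is square-free: no non-zero \<open>kR\<close> inside \<open>gR\<close> is mapped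
isomorphically, by a left multiplication, onto a right ideal inside \<open>gR\<close> that meets \<open>kR\<close> in zero.\<close>

definition square_free_below :: "('a, 'r) ring_scheme \<Rightarrow> 'a \<Rightarrow> bool" where
  "square_free_below R g \<longleftrightarrow>
     (\<forall>k\<in>carrier R. \<forall>t\<in>carrier R. g \<otimes>\<^bsub>R\<^esub> k = k \<longrightarrow> g \<otimes>\<^bsub>R\<^esub> (t \<otimes>\<^bsub>R\<^esub> k) = t \<otimes>\<^bsub>R\<^esub> k \<longrightarrow>
        (\<forall>a\<in>carrier R. t \<otimes>\<^bsub>R\<^esub> (k \<otimes>\<^bsub>R\<^esub> a) = \<zero>\<^bsub>R\<^esub> \<longrightarrow> k \<otimes>\<^bsub>R\<^esub> a = \<zero>\<^bsub>R\<^esub>) \<longrightarrow>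
        (\<forall>a\<in>carrier R. \<forall>b\<in>carrier R. k \<otimes>\<^bsub>R\<^esub> a = t \<otimes>\<^bsub>R\<^esub> (k \<otimes>\<^bsub>R\<^esub> b) \<longrightarrow> k \<otimes>\<^bsub>R\<^esub> a = \<zero>\<^bsub>R\<^esub>) \<longrightarrow>
        k = \<zero>\<^bsub>R\<^esub>)"

text \<open>These equations make \<open>e\<close> an idempotent with \<open>ex = 0\<close>, and left multiplication by \<open>x\<close> an isomorphism
from \<open>eR\<close> onto a right ideal inside \<open>(1 - e)R\<close>, with inverse \<open>y\<close>.\<close>

definition embeds_in_complement :: "('a, 'r) ring_scheme \<Rightarrow> 'a \<Rightarrow> bool" where
  "embeds_in_complement R e \<longleftrightarrow>
     (\<exists>x\<in>carrier R. \<exists>y\<in>carrier R. e = y \<otimes>\<^bsub>R\<^esub> x \<and> x \<otimes>\<^bsub>R\<^esub> x = \<zero>\<^bsub>R\<^esub> \<and> x \<otimes>\<^bsub>R\<^esub> y \<otimes>\<^bsub>R\<^esub> x = x)"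

lemma square_free_belowD:
  assumes "square_free_below R g" "k \<in> carrier R" "t \<in> carrier R"
    "g \<otimes>\<^bsub>R\<^esub> k = k" "g \<otimes>\<^bsub>R\<^esub> (t \<otimes>\<^bsub>R\<^esub> k) = t \<otimes>\<^bsub>R\<^esub> k"
    "\<And>a. a \<in> carrier R \<Longrightarrow> t \<otimes>\<^bsub>R\<^esub> (k \<otimes>\<^bsub>R\<^esub> a) = \<zero>\<^bsub>R\<^esub> \<Longrightarrow> k \<otimes>\<^bsub>R\<^esub> a = \<zero>\<^bsub>R\<^esub>"
    "\<And>a b. a \<in> carrier R \<Longrightarrow> b \<in> carrier R \<Longrightarrow> k \<otimes>\<^bsub>R\<^esub> a = t \<otimes>\<^bsub>R\<^esub> (k \<otimes>\<^bsub>R\<^esub> b) \<Longrightarrow> k \<otimes>\<^bsub>R\<^esub> a = \<zero>\<^bsub>R\<^esub>"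
  shows "k = \<zero>\<^bsub>R\<^esub>"
proof -
  note sf = bspec[OF bspec[OF assms(1)[unfolded square_free_below_def] assms(2)] assms(3)]
  show ?thesis
    by (rule mp[OF mp[OF mp[OF mp[OF sf assms(4)] assms(5)]]]) (intro ballI impI assms(6,7); assumption)+
qed

lemma (in ring) cancel_left_assoc:
  assumes "x \<otimes> y = z" "x \<in> carrier R" "y \<in> carrier R" "a \<in> carrier R"
  shows "x \<otimes> (y \<otimes> a) = z \<otimes> a"
  using assms by (simp add: m_assoc[symmetric])

lemma (in ring) mult_diff_distrib:
  assumes "x \<in> carrier R" "y \<in> carrier R" "z \<in> carrier R"
  shows "x \<otimes> (y \<ominus> z) = x \<otimes> y \<ominus> x \<otimes> z" "(y \<ominus> z) \<otimes> x = y \<otimes> x \<ominus> z \<otimes> x"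
  using assms by (simp_all add: a_minus_def r_distr l_distr r_minus l_minus)

lemma (in ring) square_zero_pair_idempotents:
  assumes u: "u \<in> carrier R" and v: "v \<in> carrier R"
    and uvu: "u \<otimes> v \<otimes> u = u" and vuv: "v \<otimes> u \<otimes> v = v" and sq: "u \<otimes> u = \<zero>" "v \<otimes> v = \<zero>"
  defines "e \<equiv> v \<otimes> u" and "f \<equiv> u \<otimes> v"
  defines "g \<equiv> \<one> \<ominus> (e \<oplus> f)"
  shows "e \<otimes> e = e" "f \<otimes> f = f" "e \<otimes> f = \<zero>" "f \<otimes> e = \<zero>"
    "e \<otimes> g = \<zero>" "f \<otimes> g = \<zero>" "g \<otimes> e = \<zero>" "g \<otimes> g = g"
proof -
  have c: "e \<in> carrier R" "f \<in> carrier R" using u v by (simp_all add: e_def f_def)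
  show ee: "e \<otimes> e = e" and ff: "f \<otimes> f = f"
    using uvu vuv u v by (simp_all add: e_def f_def m_assoc)
  show ef: "e \<otimes> f = \<zero>"
    using u v by (simp add: e_def f_def m_assoc cancel_left_assoc[OF sq(1) u u])
  show fe: "f \<otimes> e = \<zero>"
    using u v by (simp add: e_def f_def m_assoc cancel_left_assoc[OF sq(2) v v])
  show eg: "e \<otimes> g = \<zero>" and fg: "f \<otimes> g = \<zero>" and "g \<otimes> e = \<zero>"
    using c by (simp_all add: g_def r_minus r_distr l_minus l_distr ee ff ef fe a_minus_def r_neg)
  have gR: "g \<in> carrier R" using c by (simp add: g_def)
  have "(\<one> \<ominus> (e \<oplus> f)) \<otimes> g = g \<ominus> (e \<otimes> g \<oplus> f \<otimes> g)"
    using c gR by (simp add: a_minus_def l_distr l_minus)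
  then have "g \<otimes> g = g \<ominus> (e \<otimes> g \<oplus> f \<otimes> g)" by (simp only: g_def[symmetric])
  then show "g \<otimes> g = g" using gR by (simp add: eg fg a_minus_def)
qed

text \<open>The elements of \<open>pRq\<close> are the homomorphisms from \<open>qR\<close> to \<open>pR\<close>; a non-zero one is injective on some non-zero
\<open>kR\<close> inside \<open>qR\<close>.\<close>

lemma (in nonsingular_ring) corner_vanishes:
  assumes p: "p \<in> carrier R" "p \<otimes> p = p" and q: "q \<in> carrier R" "q \<otimes> q = q"
    and none: "\<And>k t. k \<in> carrier R \<Longrightarrow> t \<in> carrier R \<Longrightarrow> q \<otimes> k = k \<Longrightarrow> p \<otimes> (t \<otimes> k) = t \<otimes> k \<Longrightarrow>
      (\<And>a. a \<in> carrier R \<Longrightarrow> t \<otimes> (k \<otimes> a) = \<zero> \<Longrightarrow> k \<otimes> a = \<zero>) \<Longrightarrow> k = \<zero>"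
    and s: "s \<in> carrier R"
  shows "p \<otimes> s \<otimes> q = \<zero>"
proof (rule ccontr)
  let ?t = "p \<otimes> s \<otimes> q"
  assume nz: "?t \<noteq> \<zero>"
  have t: "?t \<in> carrier R" using p q s by simp
  obtain k where k: "k \<in> carrier R" "k \<noteq> \<zero>"
    and inj: "\<And>a. a \<in> carrier R \<Longrightarrow> ?t \<otimes> (k \<otimes> a) = \<zero> \<Longrightarrow> k \<otimes> a = \<zero>"
    by (rule left_mult_injective_somewhere[OF t nz]) blast
  note qq = cancel_left_assoc[OF q(2) q(1,1)] and pp = cancel_left_assoc[OF p(2) p(1,1)]
  have "q \<otimes> k = \<zero>"
  proof (rule none[of _ ?t])
    fix a assume a: "a \<in> carrier R" "?t \<otimes> (q \<otimes> k \<otimes> a) = \<zero>"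
    then have "?t \<otimes> (k \<otimes> a) = \<zero>" using p q s k by (simp add: m_assoc qq)
    from inj[OF a(1) this] show "q \<otimes> k \<otimes> a = \<zero>" using q k a by (simp add: m_assoc)
  qed (use p q s k in \<open>simp_all add: m_assoc pp qq\<close>)
  then have "?t \<otimes> (k \<otimes> \<one>) = \<zero>" using p q s k by (simp add: m_assoc)
  then show False using inj[of \<one>] k by simp
qed

context partial_automorphism_extending_ring
begin

text \<open>A non-zero homomorphism from \<open>pR\<close> to \<open>qR\<close> is injective on some non-zero \<open>kR\<close> and can be inverted there, and as \<open>pR\<close> and
\<open>qR\<close> meet in zero the inverse extends to an element of \<open>pRq\<close>.\<close>

lemma corner_vanishes_sym:
  assumes p: "p \<in> carrier R" "p \<otimes> p = p" and q: "q \<in> carrier R" "q \<otimes> q = q"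
    and qp: "q \<otimes> p = \<zero>"
    and zero: "\<And>s. s \<in> carrier R \<Longrightarrow> p \<otimes> s \<otimes> q = \<zero>" and s: "s \<in> carrier R"
  shows "q \<otimes> s \<otimes> p = \<zero>"
proof (rule corner_vanishes[OF q p _ s])
  fix k t
  assume k: "k \<in> carrier R" and t: "t \<in> carrier R" and pk: "p \<otimes> k = k" and qtk: "q \<otimes> (t \<otimes> k) = t \<otimes> k"
    and inj: "\<And>a. a \<in> carrier R \<Longrightarrow> t \<otimes> (k \<otimes> a) = \<zero> \<Longrightarrow> k \<otimes> a = \<zero>"
  let ?H = "{(t \<otimes> k \<otimes> a, k \<otimes> a) | a. a \<in> carrier R}"
  have H: "graph_submodule R ?H" by (rule graph_cyclic) (use k t in auto)
  have L: "right_ideal R (principal_right_ideal R p)" by (rule right_ideal_principal[OF p(1)])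
  have sv: "y = \<zero>" if "(\<zero>, y) \<in> ?H" for y using that inj k t by (auto simp: m_assoc)
  have dis: "x = \<zero>" if xD: "x \<in> Domain ?H" and xp: "x \<in> principal_right_ideal R p" for x
  proof -
    from xD obtain a where a: "a \<in> carrier R" "x = t \<otimes> k \<otimes> a" by blast
    from xp obtain b where b: "b \<in> carrier R" "x = p \<otimes> b" unfolding principal_right_ideal_def by blast
    have "x = q \<otimes> x" using a k t q by (simp add: m_assoc[symmetric] qtk[unfolded m_assoc[OF q(1) t k, symmetric]])
    also have "\<dots> = q \<otimes> p \<otimes> b" using b p q by (simp add: m_assoc)
    finally show ?thesis using b by (simp add: qp)
  qed
  have ran: "Range ?H \<subseteq> principal_right_ideal R p"
  proof
    fix y assume "y \<in> Range ?H"
    then obtain a where a: "a \<in> carrier R" "y = k \<otimes> a" by blast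
    then have "y = p \<otimes> (k \<otimes> a)" using p k by (simp add: m_assoc[symmetric] pk)
    then show "y \<in> principal_right_ideal R p"
      using a k unfolding principal_right_ideal_def by blast
  qed
  obtain r where r: "r \<in> carrier R" "\<And>x y. (x, y) \<in> ?H \<Longrightarrow> r \<otimes> x = y"
    by (rule homomorphism_into_disjoint_ideal_extends[OF H sv L dis ran]) blast+
  have "(t \<otimes> k \<otimes> \<one>, k \<otimes> \<one>) \<in> ?H" by blast
  then have rk: "r \<otimes> (t \<otimes> k) = k" using r(2) k t by simp
  have "k = p \<otimes> r \<otimes> q \<otimes> (t \<otimes> k)" using p q r k t by (simp add: m_assoc qtk rk pk)
  then show "k = \<zero>" using zero[OF r(1)] k t by simp
qed

text \<open>A pair \<open>k\<close>, \<open>tk\<close> violating square-freeness of \<open>gR\<close> could be adjoined to the maximal isomorphism: the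
components of the new pairs in \<open>eR\<close>, \<open>fR\<close> and \<open>gR\<close> do not interfere.\<close>

lemma maximal_pair_of_disjoint_isomorphic_ideals:
  obtains u v where "u \<in> carrier R" "v \<in> carrier R" "u \<otimes> v \<otimes> u = u" "v \<otimes> u \<otimes> v = v"
    "u \<otimes> u = \<zero>" "v \<otimes> v = \<zero>" "square_free_below R (\<one> \<ominus> (v \<otimes> u \<oplus> u \<otimes> v))"
proof -
  \<comment> \<open>\<open>H\<close> is to be the graph of an isomorphism whose domain and range meet in zero.\<close>
  let ?\<Phi> = "\<lambda>p q. (fst p = snd q \<longrightarrow> fst p = \<zero>) \<and> (fst p = \<zero> \<longleftrightarrow> snd p = \<zero>)"
  have "\<exists>H. graph_submodule R H \<and> {(\<zero>, \<zero>)} \<subseteq> H \<and> (\<forall>p\<in>H. \<forall>q\<in>H. ?\<Phi> p q) \<and>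
    (\<forall>N. graph_submodule R N \<and> H \<subseteq> N \<and> (\<forall>p\<in>N. \<forall>q\<in>N. ?\<Phi> p q) \<longrightarrow> N = H)"
    by (rule maximal_graph_submodule[where \<Phi> = ?\<Phi>]) (auto intro: graph_submoduleI)
  then obtain H where H: "graph_submodule R H" and \<Phi>: "\<forall>p\<in>H. \<forall>q\<in>H. ?\<Phi> p q"
    and mx: "\<forall>N. graph_submodule R N \<and> H \<subseteq> N \<and> (\<forall>p\<in>N. \<forall>q\<in>N. ?\<Phi> p q) \<longrightarrow> N = H"
    by (elim exE conjE)
  have bi: "x = \<zero> \<longleftrightarrow> y = \<zero>" if "(x, y) \<in> H" for x y using \<Phi> that by fastforce
  have dis: "x = \<zero>" if "x \<in> Domain H" "x \<in> Range H" for x using \<Phi> that by fastforce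
  obtain u v where u: "u \<in> carrier R" and v: "v \<in> carrier R"
    and uv: "\<And>x y. (x, y) \<in> H \<Longrightarrow> u \<otimes> x = y \<and> v \<otimes> y = x"
    and uL: "\<And>l. l \<in> Range H \<Longrightarrow> u \<otimes> l = \<zero>" and vL: "\<And>l. l \<in> Domain H \<Longrightarrow> v \<otimes> l = \<zero>"
    and id: "u \<otimes> v \<otimes> u = u" "v \<otimes> u \<otimes> v = v" and sq: "u \<otimes> u = \<zero>" "v \<otimes> v = \<zero>"
    by (rule disjoint_isomorphic_ideals_give_generalized_inverses
        [OF H bi graph_Range[OF H] dis subset_refl graph_Domain[OF H] dis subset_refl]) blast+
  define e where "e = v \<otimes> u"
  define f where "f = u \<otimes> v"
  define g where "g = \<one> \<ominus> (e \<oplus> f)"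
  have c: "e \<in> carrier R" "f \<in> carrier R" "g \<in> carrier R" using u v by (simp_all add: e_def f_def g_def)
  note efg = square_zero_pair_idempotents[OF u v id sq, folded e_def f_def, folded g_def]
  note eg = efg(5) and fg = efg(6)
  have gx: "g \<otimes> x = x \<ominus> (e \<otimes> x \<oplus> f \<otimes> x)" if "x \<in> carrier R" for x
    using c(1,2) that by (simp add: g_def mult_diff_distrib l_distr)
  have HD: "e \<otimes> x = x" "f \<otimes> x = \<zero>" "e \<otimes> y = \<zero>" "f \<otimes> y = y" "x \<in> carrier R" "y \<in> carrier R"
    if xy: "(x, y) \<in> H" for x y
  proof -
    note cl = graph_closed[OF H xy]
    have "v \<otimes> x = \<zero>" "u \<otimes> y = \<zero>" using uL vL xy by blast+
    then show "e \<otimes> x = x" "f \<otimes> x = \<zero>" "e \<otimes> y = \<zero>" "f \<otimes> y = y" "x \<in> carrier R" "y \<in> carrier R"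
      using uv[OF xy] cl u v by (simp_all add: e_def f_def m_assoc)
  qed
  have "k = \<zero>"
    if k: "k \<in> carrier R" and t: "t \<in> carrier R" and gk: "g \<otimes> k = k" and gtk: "g \<otimes> (t \<otimes> k) = t \<otimes> k"
      and inj: "\<forall>a\<in>carrier R. t \<otimes> (k \<otimes> a) = \<zero> \<longrightarrow> k \<otimes> a = \<zero>"
      and kdis: "\<forall>a\<in>carrier R. \<forall>b\<in>carrier R. k \<otimes> a = t \<otimes> (k \<otimes> b) \<longrightarrow> k \<otimes> a = \<zero>" for k t
  proof -
    have tk: "t \<otimes> k \<in> carrier R" using k t by simp
    have "e \<otimes> (g \<otimes> k) = \<zero>" "e \<otimes> (g \<otimes> (t \<otimes> k)) = \<zero>" "f \<otimes> (g \<otimes> (t \<otimes> k)) = \<zero>"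
      using k tk by (simp_all add: cancel_left_assoc[OF eg c(1,3)] cancel_left_assoc[OF fg c(2,3)])
    then have ek: "e \<otimes> k = \<zero>" and etk: "e \<otimes> (t \<otimes> k) = \<zero>" and ftk: "f \<otimes> (t \<otimes> k) = \<zero>"
      by (simp_all only: gk gtk)
    obtain N where N: "graph_submodule R N" "H \<subseteq> N" "(k, t \<otimes> k) \<in> N"
      and N_mem: "\<And>p q. (p, q) \<in> N \<Longrightarrow>
        \<exists>x y a. (x, y) \<in> H \<and> a \<in> carrier R \<and> p = x \<oplus> k \<otimes> a \<and> q = y \<oplus> t \<otimes> k \<otimes> a"
      by (rule graph_adjoin[OF H k tk]) blast
    have dec: "\<exists>x y a. (x, y) \<in> H \<and> a \<in> carrier R \<and> p = x \<oplus> k \<otimes> a \<and> q = y \<oplus> t \<otimes> (k \<otimes> a) \<and>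
        e \<otimes> p = x \<and> g \<otimes> p = k \<otimes> a \<and> e \<otimes> q = \<zero> \<and> f \<otimes> q = y \<and> g \<otimes> q = t \<otimes> (k \<otimes> a)"
      if pqN: "(p, q) \<in> N" for p q
    proof -
      obtain x y a where xy: "(x, y) \<in> H" and a: "a \<in> carrier R"
        and pq: "p = x \<oplus> k \<otimes> a" "q = y \<oplus> t \<otimes> k \<otimes> a" using N_mem[OF pqN] by blast
      note h = HD[OF xy]
      have gxy: "g \<otimes> x = \<zero>" "g \<otimes> y = \<zero>" using h by (simp_all add: gx a_minus_def r_neg)
      have "e \<otimes> p = x" "g \<otimes> p = k \<otimes> a"
        using h a k c gxy unfolding pq
        by (simp_all add: r_distr cancel_left_assoc[OF ek c(1) k] cancel_left_assoc[OF gk c(3) k])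
      moreover have "e \<otimes> q = \<zero>" "f \<otimes> q = y" "g \<otimes> q = t \<otimes> k \<otimes> a"
        using h a tk c gxy unfolding pq
        by (simp_all add: r_distr cancel_left_assoc[OF etk c(1) tk] cancel_left_assoc[OF ftk c(2) tk]
            cancel_left_assoc[OF gtk c(3) tk])
      ultimately show ?thesis
        using xy a pq k t by (intro exI[of _ x] exI[of _ y] exI[of _ a]) (simp add: m_assoc)
    qed
    have "N = H"
    proof (rule mx[rule_format], intro conjI N(1,2) ballI)
      fix P Q assume PQ: "P \<in> N" "Q \<in> N"
      have PN: "(fst P, snd P) \<in> N" and QN: "(fst Q, snd Q) \<in> N" using PQ by simp_all
      from dec[OF PN] obtain x y a where P: "(x, y) \<in> H" "a \<in> carrier R" "fst P = x \<oplus> k \<otimes> a"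
        "snd P = y \<oplus> t \<otimes> (k \<otimes> a)" "e \<otimes> fst P = x" "g \<otimes> fst P = k \<otimes> a" "f \<otimes> snd P = y"
        "g \<otimes> snd P = t \<otimes> (k \<otimes> a)" by (elim exE conjE)
      from dec[OF QN] obtain b where Q: "b \<in> carrier R" "e \<otimes> snd Q = \<zero>" "g \<otimes> snd Q = t \<otimes> (k \<otimes> b)"
        by (elim exE conjE)
      note h = HD[OF P(1)]
      show "fst P = snd Q \<longrightarrow> fst P = \<zero>"
      proof
        assume eq: "fst P = snd Q"
        have "x = \<zero>" using P(5) Q(2) unfolding eq by simp
        moreover have "k \<otimes> a = t \<otimes> (k \<otimes> b)" using P(6) Q(3) unfolding eq by simp
        then have "k \<otimes> a = \<zero>" using kdis P(2) Q(1) by blast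
        ultimately show "fst P = \<zero>" using P(3) by simp
      qed
      show "(fst P = \<zero>) = (snd P = \<zero>)"
      proof
        assume eq: "fst P = \<zero>"
        have "e \<otimes> fst P = \<zero>" "g \<otimes> fst P = \<zero>" unfolding eq using c by simp_all
        then have "x = \<zero>" "k \<otimes> a = \<zero>" by (simp_all only: P(5,6))
        then show "snd P = \<zero>" using P(4) bi[OF P(1)] t by simp
      next
        assume eq: "snd P = \<zero>"
        have "f \<otimes> snd P = \<zero>" "g \<otimes> snd P = \<zero>" unfolding eq using c by simp_all
        then have "y = \<zero>" "t \<otimes> (k \<otimes> a) = \<zero>" by (simp_all only: P(7,8))
        then have "x = \<zero>" "k \<otimes> a = \<zero>" using P(2) bi[OF P(1)] inj by simp_all
        then show "fst P = \<zero>" using P(3) by simp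
      qed
    qed
    \<comment> \<open>So \<open>k\<close> lies in the domain of \<open>H\<close>, on which \<open>e\<close> is the identity, whereas \<open>ek = 0\<close>.\<close>
    then have "(k, t \<otimes> k) \<in> H" using N by simp
    then show "k = \<zero>" using HD(1) ek by simp
  qed
  then have "square_free_below R g" unfolding square_free_below_def by blast
  then show thesis using that[OF u v id sq] by (simp add: e_def f_def g_def)
qed

text \<open>The complements contain \<open>(1 - g)R\<close> and \<open>(1 - e)R\<close>, which forces \<open>z = zg\<close> and \<open>w = we\<close>. A homomorphism
from \<open>(g - wz)R\<close> to \<open>(e - zw)R\<close> that is injective on some \<open>kR\<close> could be adjoined to the maximal
isomorphism.\<close>

lemma maximal_isomorphism_between_corners:
  assumes e: "e \<in> carrier R" "e \<otimes> e = e" and g: "g \<in> carrier R" "g \<otimes> g = g"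
    and eg: "e \<otimes> g = \<zero>" and ge: "g \<otimes> e = \<zero>"
  obtains z w where "z \<in> carrier R" "w \<in> carrier R" "z \<otimes> w \<otimes> z = z" "w \<otimes> z \<otimes> w = w"
    "e \<otimes> z = z" "z \<otimes> g = z" "g \<otimes> w = w" "w \<otimes> e = w"
    "\<And>s. s \<in> carrier R \<Longrightarrow> (e \<ominus> z \<otimes> w) \<otimes> s \<otimes> (g \<ominus> w \<otimes> z) = \<zero>"
proof -
  \<comment> \<open>\<open>H\<close> is to be the graph of an isomorphism from a right ideal inside \<open>gR\<close> to one inside \<open>eR\<close>.\<close>
  let ?\<Phi> = "\<lambda>p q. g \<otimes> fst p = fst p \<and> e \<otimes> snd p = snd p \<and> (fst p = \<zero> \<longleftrightarrow> snd p = \<zero>)"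
  have "\<exists>H. graph_submodule R H \<and> {(\<zero>, \<zero>)} \<subseteq> H \<and> (\<forall>p\<in>H. \<forall>q\<in>H. ?\<Phi> p q) \<and>
    (\<forall>N. graph_submodule R N \<and> H \<subseteq> N \<and> (\<forall>p\<in>N. \<forall>q\<in>N. ?\<Phi> p q) \<longrightarrow> N = H)"
    by (rule maximal_graph_submodule[where \<Phi> = ?\<Phi>]) (use e g in \<open>auto intro: graph_submoduleI\<close>)
  then obtain H where H: "graph_submodule R H" and \<Phi>: "\<forall>p\<in>H. \<forall>q\<in>H. ?\<Phi> p q"
    and mx: "\<forall>N. graph_submodule R N \<and> H \<subseteq> N \<and> (\<forall>p\<in>N. \<forall>q\<in>N. ?\<Phi> p q) \<longrightarrow> N = H"
    by (elim exE conjE)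
  have bi: "x = \<zero> \<longleftrightarrow> y = \<zero>" and gH: "g \<otimes> x = x" and eH: "e \<otimes> y = y" if "(x, y) \<in> H" for x y
    using \<Phi> that by fastforce+
  note cl = graph_closed[OF H]
  have compl: "right_ideal R (principal_right_ideal R (\<one> \<ominus> a))" if "a \<in> carrier R" for a
    using that by (simp add: right_ideal_principal)
  have mem: "y \<in> principal_right_ideal R (\<one> \<ominus> a)"
    if "a \<in> carrier R" "b \<in> carrier R" "a \<otimes> b = \<zero>" "b \<otimes> y = y" "y \<in> carrier R" for a b y
  proof -
    have "a \<otimes> (b \<otimes> y) = \<zero>" using cancel_left_assoc[OF that(3,1,2,5)] that(5) by (simp only: l_null)
    then have "a \<otimes> y = \<zero>" by (simp only: that(4))
    then have "y = (\<one> \<ominus> a) \<otimes> y" using that by (simp add: a_minus_def l_distr l_minus)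
    then show ?thesis unfolding principal_right_ideal_def using that(5) by blast
  qed
  have nmem: "x = \<zero>"
    if a: "a \<in> carrier R" "a \<otimes> a = a" and x: "a \<otimes> x = x" and m: "x \<in> principal_right_ideal R (\<one> \<ominus> a)" for a x
  proof -
    obtain b where b: "b \<in> carrier R" "x = (\<one> \<ominus> a) \<otimes> b" using m unfolding principal_right_ideal_def by blast
    have "a \<otimes> x = a \<otimes> b \<ominus> a \<otimes> a \<otimes> b" unfolding b(2) using a(1) b(1) by (simp add: mult_diff_distrib m_assoc)
    then show ?thesis using a b x by (simp add: a_minus_def r_neg)
  qed
  have Range_sub: "Range H \<subseteq> principal_right_ideal R (\<one> \<ominus> g)"
    using mem[OF g(1) e(1) ge] eH cl by blast
  have Domain_sub: "Domain H \<subseteq> principal_right_ideal R (\<one> \<ominus> e)"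
    using mem[OF e(1) g(1) eg] gH cl by blast
  have D_dis: "x = \<zero>" if "x \<in> Domain H" "x \<in> principal_right_ideal R (\<one> \<ominus> g)" for x
    using nmem[OF g _ that(2)] gH that(1) by blast
  have R_dis: "x = \<zero>" if "x \<in> Range H" "x \<in> principal_right_ideal R (\<one> \<ominus> e)" for x
    using nmem[OF e _ that(2)] eH that(1) by blast
  obtain z w where z: "z \<in> carrier R" and w: "w \<in> carrier R"
    and zw: "\<And>x y. (x, y) \<in> H \<Longrightarrow> z \<otimes> x = y \<and> w \<otimes> y = x"
    and zL: "\<And>l. l \<in> principal_right_ideal R (\<one> \<ominus> g) \<Longrightarrow> z \<otimes> l = \<zero>"
    and wL: "\<And>l. l \<in> principal_right_ideal R (\<one> \<ominus> e) \<Longrightarrow> w \<otimes> l = \<zero>"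
    and id: "z \<otimes> w \<otimes> z = z" "w \<otimes> z \<otimes> w = w"
    and az: "\<And>a. a \<in> carrier R \<Longrightarrow> (\<And>y. y \<in> Range H \<Longrightarrow> a \<otimes> y = y) \<Longrightarrow> a \<otimes> z = z"
    and aw: "\<And>a. a \<in> carrier R \<Longrightarrow> (\<And>x. x \<in> Domain H \<Longrightarrow> a \<otimes> x = x) \<Longrightarrow> a \<otimes> w = w"
    by (rule disjoint_isomorphic_ideals_give_generalized_inverses
        [OF H bi compl[OF g(1)] D_dis Range_sub compl[OF e(1)] R_dis Domain_sub]) blast+
  have ez: "e \<otimes> z = z" using az[OF e(1)] eH by blast
  have gw: "g \<otimes> w = w" using aw[OF g(1)] gH by blast
  have right_id: "b \<otimes> a = b"
    if a: "a \<in> carrier R" and b: "b \<in> carrier R" and bL: "\<And>l. l \<in> principal_right_ideal R (\<one> \<ominus> a) \<Longrightarrow> b \<otimes> l = \<zero>" for a b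
  proof -
    have "b \<otimes> (\<one> \<ominus> a) = \<zero>" by (rule bL) (use a in \<open>simp add: mem_principal_right_ideal\<close>)
    moreover have "b \<otimes> (\<one> \<ominus> a) = b \<ominus> b \<otimes> a" using a b by (simp add: mult_diff_distrib)
    ultimately show ?thesis using eq_if_minus_eq_zero[of b "b \<otimes> a"] a b by simp
  qed
  have zg: "z \<otimes> g = z" by (rule right_id[OF g(1) z zL])
  have we: "w \<otimes> e = w" by (rule right_id[OF e(1) w wL])
  define d where "d = g \<ominus> w \<otimes> z"
  define e' where "e' = e \<ominus> z \<otimes> w"
  have c: "d \<in> carrier R" "e' \<in> carrier R" using e g z w by (simp_all add: d_def e'_def)
  have idz: "w \<otimes> (z \<otimes> (w \<otimes> z)) = w \<otimes> z" "z \<otimes> (w \<otimes> (z \<otimes> w)) = z \<otimes> w"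
    using id z w by (simp_all add: m_assoc)
  have gwz: "g \<otimes> (w \<otimes> z) = w \<otimes> z" "e \<otimes> (z \<otimes> w) = z \<otimes> w"
    using z w e g by (simp_all add: cancel_left_assoc[OF gw] cancel_left_assoc[OF ez])
  have wzg: "w \<otimes> (z \<otimes> g) = w \<otimes> z" "z \<otimes> (w \<otimes> e) = z \<otimes> w" by (simp_all add: zg we)
  have wzd: "(w \<otimes> z) \<otimes> d = \<zero>"
  proof -
    have "(w \<otimes> z) \<otimes> d = w \<otimes> (z \<otimes> g) \<ominus> w \<otimes> (z \<otimes> (w \<otimes> z))" unfolding d_def using g(1) z w by (simp add: mult_diff_distrib m_assoc)
    then show ?thesis using z w by (simp add: wzg idz a_minus_def r_neg)
  qed
  have zwe': "(z \<otimes> w) \<otimes> e' = \<zero>"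
  proof -
    have "(z \<otimes> w) \<otimes> e' = z \<otimes> (w \<otimes> e) \<ominus> z \<otimes> (w \<otimes> (z \<otimes> w))" unfolding e'_def using e(1) z w by (simp add: mult_diff_distrib m_assoc)
    then show ?thesis using z w by (simp add: wzg idz a_minus_def r_neg)
  qed
  have gd: "g \<otimes> d = d"
  proof -
    have "g \<otimes> d = g \<otimes> g \<ominus> g \<otimes> (w \<otimes> z)" unfolding d_def using g(1) z w by (simp add: mult_diff_distrib m_assoc)
    then show ?thesis using g gwz by (simp add: d_def)
  qed
  have ee': "e \<otimes> e' = e'"
  proof -
    have "e \<otimes> e' = e \<otimes> e \<ominus> e \<otimes> (z \<otimes> w)" unfolding e'_def using e(1) z w by (simp add: mult_diff_distrib m_assoc)
    then show ?thesis using e gwz by (simp add: e'_def)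
  qed
  have dd: "d \<otimes> d = d"
  proof -
    have "(g \<ominus> w \<otimes> z) \<otimes> d = g \<otimes> d \<ominus> (w \<otimes> z) \<otimes> d"
      by (rule mult_diff_distrib(2)) (use g(1) z w c in auto)
    then have "d \<otimes> d = g \<otimes> d \<ominus> (w \<otimes> z) \<otimes> d" by (simp only: d_def[symmetric])
    then show ?thesis using wzd gd c by (simp add: a_minus_def)
  qed
  have e'e': "e' \<otimes> e' = e'"
  proof -
    have "(e \<ominus> z \<otimes> w) \<otimes> e' = e \<otimes> e' \<ominus> (z \<otimes> w) \<otimes> e'"
      by (rule mult_diff_distrib(2)) (use e(1) z w c in auto)
    then have "e' \<otimes> e' = e \<otimes> e' \<ominus> (z \<otimes> w) \<otimes> e'" by (simp only: e'_def[symmetric])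
    then show ?thesis using zwe' ee' c by (simp add: a_minus_def)
  qed
  have "e' \<otimes> s \<otimes> d = \<zero>" if s: "s \<in> carrier R" for s
  proof (rule corner_vanishes[OF c(2) e'e' c(1) dd _ s])
    fix k t
    assume k: "k \<in> carrier R" and t: "t \<in> carrier R" and dk: "d \<otimes> k = k"
      and e'tk: "e' \<otimes> (t \<otimes> k) = t \<otimes> k"
      and inj: "\<And>a. a \<in> carrier R \<Longrightarrow> t \<otimes> (k \<otimes> a) = \<zero> \<Longrightarrow> k \<otimes> a = \<zero>"
    have tk: "t \<otimes> k \<in> carrier R" using k t by simp
    have "g \<otimes> (d \<otimes> k) = d \<otimes> k" "(w \<otimes> z) \<otimes> (d \<otimes> k) = \<zero>"
      "e \<otimes> (e' \<otimes> (t \<otimes> k)) = e' \<otimes> (t \<otimes> k)" "(z \<otimes> w) \<otimes> (e' \<otimes> (t \<otimes> k)) = \<zero>"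
      using cancel_left_assoc[OF gd g(1) c(1) k] cancel_left_assoc[OF wzd _ c(1) k]
        cancel_left_assoc[OF ee' e(1) c(2) tk] cancel_left_assoc[OF zwe' _ c(2) tk] z w k tk by simp_all
    then have gk: "g \<otimes> k = k" and wzk: "(w \<otimes> z) \<otimes> k = \<zero>"
      and etk: "e \<otimes> (t \<otimes> k) = t \<otimes> k" and zwtk: "(z \<otimes> w) \<otimes> (t \<otimes> k) = \<zero>"
      by (simp_all only: dk e'tk)
    obtain N where N: "graph_submodule R N" "H \<subseteq> N" "(k, t \<otimes> k) \<in> N"
      and N_mem: "\<And>p q. (p, q) \<in> N \<Longrightarrow>
        \<exists>x y a. (x, y) \<in> H \<and> a \<in> carrier R \<and> p = x \<oplus> k \<otimes> a \<and> q = y \<oplus> t \<otimes> k \<otimes> a"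
      by (rule graph_adjoin[OF H k tk]) blast
    have "N = H"
    proof (rule mx[rule_format], intro conjI N(1,2) ballI)
      fix P Q assume PQ: "P \<in> N" "Q \<in> N"
      have PN: "(fst P, snd P) \<in> N" using PQ by simp
      from N_mem[OF PN] obtain x y a where xy: "(x, y) \<in> H" and a: "a \<in> carrier R"
        and P: "fst P = x \<oplus> k \<otimes> a" "snd P = y \<oplus> t \<otimes> k \<otimes> a" by (elim exE conjE)
      note h = cl(1)[OF xy] cl(2)[OF xy] gH[OF xy] eH[OF xy]
      show "g \<otimes> fst P = fst P" "e \<otimes> snd P = snd P"
        unfolding P using h g(1) e(1) a k tk
        by (simp_all add: r_distr cancel_left_assoc[OF gk g(1) k] cancel_left_assoc[OF etk e(1) tk])
      have "(w \<otimes> z) \<otimes> x = x" "(z \<otimes> w) \<otimes> y = y" using zw[OF xy] h z w by (simp_all add: m_assoc)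
      then have *: "(w \<otimes> z) \<otimes> fst P = x" "(z \<otimes> w) \<otimes> snd P = y"
        unfolding P using h a k tk z w
          cancel_left_assoc[OF wzk _ k a] cancel_left_assoc[OF zwtk _ tk a] by (simp_all add: r_distr)
      show "(fst P = \<zero>) = (snd P = \<zero>)"
      proof
        assume eq: "fst P = \<zero>"
        then have "x = \<zero>" using *(1) z w by simp
        moreover from this have "k \<otimes> a = \<zero>" using eq P(1) k a by simp
        ultimately show "snd P = \<zero>" using P(2) bi[OF xy] t k a by (simp add: m_assoc)
      next
        assume eq: "snd P = \<zero>"
        then have "y = \<zero>" using *(2) z w by simp
        moreover from this have "t \<otimes> (k \<otimes> a) = \<zero>" using eq P(2) k t a by (simp add: m_assoc)
        moreover have "k \<otimes> a = \<zero>" using calculation inj a by blast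
        ultimately show "fst P = \<zero>" using P(1) bi[OF xy] by simp
      qed
    qed
    then have "(k, t \<otimes> k) \<in> H" using N by simp
    then have "(w \<otimes> z) \<otimes> k = k" using zw[of k "t \<otimes> k"] k z w by (simp add: m_assoc)
    then show "k = \<zero>" using wzk by simp
  qed
  then show thesis using that[OF z w id ez zg gw we] by (simp add: d_def e'_def)
qed

text \<open>As \<open>qp = 0\<close>, the right ideals \<open>qR\<close> and \<open>pR\<close> meet in zero; so a homomorphism from \<open>qR\<close> to \<open>pR\<close> that is
injective on some \<open>kR\<close> violates square-freeness.\<close>

lemma square_free_below_imp_corner_vanishes:
  assumes sf: "square_free_below R g" and g: "g \<in> carrier R"
    and p: "p \<in> carrier R" "p \<otimes> p = p" "g \<otimes> p = p" and q: "q \<in> carrier R" "q \<otimes> q = q" "g \<otimes> q = q"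
    and qp: "q \<otimes> p = \<zero>" and s: "s \<in> carrier R"
  shows "p \<otimes> s \<otimes> q = \<zero>"
proof (rule corner_vanishes[OF p(1,2) q(1,2) _ s])
  fix k t
  assume k: "k \<in> carrier R" and t: "t \<in> carrier R" and qk: "q \<otimes> k = k" and ptk: "p \<otimes> (t \<otimes> k) = t \<otimes> k"
    and inj: "\<And>a. a \<in> carrier R \<Longrightarrow> t \<otimes> (k \<otimes> a) = \<zero> \<Longrightarrow> k \<otimes> a = \<zero>"
  have tk: "t \<otimes> k \<in> carrier R" using k t by simp
  show "k = \<zero>"
  proof (rule square_free_belowD[OF sf k t _ _ inj])
    show "g \<otimes> k = k" using cancel_left_assoc[OF q(3) g q(1) k] by (simp only: qk)
    show "g \<otimes> (t \<otimes> k) = t \<otimes> k" using cancel_left_assoc[OF p(3) g p(1) tk] by (simp only: ptk)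
    fix a b assume ab: "a \<in> carrier R" "b \<in> carrier R" "k \<otimes> a = t \<otimes> (k \<otimes> b)"
    have "k \<otimes> a = q \<otimes> (k \<otimes> a)" using cancel_left_assoc[OF qk q(1) k ab(1)] by simp
    also have "\<dots> = q \<otimes> (p \<otimes> (t \<otimes> k \<otimes> b))"
      using cancel_left_assoc[OF ptk p(1) tk ab(2)] ab k t by (simp add: m_assoc)
    also have "\<dots> = \<zero>" using cancel_left_assoc[OF qp q(1) p(1)] tk ab by simp
    finally show "k \<otimes> a = \<zero>" .
  qed
qed

end

section \<open>Factors given by central idempotents\<close>

text \<open>For a central idempotent \<open>c\<close> the carrier is \<open>cR\<close>.\<close>

definition corner_ring :: "('a, 'r) ring_scheme \<Rightarrow> 'a \<Rightarrow> 'a ring" where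
  "corner_ring R c =
     \<lparr>carrier = {x \<in> carrier R. c \<otimes>\<^bsub>R\<^esub> x = x}, mult = mult R, one = c, zero = zero R, add = add R\<rparr>"

lemma corner_ring_simps [simp]:
  "carrier (corner_ring R c) = {x \<in> carrier R. c \<otimes>\<^bsub>R\<^esub> x = x}"
  "mult (corner_ring R c) = mult R" "one (corner_ring R c) = c"
  "zero (corner_ring R c) = zero R" "add (corner_ring R c) = add R"
  by (simp_all add: corner_ring_def)

lemma RDirProd_simps [simp]:
  "carrier (RDirProd S T) = carrier S \<times> carrier T"
  "(a, b) \<otimes>\<^bsub>RDirProd S T\<^esub> (a', b') = (a \<otimes>\<^bsub>S\<^esub> a', b \<otimes>\<^bsub>T\<^esub> b')"
  "(a, b) \<oplus>\<^bsub>RDirProd S T\<^esub> (a', b') = (a \<oplus>\<^bsub>S\<^esub> a', b \<oplus>\<^bsub>T\<^esub> b')"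
  "\<one>\<^bsub>RDirProd S T\<^esub> = (\<one>\<^bsub>S\<^esub>, \<one>\<^bsub>T\<^esub>)"
  "\<zero>\<^bsub>RDirProd S T\<^esub> = (\<zero>\<^bsub>S\<^esub>, \<zero>\<^bsub>T\<^esub>)"
  by (simp_all add: RDirProd_def DirProd_def monoid.defs)

locale central_idempotent = ring R for R (structure) +
  fixes c
  assumes c_closed [simp]: "c \<in> carrier R" and c_idem [simp]: "c \<otimes> c = c"
    and c_central: "x \<in> carrier R \<Longrightarrow> c \<otimes> x = x \<otimes> c"
begin

lemma c_assoc [simp]: "x \<in> carrier R \<Longrightarrow> c \<otimes> (c \<otimes> x) = c \<otimes> x"
  by (simp add: m_assoc[symmetric])

lemma complement_central_idempotent: "central_idempotent R (\<one> \<ominus> c)"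
proof (unfold_locales)
  show "\<one> \<ominus> c \<in> carrier R" by simp
  show "(\<one> \<ominus> c) \<otimes> (\<one> \<ominus> c) = \<one> \<ominus> c"
    by (simp add: a_minus_def l_distr r_distr l_minus r_minus r_neg minus_add a_assoc)
  show "(\<one> \<ominus> c) \<otimes> x = x \<otimes> (\<one> \<ominus> c)" if "x \<in> carrier R" for x
    using that by (simp add: a_minus_def l_distr r_distr l_minus r_minus c_central)
qed

lemma ring_corner_ring: "ring (corner_ring R c)"
proof (intro ringI abelian_groupI monoidI)
  show "\<exists>y\<in>carrier (corner_ring R c). y \<oplus>\<^bsub>corner_ring R c\<^esub> x = \<zero>\<^bsub>corner_ring R c\<^esub>"
    if "x \<in> carrier (corner_ring R c)" for x
    using that by (intro bexI[of _ "\<ominus> x"]) (auto simp: r_minus l_neg)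
  show "x \<otimes>\<^bsub>corner_ring R c\<^esub> y \<in> carrier (corner_ring R c)"
    if "x \<in> carrier (corner_ring R c)" "y \<in> carrier (corner_ring R c)" for x y
    using that by (auto simp: cancel_left_assoc[of c x x y])
  show "x \<otimes>\<^bsub>corner_ring R c\<^esub> \<one>\<^bsub>corner_ring R c\<^esub> = x" if "x \<in> carrier (corner_ring R c)" for x
    using that c_central by auto
qed (auto simp: m_assoc a_ac l_distr r_distr)

lemma mult_eq_mult_corner: "x \<in> carrier R \<Longrightarrow> c \<otimes> x = x \<Longrightarrow> a \<in> carrier R \<Longrightarrow> x \<otimes> (c \<otimes> a) = x \<otimes> a"
  using c_central[of x] by (simp add: m_assoc[symmetric])

lemma right_ideal_corner_imp:
  assumes I: "right_ideal (corner_ring R c) I" shows "right_ideal R I"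
  unfolding right_ideal_iff
proof (intro conjI ballI)
  interpret C: ring "corner_ring R c" by (rule ring_corner_ring)
  note I' = I[unfolded C.right_ideal_iff corner_ring_simps]
  show "I \<subseteq> carrier R" "\<zero> \<in> I" using I' by auto
  show "x \<oplus> y \<in> I" if "x \<in> I" "y \<in> I" for x y using I' that by blast
  show "x \<otimes> a \<in> I" if "x \<in> I" "a \<in> carrier R" for x a
  proof -
    have "x \<in> carrier R" "c \<otimes> x = x" using I' that by auto
    moreover have "x \<otimes> (c \<otimes> a) \<in> I" using I' that by simp
    ultimately show ?thesis using that mult_eq_mult_corner by simp
  qed
qed

lemma right_ideal_kernel: "right_ideal R {x \<in> carrier R. c \<otimes> x = \<zero>}"
  by (auto simp: right_ideal_iff r_distr m_assoc[symmetric])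

lemma corner_kernel_disjoint:
  assumes "right_ideal (corner_ring R c) I"
  shows "I \<inter> {x \<in> carrier R. c \<otimes> x = \<zero>} = {\<zero>}"
proof -
  interpret C: ring "corner_ring R c" by (rule ring_corner_ring)
  show ?thesis using assms unfolding C.right_ideal_iff by auto
qed

text \<open>Adding the other factor \<open>(1 - c)R = {x. cx = 0}\<close> is how essential right ideals and partial
automorphisms of the factor \<open>cR\<close> are compared with those of \<open>R\<close>.\<close>

lemma essential_corner_add_kernel:
  assumes I: "essential_right_ideal (corner_ring R c) I"
  shows "essential_right_ideal R (I <+>\<^bsub>R\<^esub> {x \<in> carrier R. c \<otimes> x = \<zero>})"
  unfolding essential_right_ideal_iff
proof (intro conjI ballI impI)
  interpret C: ring "corner_ring R c" by (rule ring_corner_ring)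
  let ?J = "{x \<in> carrier R. c \<otimes> x = \<zero>}"
  note rI = right_ideal_corner_imp[OF C.essential_imp_right_ideal[OF I]]
  show "right_ideal R (I <+>\<^bsub>R\<^esub> ?J)" by (rule right_ideal_set_add[OF rI right_ideal_kernel])
  fix x assume x: "x \<in> carrier R" "x \<noteq> \<zero>"
  show "\<exists>a\<in>carrier R. x \<otimes> a \<noteq> \<zero> \<and> x \<otimes> a \<in> I <+>\<^bsub>R\<^esub> ?J"
  proof (cases "c \<otimes> x = x")
    case True
    then obtain a where "a \<in> carrier R" "x \<otimes> a \<noteq> \<zero>" "x \<otimes> a \<in> I"
      using I x unfolding C.essential_right_ideal_iff by auto
    then show ?thesis using right_ideal_set_add_left[OF rI right_ideal_kernel] by blast
  next
    case False
    have eq: "x \<otimes> (\<one> \<ominus> c) = x \<ominus> c \<otimes> x" using x by (simp add: mult_diff_distrib c_central)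
    have "x \<ominus> c \<otimes> x \<noteq> \<zero>" using False eq_if_minus_eq_zero[of x "c \<otimes> x"] x by auto
    moreover have "x \<ominus> c \<otimes> x \<in> ?J" using x by (simp add: mult_diff_distrib a_minus_def r_distr r_minus r_neg)
    ultimately show ?thesis
      using right_ideal_set_add_right[OF rI right_ideal_kernel] eq
      by (intro bexI[of _ "\<one> \<ominus> c"]) auto
  qed
qed

lemma right_linear_corner_imp:
  assumes I: "right_ideal (corner_ring R c) I" and h: "right_linear (corner_ring R c) I h"
  shows "right_linear R I h"
proof (rule right_linear_onI)
  interpret C: ring "corner_ring R c" by (rule ring_corner_ring)
  fix x assume x: "x \<in> I"
  have hx: "h x \<in> carrier R" "c \<otimes> h x = h x" using right_linear_on_closed[OF h x] by auto
  show "h x \<in> carrier (right_regular_module R)" using hx by simp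
  show "h (x \<oplus> y) = h x \<oplus>\<^bsub>right_regular_module R\<^esub> h y" if "y \<in> I" for y
    using right_linear_on_add[OF h x that] by simp
  show "h (x \<otimes> a) = h x \<star>\<^bsub>right_regular_module R\<^esub> a" if a: "a \<in> carrier R" for a
  proof -
    have xc: "x \<in> carrier R" "c \<otimes> x = x" using C.right_ideal_memD[OF I x] by auto
    have "h (x \<otimes> (c \<otimes> a)) = h x \<otimes> (c \<otimes> a)" using right_linear_on_mult[OF h x, of "c \<otimes> a"] a by simp
    then show ?thesis using mult_eq_mult_corner[OF xc a] mult_eq_mult_corner[OF hx a] by simp
  qed
qed

lemma square_free_below_corner:
  assumes "square_free_below R c" shows "square_free_below (corner_ring R c) c"
  unfolding square_free_below_def
proof (intro ballI impI)
  fix k t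
  assume kt: "k \<in> carrier (corner_ring R c)" "t \<in> carrier (corner_ring R c)"
    and inj: "\<forall>a\<in>carrier (corner_ring R c). t \<otimes>\<^bsub>corner_ring R c\<^esub> (k \<otimes>\<^bsub>corner_ring R c\<^esub> a) = \<zero>\<^bsub>corner_ring R c\<^esub> \<longrightarrow>
      k \<otimes>\<^bsub>corner_ring R c\<^esub> a = \<zero>\<^bsub>corner_ring R c\<^esub>"
    and dis: "\<forall>a\<in>carrier (corner_ring R c). \<forall>b\<in>carrier (corner_ring R c).
      k \<otimes>\<^bsub>corner_ring R c\<^esub> a = t \<otimes>\<^bsub>corner_ring R c\<^esub> (k \<otimes>\<^bsub>corner_ring R c\<^esub> b) \<longrightarrow>
      k \<otimes>\<^bsub>corner_ring R c\<^esub> a = \<zero>\<^bsub>corner_ring R c\<^esub>"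
  have k: "k \<in> carrier R" "c \<otimes> k = k" and t: "t \<in> carrier R" "c \<otimes> t = t" using kt by auto
  note kc = mult_eq_mult_corner[OF k]
  have "k = \<zero>"
  proof (rule square_free_belowD[OF assms k(1) t(1) k(2)])
    show "c \<otimes> (t \<otimes> k) = t \<otimes> k" using cancel_left_assoc[OF t(2) c_closed t(1) k(1)] .
    show "k \<otimes> a = \<zero>" if "a \<in> carrier R" "t \<otimes> (k \<otimes> a) = \<zero>" for a
      using inj[rule_format, of "c \<otimes> a"] that kc by simp
    show "k \<otimes> a = \<zero>" if "a \<in> carrier R" "b \<in> carrier R" "k \<otimes> a = t \<otimes> (k \<otimes> b)" for a b
      using dis[rule_format, of "c \<otimes> a" "c \<otimes> b"] that kc by simp
  qed
  then show "k = \<zero>\<^bsub>corner_ring R c\<^esub>" by simp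
qed

lemma product_decomposition:
  "(\<lambda>x. (c \<otimes> x, (\<one> \<ominus> c) \<otimes> x)) \<in>
     ring_iso R (RDirProd (corner_ring R c) (corner_ring R (\<one> \<ominus> c)))"
proof -
  let ?d = "\<one> \<ominus> c"
  interpret D: central_idempotent R ?d by (rule complement_central_idempotent)
  let ?\<phi> = "\<lambda>x. (c \<otimes> x, ?d \<otimes> x)"
  have orth: "c \<otimes> ?d = \<zero>" "?d \<otimes> c = \<zero>"
    by (simp_all add: a_minus_def r_distr l_distr r_minus l_minus r_neg)
  have mult: "e \<otimes> (x \<otimes> y) = (e \<otimes> x) \<otimes> (e \<otimes> y)"
    if "central_idempotent R e" "x \<in> carrier R" "y \<in> carrier R" for e x y
  proof -
    interpret E: central_idempotent R e by fact
    have "(e \<otimes> x) \<otimes> (e \<otimes> y) = e \<otimes> (x \<otimes> e) \<otimes> y" using that by (simp add: m_assoc)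
    also have "\<dots> = e \<otimes> (x \<otimes> y)" using that by (simp add: E.c_central[symmetric] m_assoc)
    finally show ?thesis by simp
  qed
  have hom: "?\<phi> \<in> ring_hom R (RDirProd (corner_ring R c) (corner_ring R ?d))"
  proof (rule ring_hom_memI)
    fix x y assume xy: "x \<in> carrier R" "y \<in> carrier R"
    show "?\<phi> (x \<otimes> y) = ?\<phi> x \<otimes>\<^bsub>RDirProd (corner_ring R c) (corner_ring R ?d)\<^esub> ?\<phi> y"
      unfolding RDirProd_simps corner_ring_simps prod.inject
      by (intro conjI mult central_idempotent_axioms D.central_idempotent_axioms xy)
  qed (simp_all add: r_distr)
  have "bij_betw ?\<phi> (carrier R) (carrier (corner_ring R c) \<times> carrier (corner_ring R ?d))"
  proof (rule bij_betw_byWitness[where f' = "\<lambda>(x, y). x \<oplus> y"])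
    have "c \<otimes> x \<oplus> ?d \<otimes> x = x" if "x \<in> carrier R" for x
      using that by (simp add: l_distr[symmetric] a_minus_def a_comm[of \<one>] r_neg2)
    then show "\<forall>x\<in>carrier R. (case ?\<phi> x of (x, y) \<Rightarrow> x \<oplus> y) = x" by simp
    have 1: "c \<otimes> y = \<zero>" if "y \<in> carrier R" "?d \<otimes> y = y" for y
      using cancel_left_assoc[OF orth(1) c_closed D.c_closed that(1)] that by simp
    have 2: "?d \<otimes> y = \<zero>" if "y \<in> carrier R" "c \<otimes> y = y" for y
      using cancel_left_assoc[OF orth(2) D.c_closed c_closed that(1)] that by simp
    show "\<forall>p\<in>carrier (corner_ring R c) \<times> carrier (corner_ring R ?d). ?\<phi> (case p of (x, y) \<Rightarrow> x \<oplus> y) = p"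
      using 1 2 by (auto simp: r_distr)
  qed (auto simp: r_distr)
  then show ?thesis
    using hom by (simp add: ring_iso_def)
qed

end

lemma (in nonsingular_ring) nonsingular_corner_ring:
  assumes "central_idempotent R c" shows "nonsingular_ring (corner_ring R c)"
proof -
  interpret c: central_idempotent R c by fact
  interpret C: ring "corner_ring R c" by (rule c.ring_corner_ring)
  let ?J = "{x \<in> carrier R. c \<otimes> x = \<zero>}"
  have "x = \<zero>" if x: "x \<in> carrier R" "c \<otimes> x = x"
    and ess: "essential_right_ideal (corner_ring R c) {a \<in> carrier (corner_ring R c). x \<otimes> a = \<zero>}" for x
  proof (rule essential_cancel[OF c.essential_corner_add_kernel[OF ess] x(1)])
    fix a assume "a \<in> {a \<in> carrier (corner_ring R c). x \<otimes> a = \<zero>} <+>\<^bsub>R\<^esub> ?J"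
    then obtain i j where ij: "i \<in> carrier R" "x \<otimes> i = \<zero>" "j \<in> carrier R" "c \<otimes> j = \<zero>" "a = i \<oplus> j"
      by (auto elim!: set_addE)
    have "x \<otimes> j = \<zero>" using c.mult_eq_mult_corner[OF x ij(3)] ij x by simp
    then show "x \<otimes> a = \<zero>" using ij x by (simp add: r_distr)
  qed
  moreover have "{a \<in> carrier (corner_ring R c). \<zero> \<otimes> a = \<zero>} = carrier (corner_ring R c)" by auto
  then have "essential_right_ideal (corner_ring R c) {a \<in> carrier (corner_ring R c). \<zero> \<otimes> a = \<zero>}"
    using C.essential_carrier by simp
  ultimately have "Sing (corner_ring R c) (right_regular_module (corner_ring R c)) = {\<zero>}"
    by (auto simp: Sing_def right_annihilator_def)
  then show ?thesis
    by (unfold_locales) (simp add: right_nonsingular_ring_def nonsingular_module_def)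
qed

text \<open>A partial automorphism of \<open>cR\<close> is continued by the identity on \<open>(1 - c)R\<close>.\<close>

lemma (in partial_automorphism_extending_ring) partial_automorphism_extending_corner_ring:
  assumes "central_idempotent R c" shows "partial_automorphism_extending_ring (corner_ring R c)"
proof -
  interpret c: central_idempotent R c by fact
  interpret C: nonsingular_ring "corner_ring R c" by (rule nonsingular_corner_ring) fact
  interpret reg: right_module R "right_regular_module R"
    by (rule right_module_regular) (rule ring_axioms)
  let ?J = "{x \<in> carrier R. c \<otimes> x = \<zero>}"
  have "\<exists>s\<in>carrier (corner_ring R c). \<forall>x\<in>I. h x = s \<otimes>\<^bsub>corner_ring R c\<^esub> x"
    if I: "essential_right_ideal (corner_ring R c) I" and h: "right_linear (corner_ring R c) I h"
      and inj: "inj_on h I" and im: "essential_right_ideal (corner_ring R c) (h ` I)" for I h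
  proof -
    note I' = C.essential_imp_right_ideal[OF I] and im' = C.essential_imp_right_ideal[OF im]
    note rI = c.right_ideal_corner_imp[OF I'] and rim = c.right_ideal_corner_imp[OF im']
    note h' = c.right_linear_corner_imp[OF I' h]
    have id: "right_linear R ?J (\<lambda>x. x)" by (rule right_linear_onI) auto
    obtain k where k: "right_linear R (I <+>\<^bsub>R\<^esub> ?J) k"
      and kv: "\<And>i j. i \<in> I \<Longrightarrow> j \<in> ?J \<Longrightarrow> k (i \<oplus> j) = h i \<oplus> j" and kI: "\<And>i. i \<in> I \<Longrightarrow> k i = h i"
      by (rule reg.right_linear_on_glue[OF rI c.right_ideal_kernel
            c.corner_kernel_disjoint[OF I'] h' id]) auto
    note ess = c.essential_corner_add_kernel[OF I]
    note S = essential_imp_right_ideal[OF ess]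
    have kinj: "inj_on k (I <+>\<^bsub>R\<^esub> ?J)"
    proof (rule right_linear_inj_on[OF S k])
      fix x assume x: "x \<in> I <+>\<^bsub>R\<^esub> ?J" and kx: "k x = \<zero>"
      from x obtain i j where ij: "i \<in> I" "j \<in> ?J" "x = i \<oplus> j" by (rule set_addE)
      have hi: "h i \<in> h ` I" using ij by blast
      have "h i \<oplus> j = \<zero> \<oplus> \<zero>" using kx kv[OF ij(1,2)] ij(3) by simp
      then have "h i = \<zero>" "j = \<zero>"
        using direct_sum_unique[OF rim c.right_ideal_kernel c.corner_kernel_disjoint[OF im']
            hi right_ideal_zero_mem[OF rim] ij(2) right_ideal_zero_mem[OF c.right_ideal_kernel]] by blast+
      moreover have "h \<zero> = \<zero>" by (rule reg.right_linear_on_zero[OF rI h', simplified])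
      ultimately have "i = \<zero>"
        using inj_onD[OF inj, of i \<zero>] ij(1) right_ideal_zero_mem[OF rI] by simp
      then show "x = \<zero>" using ij \<open>j = \<zero>\<close> by simp
    qed
    have "h ` I <+>\<^bsub>R\<^esub> ?J \<subseteq> k ` (I <+>\<^bsub>R\<^esub> ?J)"
    proof
      fix x assume "x \<in> h ` I <+>\<^bsub>R\<^esub> ?J"
      then obtain y j where y: "y \<in> h ` I" "j \<in> ?J" "x = y \<oplus> j" by (rule set_addE)
      then obtain i where i: "i \<in> I" "y = h i" by blast
      have "x = k (i \<oplus> j)" using kv[OF i(1) y(2)] i y by simp
      then show "x \<in> k ` (I <+>\<^bsub>R\<^esub> ?J)" using set_addI[OF i(1) y(2), of R] by blast
    qed
    then have "essential_right_ideal R (k ` (I <+>\<^bsub>R\<^esub> ?J))"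
      by (rule essential_superset[OF c.essential_corner_add_kernel[OF im] right_linear_image[OF S k]])
    then obtain u where u: "u \<in> carrier R" "\<And>x. x \<in> I <+>\<^bsub>R\<^esub> ?J \<Longrightarrow> k x = u \<otimes> x"
      by (rule partial_automorphisms_extendD[OF partial_automorphisms_extend ess k kinj]) blast
    have "h x = c \<otimes> u \<otimes> x" if "x \<in> I" for x
    proof -
      have x: "x \<in> carrier R" by (rule right_ideal_memD[OF rI that])
      have hx: "c \<otimes> h x = h x" using right_linear_on_closed[OF h that] by simp
      have "h x = u \<otimes> x"
        using kI[OF that] u(2)[OF right_ideal_set_add_left[OF rI c.right_ideal_kernel that]] by simp
      then show ?thesis using hx u x by (simp add: m_assoc)
    qed
    then show ?thesis using u by (intro bexI[of _ "c \<otimes> u"]) auto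
  qed
  then have "partial_automorphisms_extend (corner_ring R c)"
    unfolding partial_automorphisms_extend_def by (intro allI impI, elim conjE)
  then show ?thesis
    by (intro partial_automorphism_extending_ring.intro C.nonsingular_ring_axioms
        partial_automorphism_extending_ring_axioms.intro)
qed

section \<open>The decomposition\<close>

context partial_automorphism_extending_ring
begin

text \<open>With \<open>e\<close>, \<open>f\<close>, \<open>g\<close> from the maximal pair, \<open>z\<close>, \<open>w\<close> from the maximal isomorphism between \<open>gR\<close> and \<open>eR\<close>,
\<open>h = wz\<close> and \<open>e' = zw\<close>, the idempotent \<open>d = g - h\<close> satisfies \<open>dR(1 - d) = 0\<close> and \<open>(1 - d)Rd = 0\<close>.
The identities \<open>uvu = u\<close>, \<open>vuv = v\<close> and \<open>zwz = z\<close>, \<open>wzw = w\<close> together with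
\<open>u\<^sup>2 = v\<^sup>2 = z\<^sup>2 = 0\<close> show that \<open>e\<close>, \<open>f\<close> and \<open>h\<close> embed into their complements.\<close>

lemma square_free_plus_embedding_decomposition:
  obtains d e f h where "central_idempotent R d" "square_free_below R d"
    "\<one> \<ominus> d = e \<oplus> f \<oplus> h" "embeds_in_complement (corner_ring R (\<one> \<ominus> d)) e"
    "embeds_in_complement (corner_ring R (\<one> \<ominus> d)) f" "embeds_in_complement (corner_ring R (\<one> \<ominus> d)) h"
proof -
  obtain u v where u: "u \<in> carrier R" and v: "v \<in> carrier R"
    and iduv: "u \<otimes> v \<otimes> u = u" "v \<otimes> u \<otimes> v = v" and sq: "u \<otimes> u = \<zero>" "v \<otimes> v = \<zero>"
    and sf: "square_free_below R (\<one> \<ominus> (v \<otimes> u \<oplus> u \<otimes> v))"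
    by (rule maximal_pair_of_disjoint_isomorphic_ideals) blast
  define e where "e = v \<otimes> u"
  define f where "f = u \<otimes> v"
  define g where "g = \<one> \<ominus> (e \<oplus> f)"
  have sfg: "square_free_below R g" using sf by (simp add: e_def f_def g_def)
  have c: "e \<in> carrier R" "f \<in> carrier R" "g \<in> carrier R" using u v by (simp_all add: e_def f_def g_def)
  note efg = square_zero_pair_idempotents[OF u v iduv sq, folded e_def f_def, folded g_def]
  note ee = efg(1) and eg = efg(5) and ge = efg(7) and gg = efg(8)
  obtain z w where z: "z \<in> carrier R" and w: "w \<in> carrier R"
    and idzw: "z \<otimes> w \<otimes> z = z" "w \<otimes> z \<otimes> w = w"
    and ez: "e \<otimes> z = z" and zg: "z \<otimes> g = z" and gw: "g \<otimes> w = w" and we: "w \<otimes> e = w"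
    and van: "\<And>s. s \<in> carrier R \<Longrightarrow> (e \<ominus> z \<otimes> w) \<otimes> s \<otimes> (g \<ominus> w \<otimes> z) = \<zero>"
    by (rule maximal_isomorphism_between_corners[OF c(1) ee c(3) gg eg ge]) blast
  define h where "h = w \<otimes> z"
  define e' where "e' = z \<otimes> w"
  define d where "d = g \<ominus> h"
  have c': "h \<in> carrier R" "e' \<in> carrier R" "d \<in> carrier R" using z w c by (simp_all add: h_def e'_def d_def)
  have hh: "h \<otimes> h = h" and e'e': "e' \<otimes> e' = e'" and zh: "z \<otimes> h = z" and hw: "h \<otimes> w = w"
    using idzw z w by (simp_all add: h_def e'_def m_assoc)
  have gh: "g \<otimes> h = h" and hg: "h \<otimes> g = h"
    using z w c by (simp_all add: h_def m_assoc zg cancel_left_assoc[OF gw])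
  have ee': "e \<otimes> e' = e'" and e'e: "e' \<otimes> e = e'"
    using z w c by (simp_all add: e'_def m_assoc we cancel_left_assoc[OF ez])
  have gz: "g \<otimes> z = \<zero>"
    using cancel_left_assoc[OF ge c(3,1) z] z by (simp add: ez)
  have zz: "z \<otimes> z = \<zero>"
    using cancel_left_assoc[OF zg z c(3) z] z by (simp add: gz)
  have dd: "d \<otimes> d = d" and gd: "g \<otimes> d = d" and hd: "h \<otimes> d = \<zero>" and dg: "d \<otimes> g = d" and dh: "d \<otimes> h = \<zero>"
    using c(3) c'(1)
    by (simp_all add: d_def a_minus_def r_distr l_distr r_minus l_minus gg hh gh hg r_neg l_neg)
  have dz: "d \<otimes> z = \<zero>"
    using c(3) z w by (simp add: d_def h_def a_minus_def l_distr l_minus gz m_assoc zz)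
  have de: "d \<otimes> e = \<zero>"
    using cancel_left_assoc[OF dg c'(3) c(3,1)] c c' by (simp add: ge)
  have de': "d \<otimes> e' = \<zero>"
    using c' z w by (simp add: e'_def cancel_left_assoc[OF dz])
  have e_e': "(e \<ominus> e') \<otimes> (e \<ominus> e') = e \<ominus> e'"
    using c(1) c'(2) by (simp add: a_minus_def r_distr l_distr r_minus l_minus ee ee' e'e e'e' r_neg)
  have d_ee': "d \<otimes> (e \<ominus> e') = \<zero>"
    using c(1) c'(2,3) by (simp add: a_minus_def r_distr r_minus de de')
  \<comment> \<open>Maximality of the isomorphism \<open>z\<close> separates \<open>d\<close> from \<open>e - e'\<close>.\<close>
  have v1: "d \<otimes> s \<otimes> (e \<ominus> e') = \<zero>" if "s \<in> carrier R" for s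
    by (rule corner_vanishes_sym[OF _ e_e' c'(3) dd d_ee' _ that])
      (use van c c' in \<open>simp_all add: d_def e'_def h_def\<close>)
  \<comment> \<open>Square-freeness of \<open>gR\<close> separates \<open>d\<close> from \<open>h\<close>.\<close>
  have v2: "d \<otimes> s \<otimes> h = \<zero>" if "s \<in> carrier R" for s
    by (rule square_free_below_imp_corner_vanishes
        [OF sfg c(3) c'(3) dd gd c'(1) hh gh hd that])
  \<comment> \<open>The separation passes along the isomorphisms from \<open>hR\<close> to \<open>e'R\<close> and from \<open>eR\<close> to \<open>fR\<close>.\<close>
  have ve': "d \<otimes> s \<otimes> e' = \<zero>" if s: "s \<in> carrier R" for s
  proof -
    have "d \<otimes> s \<otimes> e' = d \<otimes> s \<otimes> (z \<otimes> h \<otimes> w)" by (simp only: zh e'_def)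
    also have "\<dots> = (d \<otimes> (s \<otimes> z) \<otimes> h) \<otimes> w" using s z w c' by (simp add: m_assoc)
    finally show ?thesis using v2[of "s \<otimes> z"] s z w by simp
  qed
  have ve: "d \<otimes> s \<otimes> e = \<zero>" if s: "s \<in> carrier R" for s
  proof -
    have "d \<otimes> s \<otimes> (e \<ominus> e') = d \<otimes> s \<otimes> e \<ominus> d \<otimes> s \<otimes> e'"
      by (rule mult_diff_distrib(1)) (use s c c' in auto)
    then show ?thesis using v1[OF s] ve'[OF s] s c c' by (simp add: a_minus_def)
  qed
  have vf: "d \<otimes> s \<otimes> f = \<zero>" if s: "s \<in> carrier R" for s
  proof -
    have "d \<otimes> s \<otimes> f = (d \<otimes> (s \<otimes> u) \<otimes> e) \<otimes> v"
      using s u v c' iduv by (simp add: e_def f_def m_assoc)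
    then show ?thesis using ve[of "s \<otimes> u"] s u v by simp
  qed
  have sum: "\<one> \<ominus> d = e \<oplus> f \<oplus> h"
  proof -
    have "\<one> \<ominus> d = \<one> \<ominus> ((\<one> \<ominus> (e \<oplus> f)) \<ominus> h)" by (simp only: d_def g_def)
    also have "\<dots> = e \<oplus> f \<oplus> h" using c(1,2) c'(1)
      by (simp add: a_minus_def minus_add a_assoc[symmetric] r_neg)
    finally show ?thesis .
  qed
  have vc: "d \<otimes> s \<otimes> (\<one> \<ominus> d) = \<zero>" if s: "s \<in> carrier R" for s
    unfolding sum using ve[OF s] vf[OF s] v2[OF s] s c c' by (simp add: r_distr)
  have cc: "(\<one> \<ominus> d) \<otimes> (\<one> \<ominus> d) = \<one> \<ominus> d" and cd: "(\<one> \<ominus> d) \<otimes> d = \<zero>"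
    using c' by (simp_all add: a_minus_def r_distr l_distr r_minus l_minus dd r_neg l_neg)
  have vc': "(\<one> \<ominus> d) \<otimes> s \<otimes> d = \<zero>" if s: "s \<in> carrier R" for s
    by (rule corner_vanishes_sym[OF c'(3) dd _ cc cd vc s]) (use c' in simp_all)
  have "d \<otimes> s = s \<otimes> d" if s: "s \<in> carrier R" for s
  proof -
    have "d \<otimes> s \<otimes> (\<one> \<ominus> d) = d \<otimes> s \<ominus> d \<otimes> s \<otimes> d"
      using s c' by (simp add: mult_diff_distrib)
    then have "d \<otimes> s \<ominus> d \<otimes> s \<otimes> d = \<zero>" by (simp only: vc[OF s])
    then have 1: "d \<otimes> s = d \<otimes> s \<otimes> d"
      by (rule eq_if_minus_eq_zero[rotated 2]) (use s c' in auto)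
    have "(\<one> \<ominus> d) \<otimes> s \<otimes> d = s \<otimes> d \<ominus> d \<otimes> s \<otimes> d"
      using s c' by (simp add: a_minus_def l_distr l_minus)
    then have "s \<otimes> d \<ominus> d \<otimes> s \<otimes> d = \<zero>" by (simp only: vc'[OF s])
    then have "s \<otimes> d = d \<otimes> s \<otimes> d"
      by (rule eq_if_minus_eq_zero[rotated 2]) (use s c' in auto)
    then show ?thesis using 1 by simp
  qed
  then have central: "central_idempotent R d"
    by (intro central_idempotent.intro central_idempotent_axioms.intro ring_axioms c'(3) dd)
  have below: "square_free_below R d"
    unfolding square_free_below_def
  proof (intro ballI impI)
    fix k t
    assume k: "k \<in> carrier R" and t: "t \<in> carrier R" and dk: "d \<otimes> k = k" and dtk: "d \<otimes> (t \<otimes> k) = t \<otimes> k"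
      and "\<forall>a\<in>carrier R. t \<otimes> (k \<otimes> a) = \<zero> \<longrightarrow> k \<otimes> a = \<zero>"
      and "\<forall>a\<in>carrier R. \<forall>b\<in>carrier R. k \<otimes> a = t \<otimes> (k \<otimes> b) \<longrightarrow> k \<otimes> a = \<zero>"
    moreover have "g \<otimes> (d \<otimes> k) = d \<otimes> k" "g \<otimes> (d \<otimes> (t \<otimes> k)) = d \<otimes> (t \<otimes> k)"
      using cancel_left_assoc[OF gd c(3) c'(3)] k t by simp_all
    then have "g \<otimes> k = k" "g \<otimes> (t \<otimes> k) = t \<otimes> k" by (simp_all only: dk dtk)
    ultimately show "k = \<zero>" by (intro square_free_belowD[OF sfg k t]) blast+
  qed
  have in_corner: "(\<one> \<ominus> d) \<otimes> x = x" if "x \<in> carrier R" "d \<otimes> x = \<zero>" for x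
    using that c' by (simp add: a_minus_def l_distr l_minus)
  have "d \<otimes> u = d \<otimes> \<one> \<otimes> f \<otimes> u" "d \<otimes> v = d \<otimes> \<one> \<otimes> e \<otimes> v" "d \<otimes> w = d \<otimes> \<one> \<otimes> h \<otimes> w"
    using u v w c' iduv hw by (simp_all add: e_def f_def m_assoc)
  then have "d \<otimes> u = \<zero>" "d \<otimes> v = \<zero>" "d \<otimes> w = \<zero>"
    using ve[of \<one>] vf[of \<one>] v2[of \<one>] u v w by simp_all
  note in_c = in_corner[OF u this(1)] in_corner[OF v this(2)] in_corner[OF w this(3)] in_corner[OF z dz]
  have "embeds_in_complement (corner_ring R (\<one> \<ominus> d)) e"
    unfolding embeds_in_complement_def
    by (rule bexI[of _ u], rule bexI[of _ v]) (use u v iduv sq in_c in \<open>auto simp: e_def\<close>)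
  moreover have "embeds_in_complement (corner_ring R (\<one> \<ominus> d)) f"
    unfolding embeds_in_complement_def
    by (rule bexI[of _ v], rule bexI[of _ u]) (use u v iduv sq in_c in \<open>auto simp: f_def\<close>)
  moreover have "embeds_in_complement (corner_ring R (\<one> \<ominus> d)) h"
    unfolding embeds_in_complement_def
    by (rule bexI[of _ z], rule bexI[of _ w]) (use z w idzw zz in_c in \<open>auto simp: h_def\<close>)
  ultimately show thesis using that[OF central below sum] by blast
qed

text \<open>Split \<open>h\<close> on \<open>L \<inter> eR\<close> into \<open>(1 - e)h\<close> and \<open>eh\<close>. The first part maps into \<open>(1 - e)R\<close>, which meets \<open>eR\<close> in
zero. The second one does so after composition with the embedding \<open>x\<close> of \<open>eR\<close> into
\<open>(1 - e)R\<close>, which is undone by \<open>y\<close>. So both are left multiplications.\<close>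

lemma right_linear_on_corner_is_left_mult:
  assumes emb: "embeds_in_complement R e" and L: "right_ideal R L" and h: "right_linear R L h"
  obtains t where "t \<in> carrier R" "\<And>l. l \<in> L \<Longrightarrow> e \<otimes> l = l \<Longrightarrow> h l = t \<otimes> l"
proof -
  interpret reg: right_module R "right_regular_module R"
    by (rule right_module_regular) (rule ring_axioms)
  obtain x y where x: "x \<in> carrier R" and y: "y \<in> carrier R" and e: "e = y \<otimes> x"
    and xx: "x \<otimes> x = \<zero>" and xyx: "x \<otimes> y \<otimes> x = x"
    using emb unfolding embeds_in_complement_def by blast
  have eR: "e \<in> carrier R" and ee: "e \<otimes> e = e" and ex: "e \<otimes> x = \<zero>"
    using x y xx xyx by (simp_all add: e m_assoc)
  have hR: "h l \<in> carrier R" if "l \<in> L" for l using right_linear_on_closed[OF h that] by simp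
  note LR = right_ideal_memD[OF L]
  have ext: "\<exists>t\<in>carrier R. \<forall>l\<in>L. e \<otimes> l = l \<longrightarrow> t \<otimes> l = b \<otimes> h l"
    if b: "b \<in> carrier R" "e \<otimes> b = \<zero>" for b
  proof -
    let ?H = "{(l, b \<otimes> h l) | l. l \<in> L \<and> e \<otimes> l = l}"
    let ?M = "{a \<in> carrier R. e \<otimes> a = \<zero>}"
    have h0: "h \<zero> = \<zero>" using reg.right_linear_on_zero[OF L h] by simp
    have H: "graph_submodule R ?H"
    proof (rule graph_submoduleI)
      show "(\<zero>, \<zero>) \<in> ?H" using right_ideal_zero_mem[OF L] h0 b eR by force
      show "p \<in> carrier R \<and> q \<in> carrier R" if "(p, q) \<in> ?H" for p q
        using that b hR LR by auto
      fix p q assume "(p, q) \<in> ?H"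
      then have p: "p \<in> L" "e \<otimes> p = p" "q = b \<otimes> h p" by auto
      show "(p \<oplus> p', q \<oplus> q') \<in> ?H" if "(p', q') \<in> ?H" for p' q'
      proof -
        from that have p': "p' \<in> L" "e \<otimes> p' = p'" "q' = b \<otimes> h p'" by auto
        have "p \<oplus> p' \<in> L" "e \<otimes> (p \<oplus> p') = p \<oplus> p'" "q \<oplus> q' = b \<otimes> h (p \<oplus> p')"
          using right_ideal_add[OF L p(1) p'(1)] right_linear_on_add[OF h p(1) p'(1)] p p' eR b hR LR
          by (simp_all add: r_distr)
        then show ?thesis by blast
      qed
      show "(p \<otimes> a, q \<otimes> a) \<in> ?H" if a: "a \<in> carrier R" for a
      proof -
        have "p \<otimes> a \<in> L" "e \<otimes> (p \<otimes> a) = p \<otimes> a" "q \<otimes> a = b \<otimes> h (p \<otimes> a)"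
          using right_ideal_mult[OF L p(1) a] right_linear_on_mult[OF h p(1) a] p eR b hR LR a
            cancel_left_assoc[OF p(2) eR LR[OF p(1)] a]
          by (simp_all add: m_assoc)
        then show ?thesis by blast
      qed
    qed
    have M: "right_ideal R ?M" using eR by (auto simp: right_ideal_iff r_distr m_assoc[symmetric])
    have sv: "q = \<zero>" if "(\<zero>, q) \<in> ?H" for q using that h0 b by auto
    have dis: "p = \<zero>" if "p \<in> Domain ?H" "p \<in> ?M" for p using that by auto
    have ran: "Range ?H \<subseteq> ?M"
      using b hR eR by (auto simp: cancel_left_assoc[OF b(2) eR b(1)])
    obtain t where t: "t \<in> carrier R" "\<And>p q. (p, q) \<in> ?H \<Longrightarrow> t \<otimes> p = q"
      by (rule homomorphism_into_disjoint_ideal_extends[OF H sv M dis ran]) blast+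
    show ?thesis using t by blast
  qed
  have "e \<otimes> (\<one> \<ominus> e) = \<zero>" using eR by (simp add: mult_diff_distrib ee) (simp add: a_minus_def r_neg)
  with ext[of "\<one> \<ominus> e"] obtain t1 where t1: "t1 \<in> carrier R"
    "\<And>l. l \<in> L \<Longrightarrow> e \<otimes> l = l \<Longrightarrow> t1 \<otimes> l = (\<one> \<ominus> e) \<otimes> h l" using eR by auto
  from ext[OF x ex] obtain t2 where t2: "t2 \<in> carrier R"
    "\<And>l. l \<in> L \<Longrightarrow> e \<otimes> l = l \<Longrightarrow> t2 \<otimes> l = x \<otimes> h l" by auto
  show thesis
  proof (rule that[of "t1 \<oplus> y \<otimes> t2"])
    fix l assume l: "l \<in> L" "e \<otimes> l = l"
    have "(t1 \<oplus> y \<otimes> t2) \<otimes> l = t1 \<otimes> l \<oplus> y \<otimes> (t2 \<otimes> l)"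
      using t1(1) t2(1) y LR[OF l(1)] by (simp add: l_distr m_assoc)
    also have "\<dots> = (\<one> \<ominus> e) \<otimes> h l \<oplus> e \<otimes> h l"
      using t1(2)[OF l] t2(2)[OF l] x y hR[OF l(1)] by (simp add: e m_assoc)
    also have "\<dots> = h l"
      using eR hR[OF l(1)] by (simp add: a_minus_def l_distr l_minus a_assoc l_neg)
    finally show "h l = (t1 \<oplus> y \<otimes> t2) \<otimes> l" by simp
  qed (use t1 t2 y in simp)
qed

text \<open>The components of \<open>l \<in> L\<close> in \<open>eR\<close>, \<open>fR\<close> and \<open>gR\<close> need not belong to \<open>L\<close>, but they do after
multiplication by the elements \<open>a\<close> of an essential right ideal. There \<open>h\<close> is computed from the three left
multiplications of the previous lemma, and non-singularity does the rest.\<close>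

lemma right_injective_if_one_is_sum_of_embedding_idempotents:
  assumes one: "\<one> = e \<oplus> f \<oplus> g"
    and emb: "embeds_in_complement R e" "embeds_in_complement R f" "embeds_in_complement R g"
  shows "right_injective_ring R"
proof -
  interpret reg: right_module R "right_regular_module R"
    by (rule right_module_regular) (rule ring_axioms)
  have idem: "a \<in> carrier R \<and> a \<otimes> a = a" if "embeds_in_complement R a" for a
    using that unfolding embeds_in_complement_def by (auto simp: m_assoc)
  have "\<exists>s\<in>carrier R. \<forall>x\<in>L. h x = s \<otimes> x"
    if L: "essential_right_ideal R L" and h: "right_linear R L h" for L h
  proof -
    note rL = essential_imp_right_ideal[OF L]
    note LR = right_ideal_memD[OF rL]
    obtain te where te: "te \<in> carrier R" "\<And>l. l \<in> L \<Longrightarrow> e \<otimes> l = l \<Longrightarrow> h l = te \<otimes> l"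
      by (rule right_linear_on_corner_is_left_mult[OF emb(1) rL h]) blast
    obtain tf where tf: "tf \<in> carrier R" "\<And>l. l \<in> L \<Longrightarrow> f \<otimes> l = l \<Longrightarrow> h l = tf \<otimes> l"
      by (rule right_linear_on_corner_is_left_mult[OF emb(2) rL h]) blast
    obtain tg where tg: "tg \<in> carrier R" "\<And>l. l \<in> L \<Longrightarrow> g \<otimes> l = l \<Longrightarrow> h l = tg \<otimes> l"
      by (rule right_linear_on_corner_is_left_mult[OF emb(3) rL h]) blast
    note i = idem[OF emb(1)] idem[OF emb(2)] idem[OF emb(3)]
    let ?s = "te \<otimes> e \<oplus> tf \<otimes> f \<oplus> tg \<otimes> g"
    have s: "?s \<in> carrier R" using te tf tg i by simp
    have "h l = ?s \<otimes> l" if l: "l \<in> L" for l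
    proof (rule essential_eqI)
      note lR = LR[OF l]
      have hl: "h l \<in> carrier R" using right_linear_on_closed[OF h l] by simp
      show "h l \<in> carrier R" "?s \<otimes> l \<in> carrier R" using hl s lR by auto
      let ?C = "\<lambda>b. {a \<in> carrier R. b \<otimes> l \<otimes> a \<in> L}"
      show "essential_right_ideal R (?C e \<inter> (?C f \<inter> ?C g))"
        using i lR by (intro essential_Int essential_colon[OF L]) auto
      fix a assume "a \<in> ?C e \<inter> (?C f \<inter> ?C g)"
      then have a: "a \<in> carrier R" "e \<otimes> l \<otimes> a \<in> L" "f \<otimes> l \<otimes> a \<in> L" "g \<otimes> l \<otimes> a \<in> L" by auto
      have fix_idem: "b \<otimes> (b \<otimes> l \<otimes> a) = b \<otimes> l \<otimes> a" if "b \<in> carrier R \<and> b \<otimes> b = b" for b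
        using that a lR by (simp add: m_assoc[symmetric])
      have la: "l \<otimes> a = e \<otimes> l \<otimes> a \<oplus> f \<otimes> l \<otimes> a \<oplus> g \<otimes> l \<otimes> a"
      proof -
        have "l \<otimes> a = (e \<oplus> f \<oplus> g) \<otimes> (l \<otimes> a)" using lR a by (simp add: one[symmetric])
        then show ?thesis using i lR a by (simp add: l_distr m_assoc)
      qed
      have "h l \<otimes> a = h (l \<otimes> a)" using right_linear_on_mult[OF h l a(1)] by simp
      also have "\<dots> = h (e \<otimes> l \<otimes> a) \<oplus> h (f \<otimes> l \<otimes> a) \<oplus> h (g \<otimes> l \<otimes> a)"
        unfolding la
        using right_linear_on_add[OF h right_ideal_add[OF rL a(2,3)] a(4)]
          right_linear_on_add[OF h a(2,3)] by simp
      also have "\<dots> = te \<otimes> (e \<otimes> l \<otimes> a) \<oplus> tf \<otimes> (f \<otimes> l \<otimes> a) \<oplus> tg \<otimes> (g \<otimes> l \<otimes> a)"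
        using te(2)[OF a(2) fix_idem[OF i(1)]] tf(2)[OF a(3) fix_idem[OF i(2)]]
          tg(2)[OF a(4) fix_idem[OF i(3)]] by simp
      also have "\<dots> = ?s \<otimes> l \<otimes> a" using te(1) tf(1) tg(1) i lR a(1) by (simp add: l_distr m_assoc)
      finally show "h l \<otimes> a = ?s \<otimes> l \<otimes> a" .
    qed
    then show ?thesis using s by blast
  qed
  then show ?thesis
    unfolding right_injective_ring_def
    by (intro reg.injective_module_if_extends_from_essential) simp
qed

end

lemma (in ring) right_injective_ring_extends:
  assumes inj: "right_injective_ring R" and I: "right_ideal R I" and h: "right_linear R I h"
  obtains c where "c \<in> carrier R" "\<And>x. x \<in> I \<Longrightarrow> h x = c \<otimes> x"
proof -
  let ?A = "right_regular_module R"
  have "h \<in> right_module_hom R (?A\<lparr>carrier := I\<rparr>) ?A"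
    using h by (auto simp: right_linear_on_def right_module_hom_def)
  moreover have "injective_wrt R ?A ?A"
    using inj right_module_regular[OF ring_axioms]
    by (simp add: right_injective_ring_def injective_module_def)
  ultimately obtain g where g: "g \<in> right_module_hom R ?A ?A" and gh: "\<forall>y\<in>I. g y = h y"
    using I unfolding injective_wrt_def by blast
  show thesis
  proof (rule that[of "g \<one>"])
    show "g \<one> \<in> carrier R" using right_module_homD(1)[OF g, of \<one>] by simp
    show "h x = g \<one> \<otimes> x" if "x \<in> I" for x
      using right_module_homD(3)[OF g, of \<one> x] gh that right_ideal_memD[OF I that] by simp
  qed
qed

context nonsingular_ring
begin

lemma annihilator_complement:
  assumes a: "a \<in> carrier R"
  obtains K where "right_ideal R K" "{x \<in> carrier R. a \<otimes> x = \<zero>} \<inter> K = {\<zero>}"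
    "essential_right_ideal R ({x \<in> carrier R. a \<otimes> x = \<zero>} <+>\<^bsub>R\<^esub> K)"
    "right_ideal R {x \<in> carrier R. a \<otimes> x = \<zero>}"
proof -
  have I: "right_ideal R {x \<in> carrier R. a \<otimes> x = \<zero>}"
    using a by (auto simp: right_ideal_iff r_distr m_assoc[symmetric])
  have "{x \<in> carrier R. a \<otimes> x = \<zero>} \<inter> {\<zero>} = {\<zero>}" using a by auto
  then obtain K where "right_ideal R K" "{x \<in> carrier R. a \<otimes> x = \<zero>} \<inter> K = {\<zero>}"
    "essential_right_ideal R ({x \<in> carrier R. a \<otimes> x = \<zero>} <+>\<^bsub>R\<^esub> K)"
    by (rule complement_right_ideal[OF I right_ideal_zero])
  then show thesis using I by (rule that)
qed

lemma left_mult_inverse_function: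
  assumes a: "a \<in> carrier R" and K: "right_ideal R K"
    and dis: "{x \<in> carrier R. a \<otimes> x = \<zero>} \<inter> K = {\<zero>}"
  obtains g where "right_ideal R ((\<otimes>) a ` K)" "right_linear R ((\<otimes>) a ` K) g"
    "\<And>k. k \<in> K \<Longrightarrow> g (a \<otimes> k) = k"
proof -
  let ?H = "{(a \<otimes> k, k) | k. k \<in> K}"
  note KR = right_ideal_memD[OF K]
  have H: "graph_submodule R ?H"
  proof (rule graph_submoduleI)
    show "(\<zero>, \<zero>) \<in> ?H" using right_ideal_zero_mem[OF K] a by force
    show "x \<in> carrier R \<and> y \<in> carrier R" if "(x, y) \<in> ?H" for x y using that a KR by auto
    show "(x \<oplus> x', y \<oplus> y') \<in> ?H" if "(x, y) \<in> ?H" "(x', y') \<in> ?H" for x y x' y'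
      using that right_ideal_add[OF K] a KR by (auto simp: r_distr)
    show "(x \<otimes> b, y \<otimes> b) \<in> ?H" if "(x, y) \<in> ?H" "b \<in> carrier R" for x y b
      using that right_ideal_mult[OF K] a KR by (auto simp: m_assoc)
  qed
  have sv: "y = \<zero>" if "(\<zero>, y) \<in> ?H" for y
  proof -
    have "y \<in> K" "a \<otimes> y = \<zero>" using that by auto
    then show ?thesis using dis KR by blast
  qed
  obtain g where g: "right_linear R (Domain ?H) g" "\<And>x y. (x, y) \<in> ?H \<Longrightarrow> g x = y"
    by (rule graph_function[OF H sv]) blast+
  have D: "Domain ?H = (\<otimes>) a ` K" by auto
  show thesis
    by (rule that[of g]) (use g graph_Domain[OF H] in \<open>auto simp: D\<close>)
qed

text \<open>Both \<open>aca\<close> and \<open>a\<close> vanish on the annihilator of \<open>a\<close>.\<close>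

lemma von_Neumann_inverse_if_left_inverse_on_complement:
  assumes a: "a \<in> carrier R" and c: "c \<in> carrier R" and K: "K \<subseteq> carrier R"
    and ess: "essential_right_ideal R ({x \<in> carrier R. a \<otimes> x = \<zero>} <+>\<^bsub>R\<^esub> K)"
    and inv: "\<And>k. k \<in> K \<Longrightarrow> c \<otimes> (a \<otimes> k) = k"
  shows "a \<otimes> c \<otimes> a = a"
  by (rule eq_if_eq_on_direct_sum[OF ess _ K]) (use a c K inv in \<open>auto simp: m_assoc subset_iff\<close>)

text \<open>Left multiplication by \<open>a\<close> embeds a complement \<open>K\<close> of its annihilator, and injectivity extends the inverse
\<open>aK \<rightarrow> K\<close> to a left multiplication.\<close>

lemma right_injective_imp_regular:
  assumes inj: "right_injective_ring R" shows "regular_ring R"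
  unfolding regular_ring_iff
proof
  fix a assume a: "a \<in> carrier R"
  obtain K where K: "right_ideal R K" "{x \<in> carrier R. a \<otimes> x = \<zero>} \<inter> K = {\<zero>}"
    "essential_right_ideal R ({x \<in> carrier R. a \<otimes> x = \<zero>} <+>\<^bsub>R\<^esub> K)"
    by (rule annihilator_complement[OF a]) blast
  obtain g where g: "right_ideal R ((\<otimes>) a ` K)" "right_linear R ((\<otimes>) a ` K) g"
    "\<And>k. k \<in> K \<Longrightarrow> g (a \<otimes> k) = k"
    by (rule left_mult_inverse_function[OF a K(1,2)]) blast
  obtain c where c: "c \<in> carrier R" "\<And>x. x \<in> (\<otimes>) a ` K \<Longrightarrow> g x = c \<otimes> x"
    by (rule right_injective_ring_extends[OF inj g(1,2)]) blast
  have "c \<otimes> (a \<otimes> k) = k" if "k \<in> K" for k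
    using c(2)[of "a \<otimes> k"] g(3)[OF that] that by auto
  then have "a \<otimes> c \<otimes> a = a"
    using right_ideal_memD[OF K(1)]
    by (intro von_Neumann_inverse_if_left_inverse_on_complement[OF a c(1) _ K(3)]) auto
  then show "\<exists>b\<in>carrier R. a \<otimes> b \<otimes> a = a" using c by blast
qed

text \<open>If \<open>t\<^sup>2 = 0\<close> then \<open>tR\<close> lies in the annihilator of \<open>t\<close>, so that \<open>kR\<close> and \<open>tkR\<close> meet in zero whenever
\<open>t\<close> is injective on \<open>kR\<close>.\<close>

lemma square_free_imp_reduced:
  assumes sf: "square_free_below R \<one>" and t: "t \<in> carrier R" and tt: "t \<otimes> t = \<zero>"
  shows "t = \<zero>"
proof (rule ccontr)
  assume nz: "t \<noteq> \<zero>"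
  obtain k where k: "k \<in> carrier R" "k \<noteq> \<zero>"
    and inj: "\<And>a. a \<in> carrier R \<Longrightarrow> t \<otimes> (k \<otimes> a) = \<zero> \<Longrightarrow> k \<otimes> a = \<zero>"
    by (rule left_mult_injective_somewhere[OF t nz]) blast
  have "k = \<zero>"
  proof (rule square_free_belowD[OF sf k(1) t _ _ inj])
    fix a b assume ab: "a \<in> carrier R" "b \<in> carrier R" "k \<otimes> a = t \<otimes> (k \<otimes> b)"
    have "t \<otimes> (k \<otimes> a) = \<zero>" unfolding ab(3) using cancel_left_assoc[OF tt t t] k ab by simp
    then show "k \<otimes> a = \<zero>" by (rule inj[OF ab(1)])
  qed (use k t in simp_all)
  then show False using k by simp
qed

text \<open>The elements \<open>ex - exe\<close> and \<open>xe - exe\<close> have square zero.\<close>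

lemma reduced_imp_idempotent_central:
  assumes red: "\<And>t. t \<in> carrier R \<Longrightarrow> t \<otimes> t = \<zero> \<Longrightarrow> t = \<zero>"
    and e: "e \<in> carrier R" "e \<otimes> e = e" and x: "x \<in> carrier R"
  shows "e \<otimes> x = x \<otimes> e"
proof -
  note ee = cancel_left_assoc[OF e(2) e(1) e(1)]
  have "e \<otimes> x \<ominus> e \<otimes> x \<otimes> e = \<zero>"
    by (rule red) (use e x in \<open>simp_all add: a_minus_def r_distr l_distr r_minus l_minus m_assoc ee
        r_neg l_neg minus_add\<close>)
  then have 1: "e \<otimes> x = e \<otimes> x \<otimes> e" 
    by (rule eq_if_minus_eq_zero[rotated 2]) (use e x in auto)
  have "x \<otimes> e \<ominus> e \<otimes> x \<otimes> e = \<zero>"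
  proof (rule red)
    let ?t = "x \<otimes> e \<ominus> e \<otimes> x \<otimes> e"
    show t: "?t \<in> carrier R" using e x by simp
    have "e \<otimes> ?t = \<zero>" using e x by (simp add: a_minus_def r_distr r_minus m_assoc ee r_neg)
    moreover have "?t \<otimes> y = x \<otimes> (e \<otimes> y) \<ominus> e \<otimes> x \<otimes> (e \<otimes> y)" if "y \<in> carrier R" for y
      using that e x by (simp add: a_minus_def l_distr l_minus m_assoc)
    from this[OF t] have "?t \<otimes> ?t = x \<otimes> (e \<otimes> ?t) \<ominus> e \<otimes> x \<otimes> (e \<otimes> ?t)" .
    ultimately show "?t \<otimes> ?t = \<zero>" using e x by (simp add: a_minus_def)
  qed
  then have "x \<otimes> e = e \<otimes> x \<otimes> e" 
    by (rule eq_if_minus_eq_zero[rotated 2]) (use e x in auto)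
  then show ?thesis using 1 by simp
qed

end

context partial_automorphism_extending_ring
begin

text \<open>Let \<open>I\<close> be the annihilator of \<open>a\<close> and \<open>K\<close> a complement. Since the ring is reduced, \<open>aK\<close> meets \<open>I\<close> in zero.
The sum \<open>I + aK\<close> is essential: otherwise square-freeness fails for some \<open>xR\<close> and \<open>axR\<close>. Hence
\<open>i + ak \<mapsto> i + k\<close> is a partial automorphism; it is defined on \<open>I + aK\<close> rather than on \<open>I + K\<close>
so that the element \<open>u\<close> representing it inverts \<open>a\<close> on \<open>aK\<close>.\<close>

lemma square_free_imp_regular:
  assumes sf: "square_free_below R \<one>" and a: "a \<in> carrier R"
  shows "\<exists>b\<in>carrier R. a \<otimes> b \<otimes> a = a"
proof -
  interpret reg: right_module R "right_regular_module R"
    by (rule right_module_regular) (rule ring_axioms)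
  note red = square_free_imp_reduced[OF sf]
  let ?I = "{x \<in> carrier R. a \<otimes> x = \<zero>}"
  obtain K where K: "right_ideal R K" and IK: "?I \<inter> K = {\<zero>}"
    and ess: "essential_right_ideal R (?I <+>\<^bsub>R\<^esub> K)" and I: "right_ideal R ?I"
    by (rule annihilator_complement[OF a]) blast
  obtain g where aK: "right_ideal R ((\<otimes>) a ` K)" and g: "right_linear R ((\<otimes>) a ` K) g"
    and gk: "\<And>k. k \<in> K \<Longrightarrow> g (a \<otimes> k) = k"
    by (rule left_mult_inverse_function[OF a K IK]) blast
  note KR = right_ideal_memD[OF K]
  have sq: "a \<otimes> x = \<zero>" if x: "x \<in> carrier R" and aax: "a \<otimes> (a \<otimes> x) = \<zero>" for x
  proof -
    have "a \<otimes> x \<otimes> a = \<zero>"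
      by (rule red) (use x a cancel_left_assoc[of a "a \<otimes> x" \<zero>] aax in \<open>simp_all add: m_assoc\<close>)
    then have "a \<otimes> (x \<otimes> (a \<otimes> x)) = \<zero>" using x a by (simp add: m_assoc[symmetric])
    then have "(a \<otimes> x) \<otimes> (a \<otimes> x) = \<zero>" using x a by (simp add: m_assoc)
    with m_closed[OF a x] show ?thesis by (rule red)
  qed
  have dis: "?I \<inter> (\<otimes>) a ` K = {\<zero>}"
    using sq KR right_ideal_zero_mem[OF I] right_ideal_zero_mem[OF aK] by blast
  have ess': "essential_right_ideal R (?I <+>\<^bsub>R\<^esub> (\<otimes>) a ` K)"
    unfolding essential_right_ideal_iff
  proof (intro conjI right_ideal_set_add[OF I aK] ballI impI)
    fix x assume x: "x \<in> carrier R" "x \<noteq> \<zero>"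
    show "\<exists>b\<in>carrier R. x \<otimes> b \<noteq> \<zero> \<and> x \<otimes> b \<in> ?I <+>\<^bsub>R\<^esub> (\<otimes>) a ` K"
    proof (cases "\<exists>b\<in>carrier R. x \<otimes> b \<noteq> \<zero> \<and> a \<otimes> (x \<otimes> b) = \<zero>")
      case True
      then obtain b where b: "b \<in> carrier R" "x \<otimes> b \<noteq> \<zero>" "a \<otimes> (x \<otimes> b) = \<zero>" by blast
      then have "x \<otimes> b \<in> ?I" using x by simp
      then show ?thesis using b right_ideal_set_add_left[OF I aK] by blast
    next
      case False
      have "\<exists>b\<in>carrier R. \<exists>b'\<in>carrier R. x \<otimes> b = a \<otimes> (x \<otimes> b') \<and> x \<otimes> b \<noteq> \<zero>"
      proof (rule ccontr)
        assume "\<not> ?thesis"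
        then have "x = \<zero>"
          using False by (intro square_free_belowD[OF sf x(1) a]) (use x a in auto)
        then show False using x by simp
      qed
      then obtain b b' where b: "b \<in> carrier R" "b' \<in> carrier R" "x \<otimes> b = a \<otimes> (x \<otimes> b')" "x \<otimes> b \<noteq> \<zero>"
        by blast
      let ?E = "{c \<in> carrier R. x \<otimes> b' \<otimes> c \<in> ?I <+>\<^bsub>R\<^esub> K}"
      have E: "essential_right_ideal R ?E" using x b by (intro essential_colon[OF ess]) auto
      obtain c where "c \<in> ?E" "c \<in> carrier R" and xbc: "x \<otimes> b \<otimes> c \<noteq> \<zero>"
        by (rule essential_nonzero[OF E m_closed[OF x(1) b(1)] b(4)]) blast
      then have c: "c \<in> carrier R" "x \<otimes> b' \<otimes> c \<in> ?I <+>\<^bsub>R\<^esub> K" "x \<otimes> b \<otimes> c \<noteq> \<zero>" by auto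
      from c(2) obtain i k where ik: "i \<in> ?I" "k \<in> K" "x \<otimes> b' \<otimes> c = i \<oplus> k" by (rule set_addE)
      have "x \<otimes> (b \<otimes> c) = x \<otimes> b \<otimes> c" by (rule m_assoc[symmetric, OF x(1) b(1) c(1)])
      also have "\<dots> = a \<otimes> (x \<otimes> b' \<otimes> c)"
        unfolding b(3) using x(1) b(2) c(1) a by (simp add: m_assoc)
      also have "\<dots> = a \<otimes> k" using ik a KR by (simp add: r_distr)
      finally have "x \<otimes> (b \<otimes> c) \<in> ?I <+>\<^bsub>R\<^esub> (\<otimes>) a ` K"
        using right_ideal_set_add_right[OF I aK] ik by simp
      then show ?thesis using c(1,3) m_assoc[OF x(1) b(1) c(1)] b(1) by (intro bexI[of _ "b \<otimes> c"]) auto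
    qed
  qed
  have id: "right_linear R ?I (\<lambda>x. x)" by (rule right_linear_onI) auto
  obtain k where k: "right_linear R (?I <+>\<^bsub>R\<^esub> (\<otimes>) a ` K) k"
    and kv: "\<And>i j. i \<in> ?I \<Longrightarrow> j \<in> (\<otimes>) a ` K \<Longrightarrow> k (i \<oplus> j) = i \<oplus> g j"
    and kK: "\<And>j. j \<in> (\<otimes>) a ` K \<Longrightarrow> k j = g j"
    by (rule reg.right_linear_on_glue[OF I aK dis id g]) auto
  note S = essential_imp_right_ideal[OF ess']
  have inj: "inj_on k (?I <+>\<^bsub>R\<^esub> (\<otimes>) a ` K)"
  proof (rule right_linear_inj_on[OF S k])
    fix x assume x: "x \<in> ?I <+>\<^bsub>R\<^esub> (\<otimes>) a ` K" and kx: "k x = \<zero>"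
    from x obtain i j where ij: "i \<in> ?I" "j \<in> (\<otimes>) a ` K" "x = i \<oplus> j" by (rule set_addE)
    from ij(2) obtain m where m: "m \<in> K" "j = a \<otimes> m" by blast
    have "i \<oplus> m = \<zero>" using kx kv[OF ij(1,2)] unfolding ij(3) m(2) gk[OF m(1)] by simp
    then have "i \<oplus> m = \<zero> \<oplus> \<zero>" by simp
    then have "i = \<zero>" "m = \<zero>"
      using direct_sum_unique[OF I K IK ij(1) right_ideal_zero_mem[OF I] m(1) right_ideal_zero_mem[OF K]]
      by blast+
    then show "x = \<zero>" using ij m a by simp
  qed
  have "?I <+>\<^bsub>R\<^esub> K \<subseteq> k ` (?I <+>\<^bsub>R\<^esub> (\<otimes>) a ` K)"
  proof
    fix x assume "x \<in> ?I <+>\<^bsub>R\<^esub> K"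
    then obtain i m where im: "i \<in> ?I" "m \<in> K" "x = i \<oplus> m" by (rule set_addE)
    have am: "a \<otimes> m \<in> (\<otimes>) a ` K" using im by blast
    have "x = k (i \<oplus> a \<otimes> m)" using kv[OF im(1) am] gk[OF im(2)] im by simp
    then show "x \<in> k ` (?I <+>\<^bsub>R\<^esub> (\<otimes>) a ` K)" using set_addI[OF im(1) am, of R] by blast
  qed
  then have "essential_right_ideal R (k ` (?I <+>\<^bsub>R\<^esub> (\<otimes>) a ` K))"
    by (rule essential_superset[OF ess right_linear_image[OF S k]])
  then obtain u where u: "u \<in> carrier R" "\<And>x. x \<in> ?I <+>\<^bsub>R\<^esub> (\<otimes>) a ` K \<Longrightarrow> k x = u \<otimes> x"
    by (rule partial_automorphisms_extendD[OF partial_automorphisms_extend ess' k inj]) blast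
  have "u \<otimes> (a \<otimes> m) = m" if m: "m \<in> K" for m
  proof -
    have am: "a \<otimes> m \<in> (\<otimes>) a ` K" using m by blast
    show ?thesis
      using u(2)[OF right_ideal_set_add_right[OF I aK am]] kK[OF am] gk[OF m] by simp
  qed
  then have "a \<otimes> u \<otimes> a = a"
    using KR by (intro von_Neumann_inverse_if_left_inverse_on_complement[OF a u(1) _ ess]) auto
  then show ?thesis using u by blast
qed

lemma square_free_imp_strongly_regular:
  assumes sf: "square_free_below R \<one>" shows "strongly_regular_ring R"
  unfolding strongly_regular_ring_def
proof
  fix a assume a: "a \<in> carrier R"
  obtain b where b: "b \<in> carrier R" "a \<otimes> b \<otimes> a = a"
    using square_free_imp_regular[OF sf a] by blast
  note * = principal_ideals_generated_by_idempotents[OF a b]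
  have "idempotents R \<subseteq> central_idempotents R"
    using reduced_imp_idempotent_central[OF square_free_imp_reduced[OF sf]]
    by (auto simp: central_idempotents_def idempotents_def)
  then show "(\<exists>e\<in>central_idempotents R. principal_right_ideal R a = principal_right_ideal R e) \<and>
      (\<exists>e\<in>central_idempotents R. principal_left_ideal R a = principal_left_ideal R e)"
    using * by blast
qed

end

section \<open>The maximal right ring of quotients\<close>

text \<open>The properties of the maximal right ring of quotients that refer only to right ideals of \<open>R\<close>: its elements
act as homomorphisms from essential right ideals to \<open>R\<close>, faithfully, and all such homomorphisms
occur.\<close>

definition represents_partial_maps ::
    "('a, 'r) ring_scheme \<Rightarrow> ('q, 's) ring_scheme \<Rightarrow> ('a \<Rightarrow> 'q) \<Rightarrow> bool" where
  "represents_partial_maps R Q \<iota> \<longleftrightarrow>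
     ring Q \<and> \<iota> \<in> ring_hom R Q \<and> inj_on \<iota> (carrier R) \<and>
     (\<forall>q\<in>carrier Q. \<exists>D. essential_right_ideal R D \<and> (\<forall>a\<in>D. q \<otimes>\<^bsub>Q\<^esub> \<iota> a \<in> \<iota> ` carrier R)) \<and>
     (\<forall>q\<in>carrier Q. \<forall>I. essential_right_ideal R I \<and> (\<forall>a\<in>I. q \<otimes>\<^bsub>Q\<^esub> \<iota> a = \<zero>\<^bsub>Q\<^esub>) \<longrightarrow> q = \<zero>\<^bsub>Q\<^esub>) \<and>
     (\<forall>I h. essential_right_ideal R I \<and> right_linear R I h \<longrightarrow>
        (\<exists>q\<in>carrier Q. \<forall>a\<in>I. q \<otimes>\<^bsub>Q\<^esub> \<iota> a = \<iota> (h a)))"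

lemma represents_partial_mapsD:
  assumes "represents_partial_maps R Q \<iota>"
  shows "ring Q" "\<iota> \<in> ring_hom R Q" "inj_on \<iota> (carrier R)"
    and "q \<in> carrier Q \<Longrightarrow> \<exists>D. essential_right_ideal R D \<and> (\<forall>a\<in>D. q \<otimes>\<^bsub>Q\<^esub> \<iota> a \<in> \<iota> ` carrier R)"
    and "q \<in> carrier Q \<Longrightarrow> essential_right_ideal R I \<Longrightarrow> (\<And>a. a \<in> I \<Longrightarrow> q \<otimes>\<^bsub>Q\<^esub> \<iota> a = \<zero>\<^bsub>Q\<^esub>) \<Longrightarrow> q = \<zero>\<^bsub>Q\<^esub>"
    and "essential_right_ideal R I \<Longrightarrow> right_linear R I h \<Longrightarrow>
      \<exists>q\<in>carrier Q. \<forall>a\<in>I. q \<otimes>\<^bsub>Q\<^esub> \<iota> a = \<iota> (h a)"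
proof -
  note * = assms[unfolded represents_partial_maps_def]
  note s2 = conjunct2[OF *] note s3 = conjunct2[OF s2] note s4 = conjunct2[OF s3]
  note s5 = conjunct2[OF s4] note s6 = conjunct2[OF s5]
  show "ring Q" "\<iota> \<in> ring_hom R Q" "inj_on \<iota> (carrier R)"
    by (fact conjunct1[OF *] conjunct1[OF s2] conjunct1[OF s3])+
  show "\<exists>D. essential_right_ideal R D \<and> (\<forall>a\<in>D. q \<otimes>\<^bsub>Q\<^esub> \<iota> a \<in> \<iota> ` carrier R)"
    if "q \<in> carrier Q" by (rule bspec[OF conjunct1[OF s4] that])
  show "q = \<zero>\<^bsub>Q\<^esub>" if "q \<in> carrier Q" "essential_right_ideal R I"
    "\<And>a. a \<in> I \<Longrightarrow> q \<otimes>\<^bsub>Q\<^esub> \<iota> a = \<zero>\<^bsub>Q\<^esub>"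
    by (rule mp[OF spec[of _ I, OF bspec[OF conjunct1[OF s5] that(1)]]]) (intro conjI ballI that(2,3))
  show "\<exists>q\<in>carrier Q. \<forall>a\<in>I. q \<otimes>\<^bsub>Q\<^esub> \<iota> a = \<iota> (h a)"
    if "essential_right_ideal R I" "right_linear R I h"
    by (rule mp[OF spec[of _ h, OF spec[of _ I, OF s6]]]) (intro conjI that)
qed

lemma represents_partial_maps_image:
  assumes rep: "represents_partial_maps R Q \<iota>" and R: "ring R" and f: "inj_on f (carrier Q)"
  shows "represents_partial_maps R (image_ring f Q) (f \<circ> \<iota>)"
proof -
  note rd = represents_partial_mapsD[OF rep]
  interpret R: ring R by (rule R)
  interpret Q: ring Q by (rule rd(1))
  have iso: "f \<in> ring_hom Q (image_ring f Q)" and ring: "ring (image_ring f Q)"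
    using Q.inj_imp_image_ring_is_ring[OF f] inj_imp_image_ring_iso[OF f] by (auto simp: ring_iso_def)
  have iQ: "\<iota> a \<in> carrier Q" if "a \<in> carrier R" for a using ring_hom_closed[OF rd(2) that] .
  have mult: "f q \<otimes>\<^bsub>image_ring f Q\<^esub> (f \<circ> \<iota>) a = f (q \<otimes>\<^bsub>Q\<^esub> \<iota> a)" if "q \<in> carrier Q" "a \<in> carrier R" for q a
    using ring_hom_mult[OF iso that(1) iQ[OF that(2)]] by simp
  have f0: "f q = \<zero>\<^bsub>image_ring f Q\<^esub> \<longleftrightarrow> q = \<zero>\<^bsub>Q\<^esub>" if "q \<in> carrier Q" for q
    using inj_on_eq_iff[OF f that Q.zero_closed] by (simp add: image_ring_zero)
  have sub: "a \<in> carrier R" if "essential_right_ideal R I" "a \<in> I" for I a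
    using R.right_ideal_memD[OF R.essential_imp_right_ideal[OF that(1)] that(2)] .
  show ?thesis
    unfolding represents_partial_maps_def
  proof (intro conjI ballI allI impI)
    show "ring (image_ring f Q)" by (rule ring)
    show "f \<circ> \<iota> \<in> ring_hom R (image_ring f Q)" by (rule ring_hom_trans[OF rd(2) iso])
    show "inj_on (f \<circ> \<iota>) (carrier R)"
      using rd(3) iQ by (intro comp_inj_on inj_on_subset[OF f]) auto
  next
    fix p assume "p \<in> carrier (image_ring f Q)"
    then obtain q where q: "q \<in> carrier Q" "p = f q" by (auto simp: image_ring_carrier)
    obtain D where D: "essential_right_ideal R D" "\<forall>a\<in>D. q \<otimes>\<^bsub>Q\<^esub> \<iota> a \<in> \<iota> ` carrier R"
      using rd(4)[OF q(1)] by blast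
    have "p \<otimes>\<^bsub>image_ring f Q\<^esub> (f \<circ> \<iota>) a \<in> (f \<circ> \<iota>) ` carrier R" if a: "a \<in> D" for a
      unfolding q(2) mult[OF q(1) sub[OF D(1) a]] image_comp[symmetric]
      using D(2) a by blast
    then show "\<exists>D. essential_right_ideal R D \<and>
        (\<forall>a\<in>D. p \<otimes>\<^bsub>image_ring f Q\<^esub> (f \<circ> \<iota>) a \<in> (f \<circ> \<iota>) ` carrier R)"
      using D(1) by (intro exI[of _ D] conjI ballI)
  next
    fix p I assume "p \<in> carrier (image_ring f Q)"
      and I: "essential_right_ideal R I \<and>
        (\<forall>a\<in>I. p \<otimes>\<^bsub>image_ring f Q\<^esub> (f \<circ> \<iota>) a = \<zero>\<^bsub>image_ring f Q\<^esub>)"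
    then obtain q where q: "q \<in> carrier Q" "p = f q" by (auto simp: image_ring_carrier)
    have "q = \<zero>\<^bsub>Q\<^esub>"
    proof (rule rd(5)[OF q(1)])
      show "essential_right_ideal R I" using I by blast
      fix a assume a: "a \<in> I"
      then have aR: "a \<in> carrier R" using I sub by blast
      have "f (q \<otimes>\<^bsub>Q\<^esub> \<iota> a) = \<zero>\<^bsub>image_ring f Q\<^esub>" using I a by (simp only: mult[OF q(1) aR, symmetric] q(2))
      then show "q \<otimes>\<^bsub>Q\<^esub> \<iota> a = \<zero>\<^bsub>Q\<^esub>" using q(1) iQ[OF aR] by (simp add: f0)
    qed
    then show "p = \<zero>\<^bsub>image_ring f Q\<^esub>" by (simp add: q(2) image_ring_zero)
  next
    fix I h assume Ih: "essential_right_ideal R I \<and> right_linear R I h"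
    then obtain q where q: "q \<in> carrier Q" "\<forall>a\<in>I. q \<otimes>\<^bsub>Q\<^esub> \<iota> a = \<iota> (h a)"
      using rd(6)[of I h] by blast
    have "f q \<otimes>\<^bsub>image_ring f Q\<^esub> (f \<circ> \<iota>) a = (f \<circ> \<iota>) (h a)" if "a \<in> I" for a
      using mult[OF q(1) sub[of I a]] q(2) Ih that by simp
    then show "\<exists>p\<in>carrier (image_ring f Q). \<forall>a\<in>I. p \<otimes>\<^bsub>image_ring f Q\<^esub> (f \<circ> \<iota>) a = (f \<circ> \<iota>) (h a)"
      using q(1) by (intro bexI[of _ "f q"] ballI) (auto simp: image_ring_carrier)
  qed
qed

context nonsingular_ring
begin

text \<open>For Baer's criterion, restrict a homomorphism \<open>h\<close> from \<open>I\<close> to \<open>Q\<close> to the right ideal \<open>D\<close> of elements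
that it maps into \<open>R\<close>. As \<open>D\<close> is essential, the restriction is left multiplication by some \<open>q \<in> Q\<close>, and
\<open>h x - qx\<close> is annihilated by an essential right ideal.\<close>

lemma represents_partial_maps_imp_max_right_quotient_ring:
  assumes rep: "represents_partial_maps R Q \<iota>"
  shows "is_max_right_quotient_ring R Q \<iota>"
proof -
  note rd = represents_partial_mapsD[OF rep]
  interpret Q: ring Q by (rule rd(1))
  let ?E = "restrict_scalars \<iota> Q"
  have E [simp]: "carrier ?E = carrier Q" "add ?E = add Q" "zero ?E = zero Q"
      "x \<star>\<^bsub>?E\<^esub> a = x \<otimes>\<^bsub>Q\<^esub> \<iota> a" for x a
    by (simp_all add: restrict_scalars_def)
  note iQ = ring_hom_closed[OF rd(2)]
  have "abelian_group ?E"
    by (rule abelian_groupI) (auto simp: Q.a_ac intro: bexI[of _ "\<ominus>\<^bsub>Q\<^esub> _"] Q.l_neg)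
  then interpret E: right_module R ?E
    by (intro right_module.intro right_module_axioms.intro ring_axioms)
      (simp_all add: iQ Q.l_distr Q.r_distr Q.m_assoc ring_hom_add[OF rd(2)]
        ring_hom_mult[OF rd(2)] ring_hom_one[OF rd(2)])
  have inj: "injective_module R ?E"
  proof (rule E.injective_module_if_extends_from_essential)
    fix I h assume I: "essential_right_ideal R I" and h: "right_linear_on R ?E I h"
    note rI = essential_imp_right_ideal[OF I]
    note IR = right_ideal_memD[OF rI]
    have hQ: "h x \<in> carrier Q" if "x \<in> I" for x using right_linear_on_closed[OF h that] by simp
    have hadd: "h (x \<oplus> y) = h x \<oplus>\<^bsub>Q\<^esub> h y" if "x \<in> I" "y \<in> I" for x y
      using right_linear_on_add[OF h that] by simp
    have hmult: "h (x \<otimes> a) = h x \<otimes>\<^bsub>Q\<^esub> \<iota> a" if "x \<in> I" "a \<in> carrier R" for x a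
      using right_linear_on_mult[OF h that] by simp
    define D where "D = {a \<in> I. h a \<in> \<iota> ` carrier R}"
    define k where "k = (\<lambda>a. inv_into (carrier R) \<iota> (h a))"
    have DI: "a \<in> I" if "a \<in> D" for a using that by (simp add: D_def)
    have k: "\<iota> (k a) = h a" "k a \<in> carrier R" if "a \<in> D" for a
      using that by (auto simp: D_def k_def f_inv_into_f inv_into_into)
    have kI: "a \<in> D" "k a = b" if "a \<in> I" "b \<in> carrier R" "h a = \<iota> b" for a b
    proof -
      show "a \<in> D" using that by (simp add: D_def)
      then show "k a = b" using k inj_onD[OF rd(3), of "k a" b] that by simp
    qed
    have Dadd: "a \<oplus> b \<in> D" "k (a \<oplus> b) = k a \<oplus> k b" if "a \<in> D" "b \<in> D" for a b
    proof -
      have "h (a \<oplus> b) = \<iota> (k a \<oplus> k b)" "a \<oplus> b \<in> I" "k a \<oplus> k b \<in> carrier R"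
        using that k DI right_ideal_add[OF rI] by (simp_all add: hadd ring_hom_add[OF rd(2)])
      then show "a \<oplus> b \<in> D" "k (a \<oplus> b) = k a \<oplus> k b" using kI by blast+
    qed
    have Dmult: "a \<otimes> b \<in> D" "k (a \<otimes> b) = k a \<otimes> b" if "a \<in> D" "b \<in> carrier R" for a b
    proof -
      have "h (a \<otimes> b) = \<iota> (k a \<otimes> b)" "a \<otimes> b \<in> I" "k a \<otimes> b \<in> carrier R"
        using that k DI right_ideal_mult[OF rI] by (simp_all add: hmult ring_hom_mult[OF rd(2)])
      then show "a \<otimes> b \<in> D" "k (a \<otimes> b) = k a \<otimes> b" using kI by blast+
    qed
    have h0: "h \<zero> = \<zero>\<^bsub>Q\<^esub>" using E.right_linear_on_zero[OF rI h] by simp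
    have D0: "\<zero> \<in> D"
      by (rule kI(1)[of \<zero> \<zero>]) (simp_all add: right_ideal_zero_mem[OF rI] h0 ring_hom_zero[OF rd(2) ring_axioms rd(1)])
    have rD: "right_ideal R D"
      unfolding right_ideal_iff using D0 Dadd(1) Dmult(1) DI IR by (intro conjI ballI subsetI) simp_all
    have kl: "right_linear R D k"
      by (rule right_linear_onI) (simp_all add: k Dadd Dmult)
    have essD: "essential_right_ideal R D"
      unfolding essential_right_ideal_iff
    proof (intro conjI rD ballI impI)
      fix b assume b: "b \<in> carrier R" "b \<noteq> \<zero>"
      then obtain c where c: "c \<in> carrier R" "b \<otimes> c \<noteq> \<zero>" "b \<otimes> c \<in> I"
        using I unfolding essential_right_ideal_iff by blast
      obtain F where F: "essential_right_ideal R F" "\<forall>a\<in>F. h (b \<otimes> c) \<otimes>\<^bsub>Q\<^esub> \<iota> a \<in> \<iota> ` carrier R"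
        using rd(4)[OF hQ[OF c(3)]] by blast
      obtain a where a: "a \<in> F" "b \<otimes> c \<otimes> a \<noteq> \<zero>" and aR: "a \<in> carrier R"
        by (rule essential_nonzero[OF F(1) m_closed[OF b(1) c(1)] c(2)]) blast
      have "b \<otimes> c \<otimes> a \<in> D"
        using F(2) a(1) right_ideal_mult[OF rI c(3) aR] by (simp add: D_def hmult[OF c(3) aR])
      then show "\<exists>a\<in>carrier R. b \<otimes> a \<noteq> \<zero> \<and> b \<otimes> a \<in> D"
        using a(2) aR b c by (intro bexI[of _ "c \<otimes> a"]) (simp_all add: m_assoc)
    qed
    obtain q where q: "q \<in> carrier Q" "\<forall>a\<in>D. q \<otimes>\<^bsub>Q\<^esub> \<iota> a = \<iota> (k a)"
      using rd(6)[OF essD kl] by blast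
    have "h x = q \<star>\<^bsub>?E\<^esub> x" if x: "x \<in> I" for x
    proof -
      note xR = IR[OF x]
      have c: "h x \<in> carrier Q" "q \<otimes>\<^bsub>Q\<^esub> \<iota> x \<in> carrier Q" using hQ[OF x] q iQ[OF xR] by auto
      have "h x \<ominus>\<^bsub>Q\<^esub> q \<otimes>\<^bsub>Q\<^esub> \<iota> x = \<zero>\<^bsub>Q\<^esub>"
      proof (rule rd(5)[OF _ essential_colon[OF essD xR]])
        show "h x \<ominus>\<^bsub>Q\<^esub> q \<otimes>\<^bsub>Q\<^esub> \<iota> x \<in> carrier Q" using c by simp
        fix a assume "a \<in> {a \<in> carrier R. x \<otimes> a \<in> D}"
        then have a: "a \<in> carrier R" "x \<otimes> a \<in> D" by auto
        have "q \<otimes>\<^bsub>Q\<^esub> \<iota> x \<otimes>\<^bsub>Q\<^esub> \<iota> a = q \<otimes>\<^bsub>Q\<^esub> \<iota> (x \<otimes> a)"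
          using q(1) iQ xR a(1) by (simp add: Q.m_assoc ring_hom_mult[OF rd(2)])
        also have "\<dots> = h (x \<otimes> a)" using q(2) a(2) k(1) by simp
        also have "\<dots> = h x \<otimes>\<^bsub>Q\<^esub> \<iota> a" by (rule hmult[OF x a(1)])
        finally show "(h x \<ominus>\<^bsub>Q\<^esub> q \<otimes>\<^bsub>Q\<^esub> \<iota> x) \<otimes>\<^bsub>Q\<^esub> \<iota> a = \<zero>\<^bsub>Q\<^esub>"
          using c iQ[OF a(1)] by (simp add: a_minus_def Q.l_distr Q.l_minus Q.r_neg)
      qed
      then show ?thesis using Q.eq_if_minus_eq_zero[OF c] by simp
    qed
    then show "\<exists>e\<in>carrier ?E. \<forall>x\<in>I. h x = e \<star>\<^bsub>?E\<^esub> x" using q(1) by auto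
  qed
  have "essential_submodule R ?E (\<iota> ` carrier R)"
    unfolding E.essential_submodule_iff
  proof (intro conjI ballI impI)
    show "right_submodule R ?E (\<iota> ` carrier R)"
      unfolding E.right_submodule_iff
      using iQ ring_hom_zero[OF rd(2) ring_axioms rd(1)]
      by (auto simp: ring_hom_add[OF rd(2), symmetric] ring_hom_mult[OF rd(2), symmetric] image_iff
          intro: bexI[of _ \<zero>])
    fix q assume q: "q \<in> carrier ?E" "q \<noteq> \<zero>\<^bsub>?E\<^esub>"
    then have qQ: "q \<in> carrier Q" "q \<noteq> \<zero>\<^bsub>Q\<^esub>" by simp_all
    obtain D where D: "essential_right_ideal R D" "\<forall>a\<in>D. q \<otimes>\<^bsub>Q\<^esub> \<iota> a \<in> \<iota> ` carrier R"
      using rd(4)[OF qQ(1)] by blast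
    have "\<exists>a\<in>D. q \<otimes>\<^bsub>Q\<^esub> \<iota> a \<noteq> \<zero>\<^bsub>Q\<^esub>"
      by (rule ccontr) (use rd(5)[OF qQ(1) D(1)] qQ(2) in blast)
    then obtain a where a: "a \<in> D" "q \<otimes>\<^bsub>Q\<^esub> \<iota> a \<noteq> \<zero>\<^bsub>Q\<^esub>" by blast
    then show "\<exists>a\<in>carrier R. q \<star>\<^bsub>?E\<^esub> a \<noteq> \<zero>\<^bsub>?E\<^esub> \<and> q \<star>\<^bsub>?E\<^esub> a \<in> \<iota> ` carrier R"
      using D(2) right_ideal_memD[OF essential_imp_right_ideal[OF D(1)] a(1)]
      by (intro bexI[of _ a]) simp_all
  qed
  moreover have "\<iota> \<in> right_module_hom R (right_regular_module R) ?E"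
    using iQ by (auto simp: right_module_hom_def ring_hom_add[OF rd(2)] ring_hom_mult[OF rd(2)])
  ultimately have "is_injective_hull R (right_regular_module R) ?E \<iota>"
    using inj rd(3) by (simp add: is_injective_hull_def)
  then show ?thesis using rd(1-3) by (simp add: is_max_right_quotient_ring_def)
qed

text \<open>The elements of \<open>Q\<close> that represent a partial automorphism and its inverse are inverse to each other.\<close>

lemma partial_automorphisms_extend_if_units_represented:
  assumes rep: "represents_partial_maps R Q \<iota>" and units: "Units Q \<subseteq> \<iota> ` carrier R"
  shows "partial_automorphisms_extend R"
  unfolding partial_automorphisms_extend_def
proof (intro allI impI, elim conjE)
  fix I h
  assume I: "essential_right_ideal R I" and h: "right_linear R I h" and inj: "inj_on h I"
    and im: "essential_right_ideal R (h ` I)"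
  note rd = represents_partial_mapsD[OF rep]
  interpret Q: ring Q by (rule rd(1))
  note iQ = ring_hom_closed[OF rd(2)]
  note IR = right_ideal_memD[OF essential_imp_right_ideal[OF I]]
  have hR: "h x \<in> carrier R" if "x \<in> I" for x using right_linear_on_closed[OF h that] by simp
  define k where "k = inv_into I h"
  have k: "k (h x) = x" if "x \<in> I" for x using inv_into_f_f[OF inj that] by (simp add: k_def)
  have kl: "right_linear R (h ` I) k"
  proof (rule right_linear_onI)
    fix x assume "x \<in> h ` I"
    then obtain a where a: "a \<in> I" "x = h a" by blast
    show "k x \<in> carrier (right_regular_module R)" using a k IR by simp
    show "k (x \<oplus> y) = k x \<oplus>\<^bsub>right_regular_module R\<^esub> k y" if "y \<in> h ` I" for y
    proof -
      from that obtain b where b: "b \<in> I" "y = h b" by blast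
      have "h (a \<oplus> b) = x \<oplus> y" using right_linear_on_add[OF h a(1) b(1)] a b by simp
      then show ?thesis
        using k[OF right_ideal_add[OF essential_imp_right_ideal[OF I] a(1) b(1)]] a b k by simp
    qed
    show "k (x \<otimes> r) = k x \<star>\<^bsub>right_regular_module R\<^esub> r" if r: "r \<in> carrier R" for r
    proof -
      have "h (a \<otimes> r) = x \<otimes> r" using right_linear_on_mult[OF h a(1) r] a by simp
      then show ?thesis
        using k[OF right_ideal_mult[OF essential_imp_right_ideal[OF I] a(1) r]] a k by simp
    qed
  qed
  obtain q where q: "q \<in> carrier Q" "\<forall>a\<in>I. q \<otimes>\<^bsub>Q\<^esub> \<iota> a = \<iota> (h a)" using rd(6)[OF I h] by blast
  obtain p where p: "p \<in> carrier Q" "\<forall>a\<in>h ` I. p \<otimes>\<^bsub>Q\<^esub> \<iota> a = \<iota> (k a)" using rd(6)[OF im kl] by blast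
  have one: "s = \<one>\<^bsub>Q\<^esub>" if s: "s \<in> carrier Q" and J: "essential_right_ideal R J"
    and eq: "\<And>a. a \<in> J \<Longrightarrow> s \<otimes>\<^bsub>Q\<^esub> \<iota> a = \<iota> a" for s J
  proof -
    have "s \<ominus>\<^bsub>Q\<^esub> \<one>\<^bsub>Q\<^esub> = \<zero>\<^bsub>Q\<^esub>"
    proof (rule rd(5)[OF _ J])
      fix a assume a: "a \<in> J"
      have "\<iota> a \<in> carrier Q" using iQ right_ideal_memD[OF essential_imp_right_ideal[OF J] a] by blast
      then show "(s \<ominus>\<^bsub>Q\<^esub> \<one>\<^bsub>Q\<^esub>) \<otimes>\<^bsub>Q\<^esub> \<iota> a = \<zero>\<^bsub>Q\<^esub>"
        using s eq[OF a] by (simp add: a_minus_def Q.l_distr Q.l_minus Q.r_neg)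
    qed (use s in simp)
    then show ?thesis by (rule Q.eq_if_minus_eq_zero[OF s Q.one_closed])
  qed
  have "p \<otimes>\<^bsub>Q\<^esub> q = \<one>\<^bsub>Q\<^esub>"
    by (rule one[OF _ I]) (use p q iQ IR k in \<open>simp_all add: Q.m_assoc\<close>)
  moreover have "q \<otimes>\<^bsub>Q\<^esub> p = \<one>\<^bsub>Q\<^esub>"
  proof (rule one[OF _ im])
    fix b assume b: "b \<in> h ` I"
    then obtain a where a: "a \<in> I" "b = h a" by blast
    show "q \<otimes>\<^bsub>Q\<^esub> p \<otimes>\<^bsub>Q\<^esub> \<iota> b = \<iota> b"
      using p q iQ[OF hR[OF a(1)]] b a k[OF a(1)] by (simp add: Q.m_assoc)
  qed (use p q in simp)
  ultimately have "q \<in> Units Q" using p q by (auto simp: Units_def)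
  then obtain c where c: "c \<in> carrier R" "q = \<iota> c" using units by blast
  have "h x = c \<otimes> x" if x: "x \<in> I" for x
  proof -
    have "\<iota> (h x) = \<iota> (c \<otimes> x)" using q(2) x c IR[OF x] by (simp add: ring_hom_mult[OF rd(2)])
    then show ?thesis using inj_onD[OF rd(3)] hR[OF x] c IR[OF x] by simp
  qed
  then show "\<exists>c\<in>carrier R. \<forall>x\<in>I. h x = c \<otimes> x" using c by blast
qed

end

definition essential_partial_map :: "('a, 'r) ring_scheme \<Rightarrow> ('a \<times> 'a) set \<Rightarrow> bool" where
  "essential_partial_map R G \<longleftrightarrow> graph_submodule R G \<and>
     (\<forall>y. (\<zero>\<^bsub>R\<^esub>, y) \<in> G \<longrightarrow> y = \<zero>\<^bsub>R\<^esub>) \<and> essential_right_ideal R (Domain G)"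

text \<open>The largest extension of \<open>G\<close>: in the torsion theory of non-singular modules this is the closure of \<open>G\<close> in
\<open>R \<times> R\<close>. Two homomorphisms from essential right ideals that agree on an essential right
ideal have the same closure.\<close>

definition graph_closure :: "('a, 'r) ring_scheme \<Rightarrow> ('a \<times> 'a) set \<Rightarrow> ('a \<times> 'a) set" where
  "graph_closure R G = {(x, y). x \<in> carrier R \<and> y \<in> carrier R \<and>
     essential_right_ideal R {a \<in> carrier R. (x \<otimes>\<^bsub>R\<^esub> a, y \<otimes>\<^bsub>R\<^esub> a) \<in> G}}"

definition graph_sum :: "('a, 'r) ring_scheme \<Rightarrow> ('a \<times> 'a) set \<Rightarrow> ('a \<times> 'a) set \<Rightarrow> ('a \<times> 'a) set" where
  "graph_sum R G H = {(x, y \<oplus>\<^bsub>R\<^esub> z) | x y z. (x, y) \<in> G \<and> (x, z) \<in> H}"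

definition left_mult_graph :: "('a, 'r) ring_scheme \<Rightarrow> 'a \<Rightarrow> ('a \<times> 'a) set" where
  "left_mult_graph R a = {(x, a \<otimes>\<^bsub>R\<^esub> x) | x. x \<in> carrier R}"

text \<open>A concrete maximal right ring of quotients. Every class of homomorphisms from essential right ideals, up to
agreement on smaller essential right ideals, is represented by its largest member. In the product \<open>H\<close> is applied
before \<open>G\<close>, as for left multiplications.\<close>

definition partial_map_ring :: "('a, 'r) ring_scheme \<Rightarrow> ('a \<times> 'a) set ring" where
  "partial_map_ring R =
     \<lparr>carrier = {G. essential_partial_map R G \<and> graph_closure R G = G},
      mult = (\<lambda>G H. graph_closure R (H O G)),
      one = left_mult_graph R \<one>\<^bsub>R\<^esub>, zero = left_mult_graph R \<zero>\<^bsub>R\<^esub>,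
      add = (\<lambda>G H. graph_closure R (graph_sum R G H))\<rparr>"

context nonsingular_ring
begin

lemma essential_partial_mapD:
  assumes "essential_partial_map R G"
  shows "graph_submodule R G" "(\<zero>, y) \<in> G \<Longrightarrow> y = \<zero>" "essential_right_ideal R (Domain G)"
    "(x, y) \<in> G \<Longrightarrow> (x, z) \<in> G \<Longrightarrow> y = z"
proof -
  show H: "graph_submodule R G" and sv: "\<And>y. (\<zero>, y) \<in> G \<Longrightarrow> y = \<zero>" and "essential_right_ideal R (Domain G)"
    using assms by (auto simp: essential_partial_map_def)
  obtain h where "\<And>x y. (x, y) \<in> G \<Longrightarrow> h x = y"
    by (rule graph_function[OF H sv]) blast+
  then show "(x, y) \<in> G \<Longrightarrow> (x, z) \<in> G \<Longrightarrow> y = z" by metis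
qed

lemma essential_partial_mapI:
  assumes "graph_submodule R G" "\<And>y. (\<zero>, y) \<in> G \<Longrightarrow> y = \<zero>" "essential_right_ideal R (Domain G)"
  shows "essential_partial_map R G"
  using assms by (simp add: essential_partial_map_def)

lemma graph_transporter_right_ideal:
  assumes "graph_submodule R G" "x \<in> carrier R" "y \<in> carrier R"
  shows "right_ideal R {a \<in> carrier R. (x \<otimes> a, y \<otimes> a) \<in> G}"
  using assms graph_zero[OF assms(1)] graph_add[OF assms(1)] graph_mult[OF assms(1)]
  by (auto simp: right_ideal_iff r_distr m_assoc[symmetric])

lemma graph_closureI:
  assumes "graph_submodule R G" "x \<in> carrier R" "y \<in> carrier R" "essential_right_ideal R D"
    "\<And>a. a \<in> D \<Longrightarrow> (x \<otimes> a, y \<otimes> a) \<in> G"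
  shows "(x, y) \<in> graph_closure R G"
proof -
  have "essential_right_ideal R {a \<in> carrier R. (x \<otimes> a, y \<otimes> a) \<in> G}"
    by (rule essential_superset[OF assms(4) graph_transporter_right_ideal[OF assms(1-3)]])
      (use assms(5) right_ideal_memD[OF essential_imp_right_ideal[OF assms(4)]] in blast)
  then show ?thesis using assms by (simp add: graph_closure_def)
qed

lemma graph_closureE:
  assumes "(x, y) \<in> graph_closure R G"
  obtains D where "x \<in> carrier R" "y \<in> carrier R" "essential_right_ideal R D"
    "\<And>a. a \<in> D \<Longrightarrow> a \<in> carrier R \<and> (x \<otimes> a, y \<otimes> a) \<in> G"
  using assms that[of "{a \<in> carrier R. (x \<otimes> a, y \<otimes> a) \<in> G}"] unfolding graph_closure_def by blast

lemma graph_subset_closure: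
  assumes G: "graph_submodule R G" shows "G \<subseteq> graph_closure R G"
proof (clarify)
  fix x y assume xy: "(x, y) \<in> G"
  show "(x, y) \<in> graph_closure R G"
    by (rule graph_closureI[OF G graph_closed[OF G xy] essential_carrier graph_mult[OF G xy]])
qed

lemma essential_partial_map_closure:
  assumes G: "essential_partial_map R G" shows "essential_partial_map R (graph_closure R G)"
proof (rule essential_partial_mapI)
  note G' = essential_partial_mapD[OF G]
  show sub: "graph_submodule R (graph_closure R G)"
  proof (rule graph_submoduleI)
    show "x \<in> carrier R \<and> y \<in> carrier R" if "(x, y) \<in> graph_closure R G" for x y
      using that by (auto simp: graph_closure_def)
    show "(\<zero>, \<zero>) \<in> graph_closure R G" using graph_subset_closure[OF G'(1)] graph_zero[OF G'(1)] by blast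
    fix x y assume xy: "(x, y) \<in> graph_closure R G"
    obtain D where D: "x \<in> carrier R" "y \<in> carrier R" "essential_right_ideal R D"
      "\<And>a. a \<in> D \<Longrightarrow> a \<in> carrier R \<and> (x \<otimes> a, y \<otimes> a) \<in> G" by (rule graph_closureE[OF xy]) blast
    show "(x \<oplus> x', y \<oplus> y') \<in> graph_closure R G" if xy': "(x', y') \<in> graph_closure R G" for x' y'
    proof -
      obtain D' where D': "x' \<in> carrier R" "y' \<in> carrier R" "essential_right_ideal R D'"
        "\<And>a. a \<in> D' \<Longrightarrow> a \<in> carrier R \<and> (x' \<otimes> a, y' \<otimes> a) \<in> G" by (rule graph_closureE[OF xy']) blast
      show ?thesis
      proof (rule graph_closureI[OF G'(1) _ _ essential_Int[OF D(3) D'(3)]])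
        fix a assume "a \<in> D \<inter> D'"
        then have a: "a \<in> carrier R" "(x \<otimes> a, y \<otimes> a) \<in> G" "(x' \<otimes> a, y' \<otimes> a) \<in> G"
          using D(4) D'(4) by blast+
        show "((x \<oplus> x') \<otimes> a, (y \<oplus> y') \<otimes> a) \<in> G"
          using graph_add[OF G'(1) a(2,3)] a(1) D(1,2) D'(1,2) by (simp add: l_distr)
      qed (use D D' in auto)
    qed
    show "(x \<otimes> b, y \<otimes> b) \<in> graph_closure R G" if b: "b \<in> carrier R" for b
    proof (rule graph_closureI[OF G'(1) _ _ essential_colon[OF D(3) b]])
      fix a assume "a \<in> {a \<in> carrier R. b \<otimes> a \<in> D}"
      then have "a \<in> carrier R" "(x \<otimes> (b \<otimes> a), y \<otimes> (b \<otimes> a)) \<in> G" using D(4) by blast+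
      then show "(x \<otimes> b \<otimes> a, y \<otimes> b \<otimes> a) \<in> G" using D(1,2) b by (simp add: m_assoc)
    qed (use D b in auto)
  qed
  show "y = \<zero>" if y0: "(\<zero>, y) \<in> graph_closure R G" for y
  proof -
    obtain D where D: "y \<in> carrier R" "essential_right_ideal R D"
      "\<And>a. a \<in> D \<Longrightarrow> a \<in> carrier R \<and> (\<zero> \<otimes> a, y \<otimes> a) \<in> G" by (rule graph_closureE[OF y0]) blast
    show ?thesis
    proof (rule essential_cancel[OF D(2,1)])
      fix a assume "a \<in> D"
      then have "a \<in> carrier R" "(\<zero> \<otimes> a, y \<otimes> a) \<in> G" using D(3) by blast+
      then have "(\<zero>, y \<otimes> a) \<in> G" by simp
      then show "y \<otimes> a = \<zero>" by (rule G'(2))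
    qed
  qed
  show "essential_right_ideal R (Domain (graph_closure R G))"
    using graph_subset_closure[OF G'(1)]
    by (intro essential_superset[OF G'(3) graph_Domain[OF sub]]) blast
qed

text \<open>Essentiality is transitive here because in a non-singular ring a non-zero element is not annihilated by an
essential right ideal.\<close>

lemma graph_closure_idem:
  assumes G: "essential_partial_map R G"
  shows "graph_closure R (graph_closure R G) = graph_closure R G"
proof
  note G' = essential_partial_mapD[OF G]
  note C = essential_partial_mapD(1)[OF essential_partial_map_closure[OF G]]
  show "graph_closure R G \<subseteq> graph_closure R (graph_closure R G)" by (rule graph_subset_closure[OF C])
  show "graph_closure R (graph_closure R G) \<subseteq> graph_closure R G"
  proof clarify
    fix x y assume xy: "(x, y) \<in> graph_closure R (graph_closure R G)"
    obtain D where D: "x \<in> carrier R" "y \<in> carrier R" "essential_right_ideal R D"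
      "\<And>a. a \<in> D \<Longrightarrow> a \<in> carrier R \<and> (x \<otimes> a, y \<otimes> a) \<in> graph_closure R G" by (rule graph_closureE[OF xy]) blast
    let ?F = "{a \<in> carrier R. (x \<otimes> a, y \<otimes> a) \<in> G}"
    have "essential_right_ideal R ?F"
      unfolding essential_right_ideal_iff
    proof (intro conjI graph_transporter_right_ideal[OF G'(1) D(1,2)] ballI impI)
      fix b assume b: "b \<in> carrier R" "b \<noteq> \<zero>"
      then obtain c where c: "c \<in> carrier R" "b \<otimes> c \<noteq> \<zero>" "b \<otimes> c \<in> D"
        using D(3) unfolding essential_right_ideal_iff by blast
      obtain E where E: "essential_right_ideal R E"
        "\<And>a. a \<in> E \<Longrightarrow> a \<in> carrier R \<and> (x \<otimes> (b \<otimes> c) \<otimes> a, y \<otimes> (b \<otimes> c) \<otimes> a) \<in> G"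
        by (rule graph_closureE[OF conjunct2[OF D(4)[OF c(3)]]]) blast
      obtain a where a: "a \<in> E" "a \<in> carrier R" "b \<otimes> c \<otimes> a \<noteq> \<zero>"
        by (rule essential_nonzero[OF E(1) m_closed[OF b(1) c(1)] c(2)]) blast
      show "\<exists>a\<in>carrier R. b \<otimes> a \<noteq> \<zero> \<and> b \<otimes> a \<in> ?F"
        using a(2,3) conjunct2[OF E(2)[OF a(1)]] b c D(1,2) by (intro bexI[of _ "c \<otimes> a"]) (simp_all add: m_assoc)
    qed
    then show "(x, y) \<in> graph_closure R G" using D by (simp add: graph_closure_def)
  qed
qed

lemma partial_map_ring_simps:
  "carrier (partial_map_ring R) = {G. essential_partial_map R G \<and> graph_closure R G = G}"
  "G \<otimes>\<^bsub>partial_map_ring R\<^esub> H = graph_closure R (H O G)"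
  "\<one>\<^bsub>partial_map_ring R\<^esub> = left_mult_graph R \<one>" "\<zero>\<^bsub>partial_map_ring R\<^esub> = left_mult_graph R \<zero>"
  "G \<oplus>\<^bsub>partial_map_ring R\<^esub> H = graph_closure R (graph_sum R G H)"
  by (simp_all add: partial_map_ring_def)

lemma closure_mem_partial_map_ring:
  "essential_partial_map R G \<Longrightarrow> graph_closure R G \<in> carrier (partial_map_ring R)"
  by (simp add: partial_map_ring_simps essential_partial_map_closure graph_closure_idem)

lemma partial_map_ring_memD:
  "G \<in> carrier (partial_map_ring R) \<Longrightarrow> essential_partial_map R G"
  by (simp add: partial_map_ring_simps)

text \<open>With this rule the ring laws reduce to inclusions between composites and sums of graphs, for which
closures can be ignored.\<close>

lemma partial_map_ring_eqI:
  assumes G: "G \<in> carrier (partial_map_ring R)" and H: "H \<in> carrier (partial_map_ring R)"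
    and K: "essential_partial_map R K" and KG: "K \<subseteq> G" and KH: "K \<subseteq> H"
  shows "G = H"
proof -
  have sub: "G \<subseteq> H"
    if G: "G \<in> carrier (partial_map_ring R)" and H: "H \<in> carrier (partial_map_ring R)"
      and KG: "K \<subseteq> G" and KH: "K \<subseteq> H" for G H
  proof clarify
    fix x y assume xy: "(x, y) \<in> G"
    note G' = essential_partial_mapD[OF partial_map_ring_memD[OF G]]
    note H' = essential_partial_mapD[OF partial_map_ring_memD[OF H]]
    note K' = essential_partial_mapD[OF K]
    note c = graph_closed[OF G'(1) xy]
    have "(x, y) \<in> graph_closure R H"
    proof (rule graph_closureI[OF H'(1) c essential_colon[OF K'(3) c(1)]])
      fix a assume "a \<in> {a \<in> carrier R. x \<otimes> a \<in> Domain K}"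
      then obtain z where a: "a \<in> carrier R" "(x \<otimes> a, z) \<in> K" by blast
      have "(x \<otimes> a, y \<otimes> a) \<in> G" by (rule graph_mult[OF G'(1) xy a(1)])
      then have "z = y \<otimes> a" using G'(4) a(2) KG by blast
      then show "(x \<otimes> a, y \<otimes> a) \<in> H" using a(2) KH by blast
    qed
    then show "(x, y) \<in> H" using H by (simp add: partial_map_ring_simps)
  qed
  show ?thesis using sub[OF G H KG KH] sub[OF H G KH KG] by blast
qed

lemma essential_partial_map_comp:
  assumes G: "essential_partial_map R G" and H: "essential_partial_map R H"
  shows "essential_partial_map R (H O G)"
proof (rule essential_partial_mapI)
  note G' = essential_partial_mapD[OF G] and H' = essential_partial_mapD[OF H]
  show sub: "graph_submodule R (H O G)"
  proof (rule graph_submoduleI)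
    show "x \<in> carrier R \<and> z \<in> carrier R" if "(x, z) \<in> H O G" for x z
      using that graph_closed[OF G'(1)] graph_closed[OF H'(1)] by blast
    show "(\<zero>, \<zero>) \<in> H O G" using graph_zero[OF G'(1)] graph_zero[OF H'(1)] by blast
    show "(x \<oplus> x', z \<oplus> z') \<in> H O G" if "(x, z) \<in> H O G" "(x', z') \<in> H O G" for x z x' z'
      using that graph_add[OF G'(1)] graph_add[OF H'(1)] by blast
    show "(x \<otimes> a, z \<otimes> a) \<in> H O G" if "(x, z) \<in> H O G" "a \<in> carrier R" for x z a
      using that graph_mult[OF G'(1)] graph_mult[OF H'(1)] by blast
  qed
  show "z = \<zero>" if "(\<zero>, z) \<in> H O G" for z using that G'(2) H'(2) by blast
  show "essential_right_ideal R (Domain (H O G))"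
    unfolding essential_right_ideal_iff
  proof (intro conjI graph_Domain[OF sub] ballI impI)
    fix x assume x: "x \<in> carrier R" "x \<noteq> \<zero>"
    obtain a where a: "a \<in> carrier R" "x \<otimes> a \<noteq> \<zero>" "x \<otimes> a \<in> Domain H"
      using H'(3) x unfolding essential_right_ideal_iff by blast
    then obtain y where y: "(x \<otimes> a, y) \<in> H" by blast
    note E = essential_colon[OF G'(3) graph_closed(2)[OF H'(1) y]]
    obtain b where b: "b \<in> {b \<in> carrier R. y \<otimes> b \<in> Domain G}" "b \<in> carrier R" "x \<otimes> a \<otimes> b \<noteq> \<zero>"
      by (rule essential_nonzero[OF E m_closed[OF x(1) a(1)] a(2)]) blast
    have "x \<otimes> a \<otimes> b \<in> Domain (H O G)" using b(1) graph_mult[OF H'(1) y b(2)] by blast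
    then show "\<exists>a\<in>carrier R. x \<otimes> a \<noteq> \<zero> \<and> x \<otimes> a \<in> Domain (H O G)"
      using x a b by (intro bexI[of _ "a \<otimes> b"]) (simp_all add: m_assoc)
  qed
qed

lemma essential_partial_map_sum:
  assumes G: "essential_partial_map R G" and H: "essential_partial_map R H"
  shows "essential_partial_map R (graph_sum R G H)"
proof (rule essential_partial_mapI)
  note G' = essential_partial_mapD[OF G] and H' = essential_partial_mapD[OF H]
  note cl = graph_closed[OF G'(1)] graph_closed[OF H'(1)]
  show "graph_submodule R (graph_sum R G H)"
  proof (rule graph_submoduleI)
    show "x \<in> carrier R \<and> z \<in> carrier R" if "(x, z) \<in> graph_sum R G H" for x z
      using that cl by (auto simp: graph_sum_def)
    show "(\<zero>, \<zero>) \<in> graph_sum R G H"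
      using graph_zero[OF G'(1)] graph_zero[OF H'(1)] unfolding graph_sum_def by force
    fix x z assume "(x, z) \<in> graph_sum R G H"
    then obtain y w where yw: "(x, y) \<in> G" "(x, w) \<in> H" "z = y \<oplus> w" unfolding graph_sum_def by blast
    note c = cl(1,2)[OF yw(1)] cl(4)[OF yw(2)]
    show "(x \<oplus> x', z \<oplus> z') \<in> graph_sum R G H" if "(x', z') \<in> graph_sum R G H" for x' z'
    proof -
      from that obtain y' w' where yw': "(x', y') \<in> G" "(x', w') \<in> H" "z' = y' \<oplus> w'"
        unfolding graph_sum_def by blast
      have "z \<oplus> z' = (y \<oplus> y') \<oplus> (w \<oplus> w')"
        using c cl(2)[OF yw'(1)] cl(4)[OF yw'(2)] by (simp add: yw(3) yw'(3) a_ac)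
      then show ?thesis
        using graph_add[OF G'(1) yw(1) yw'(1)] graph_add[OF H'(1) yw(2) yw'(2)]
        unfolding graph_sum_def by blast
    qed
    show "(x \<otimes> a, z \<otimes> a) \<in> graph_sum R G H" if a: "a \<in> carrier R" for a
    proof -
      have "z \<otimes> a = y \<otimes> a \<oplus> w \<otimes> a" using c a by (simp add: yw(3) l_distr)
      then show ?thesis
        using graph_mult[OF G'(1) yw(1) a] graph_mult[OF H'(1) yw(2) a] unfolding graph_sum_def by blast
    qed
  qed
  show "z = \<zero>" if z0: "(\<zero>, z) \<in> graph_sum R G H" for z
  proof -
    from z0 obtain y w where yw: "(\<zero>, y) \<in> G" "(\<zero>, w) \<in> H" "z = y \<oplus> w"
      unfolding graph_sum_def by blast
    show ?thesis using G'(2)[OF yw(1)] H'(2)[OF yw(2)] yw(3) by simp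
  qed
  have "Domain (graph_sum R G H) = Domain G \<inter> Domain H" unfolding graph_sum_def by blast
  then show "essential_right_ideal R (Domain (graph_sum R G H))"
    using essential_Int[OF G'(3) H'(3)] by simp
qed

lemma essential_partial_map_neg:
  assumes G: "essential_partial_map R G"
  shows "essential_partial_map R {(x, \<ominus> y) | x y. (x, y) \<in> G}"
proof (rule essential_partial_mapI)
  let ?N = "{(x, \<ominus> y) | x y. (x, y) \<in> G}"
  note G' = essential_partial_mapD[OF G]
  note cl = graph_closed[OF G'(1)]
  show "graph_submodule R ?N"
  proof (rule graph_submoduleI)
    show "x \<in> carrier R \<and> y \<in> carrier R" if "(x, y) \<in> ?N" for x y using that cl by auto
    show "(\<zero>, \<zero>) \<in> ?N" using graph_zero[OF G'(1)] by force
    fix x z assume "(x, z) \<in> ?N"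
    then obtain y where y: "(x, y) \<in> G" "z = \<ominus> y" by blast
    show "(x \<oplus> x', z \<oplus> z') \<in> ?N" if "(x', z') \<in> ?N" for x' z'
    proof -
      from that obtain y' where y': "(x', y') \<in> G" "z' = \<ominus> y'" by blast
      have "z \<oplus> z' = \<ominus> (y \<oplus> y')" using cl(2)[OF y(1)] cl(2)[OF y'(1)] by (simp add: y(2) y'(2) minus_add)
      then show ?thesis using graph_add[OF G'(1) y(1) y'(1)] by blast
    qed
    show "(x \<otimes> a, z \<otimes> a) \<in> ?N" if a: "a \<in> carrier R" for a
    proof -
      have "z \<otimes> a = \<ominus> (y \<otimes> a)" using cl(2)[OF y(1)] a by (simp add: y(2) l_minus)
      then show ?thesis using graph_mult[OF G'(1) y(1) a] by blast
    qed
  qed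
  show "z = \<zero>" if z0: "(\<zero>, z) \<in> ?N" for z
  proof -
    from z0 obtain y where y: "(\<zero>, y) \<in> G" "z = \<ominus> y" by blast
    show ?thesis using G'(2)[OF y(1)] y(2) by simp
  qed
  have "Domain ?N = Domain G" by blast
  then show "essential_right_ideal R (Domain ?N)" using G'(3) by simp
qed

lemma essential_partial_map_right_linear:
  assumes I: "essential_right_ideal R I" and h: "right_linear R I h"
  shows "essential_partial_map R {(x, h x) | x. x \<in> I}"
proof (rule essential_partial_mapI)
  interpret reg: right_module R "right_regular_module R"
    by (rule right_module_regular) (rule ring_axioms)
  let ?G = "{(x, h x) | x. x \<in> I}"
  note rI = essential_imp_right_ideal[OF I]
  have h0: "h \<zero> = \<zero>" using reg.right_linear_on_zero[OF rI h] by simp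
  show "graph_submodule R ?G"
  proof (rule graph_submoduleI)
    show "x \<in> carrier R \<and> y \<in> carrier R" if "(x, y) \<in> ?G" for x y
      using that right_ideal_memD[OF rI] right_linear_on_closed[OF h] by auto
    show "(\<zero>, \<zero>) \<in> ?G" using h0 right_ideal_zero_mem[OF rI] by force
    show "(x \<oplus> x', y \<oplus> y') \<in> ?G" if "(x, y) \<in> ?G" "(x', y') \<in> ?G" for x y x' y'
      using that right_linear_on_add[OF h] right_ideal_add[OF rI] by auto
    show "(x \<otimes> a, y \<otimes> a) \<in> ?G" if "(x, y) \<in> ?G" "a \<in> carrier R" for x y a
      using that right_linear_on_mult[OF h] right_ideal_mult[OF rI] by auto
  qed
  show "y = \<zero>" if "(\<zero>, y) \<in> ?G" for y using that h0 by auto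
  have "Domain ?G = I" by blast
  then show "essential_right_ideal R (Domain ?G)" using I by simp
qed

lemma left_mult_graph_mem_partial_map_ring:
  assumes a: "a \<in> carrier R" shows "left_mult_graph R a \<in> carrier (partial_map_ring R)"
proof -
  have epm: "essential_partial_map R (left_mult_graph R a)"
    unfolding left_mult_graph_def
    by (rule essential_partial_map_right_linear[OF essential_carrier right_linear_left_mult[OF a]]) simp
  have "graph_closure R (left_mult_graph R a) \<subseteq> left_mult_graph R a"
  proof clarify
    fix x y assume xy: "(x, y) \<in> graph_closure R (left_mult_graph R a)"
    obtain D where D: "x \<in> carrier R" "y \<in> carrier R" "essential_right_ideal R D"
      "\<And>b. b \<in> D \<Longrightarrow> b \<in> carrier R \<and> (x \<otimes> b, y \<otimes> b) \<in> left_mult_graph R a"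
      by (rule graph_closureE[OF xy]) blast
    have "y = a \<otimes> x"
    proof (rule essential_eqI[OF D(3,2)])
      show "a \<otimes> x \<in> carrier R" using a D by simp
      fix b assume "b \<in> D"
      then show "y \<otimes> b = a \<otimes> x \<otimes> b" using D(4)[of b] a D(1) by (auto simp: left_mult_graph_def m_assoc)
    qed
    then show "(x, y) \<in> left_mult_graph R a" using D by (auto simp: left_mult_graph_def)
  qed
  then have "graph_closure R (left_mult_graph R a) = left_mult_graph R a"
    by (rule equalityI) (rule graph_subset_closure[OF essential_partial_mapD(1)[OF epm]])
  then show ?thesis using epm by (simp add: partial_map_ring_simps)
qed

lemma ring_partial_map_ring: "ring (partial_map_ring R)"
proof -
  let ?Q = "partial_map_ring R"
  note epm = partial_map_ring_memD
  note comp = essential_partial_map_comp and sum = essential_partial_map_sum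
  have subC: "G \<subseteq> graph_closure R G" if "essential_partial_map R G" for G
    by (rule graph_subset_closure[OF essential_partial_mapD(1)[OF that]])
  have cl: "x \<in> carrier R" "y \<in> carrier R" if "G \<in> carrier ?Q" "(x, y) \<in> G" for G x y
    using graph_closed[OF essential_partial_mapD(1)[OF epm[OF that(1)]] that(2)] .
  have mult_closed: "G \<otimes>\<^bsub>?Q\<^esub> H \<in> carrier ?Q" if "G \<in> carrier ?Q" "H \<in> carrier ?Q" for G H
    unfolding partial_map_ring_simps(2) by (rule closure_mem_partial_map_ring[OF comp[OF that[THEN epm]]])
  have add_closed: "G \<oplus>\<^bsub>?Q\<^esub> H \<in> carrier ?Q" if "G \<in> carrier ?Q" "H \<in> carrier ?Q" for G H
    unfolding partial_map_ring_simps(5) by (rule closure_mem_partial_map_ring[OF sum[OF that[THEN epm]]])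
  have multI: "H O G \<subseteq> G \<otimes>\<^bsub>?Q\<^esub> H" if "G \<in> carrier ?Q" "H \<in> carrier ?Q" for G H
    unfolding partial_map_ring_simps(2) by (rule subC[OF comp[OF that[THEN epm]]])
  have addI: "graph_sum R G H \<subseteq> G \<oplus>\<^bsub>?Q\<^esub> H" if "G \<in> carrier ?Q" "H \<in> carrier ?Q" for G H
    unfolding partial_map_ring_simps(5) by (rule subC[OF sum[OF that[THEN epm]]])
  have sum_mono: "graph_sum R G H \<subseteq> graph_sum R G' H'" if "G \<subseteq> G'" "H \<subseteq> H'" for G H G' H'
    using that unfolding graph_sum_def by blast
  have closed_eq: "graph_closure R G = G" if "G \<in> carrier ?Q" for G
    using that by (simp add: partial_map_ring_simps)
  note one_mem = left_mult_graph_mem_partial_map_ring[OF one_closed]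
    and zero_mem = left_mult_graph_mem_partial_map_ring[OF zero_closed]
  show ?thesis
  proof (intro ringI abelian_groupI monoidI)
    show "\<one>\<^bsub>?Q\<^esub> \<in> carrier ?Q" "\<zero>\<^bsub>?Q\<^esub> \<in> carrier ?Q"
      by (simp_all only: partial_map_ring_simps(3,4) one_mem zero_mem)
    fix F assume F: "F \<in> carrier ?Q"
    have "F O left_mult_graph R \<one> = F" using cl[OF F] by (auto simp: left_mult_graph_def)
    then show "\<one>\<^bsub>?Q\<^esub> \<otimes>\<^bsub>?Q\<^esub> F = F" by (simp only: partial_map_ring_simps(2,3) closed_eq[OF F])
    have "left_mult_graph R \<one> O F = F" using cl[OF F] by (force simp: left_mult_graph_def)
    then show "F \<otimes>\<^bsub>?Q\<^esub> \<one>\<^bsub>?Q\<^esub> = F" by (simp only: partial_map_ring_simps(2,3) closed_eq[OF F])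
    have "graph_sum R (left_mult_graph R \<zero>) F = F"
      using cl[OF F] by (force simp: left_mult_graph_def graph_sum_def)
    then show "\<zero>\<^bsub>?Q\<^esub> \<oplus>\<^bsub>?Q\<^esub> F = F" by (simp only: partial_map_ring_simps(4,5) closed_eq[OF F])
    let ?N = "{(x, \<ominus> y) | x y. (x, y) \<in> F}"
    note N = essential_partial_map_neg[OF epm[OF F]]
    note N' = closure_mem_partial_map_ring[OF N]
    have "graph_closure R ?N \<oplus>\<^bsub>?Q\<^esub> F = left_mult_graph R \<zero>"
    proof (rule partial_map_ring_eqI[OF add_closed[OF N' F] zero_mem sum[OF N epm[OF F]]])
      show "graph_sum R ?N F \<subseteq> graph_closure R ?N \<oplus>\<^bsub>?Q\<^esub> F"
        using addI[OF N' F] sum_mono[OF subC[OF N] subset_refl[of F]] by (rule order_trans[rotated])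
      show "graph_sum R ?N F \<subseteq> left_mult_graph R \<zero>"
      proof clarify
        fix x z assume "(x, z) \<in> graph_sum R ?N F"
        then obtain y y' where yy': "(x, y) \<in> F" "(x, y') \<in> F" "z = \<ominus> y \<oplus> y'"
          unfolding graph_sum_def by blast
        have "y = y'" by (rule essential_partial_mapD(4)[OF epm[OF F] yy'(1,2)])
        then have "z = \<zero> \<otimes> x" using yy' cl[OF F yy'(1)] by (simp add: l_neg)
        then show "(x, z) \<in> left_mult_graph R \<zero>"
          using cl[OF F yy'(1)] unfolding left_mult_graph_def by blast
      qed
    qed
    then show "\<exists>G\<in>carrier ?Q. G \<oplus>\<^bsub>?Q\<^esub> F = \<zero>\<^bsub>?Q\<^esub>"
      using N' by (intro bexI[of _ "graph_closure R ?N"]) (simp_all only: partial_map_ring_simps(4))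
    fix G assume G: "G \<in> carrier ?Q"
    show "F \<otimes>\<^bsub>?Q\<^esub> G \<in> carrier ?Q" by (rule mult_closed[OF F G])
    show "F \<oplus>\<^bsub>?Q\<^esub> G \<in> carrier ?Q" by (rule add_closed[OF F G])
    have "graph_sum R F G = graph_sum R G F"
      using cl[OF F] cl[OF G] a_comm unfolding graph_sum_def by blast
    then show "F \<oplus>\<^bsub>?Q\<^esub> G = G \<oplus>\<^bsub>?Q\<^esub> F" by (simp only: partial_map_ring_simps(5))
    fix H assume H: "H \<in> carrier ?Q"
    note FG = mult_closed[OF F G] add_closed[OF F G] and GH = mult_closed[OF G H] add_closed[OF G H]
    show "F \<otimes>\<^bsub>?Q\<^esub> G \<otimes>\<^bsub>?Q\<^esub> H = F \<otimes>\<^bsub>?Q\<^esub> (G \<otimes>\<^bsub>?Q\<^esub> H)"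
    proof (rule partial_map_ring_eqI[OF mult_closed[OF FG(1) H] mult_closed[OF F GH(1)]
          comp[OF comp[OF epm[OF F] epm[OF G]] epm[OF H]]])
      show "H O (G O F) \<subseteq> F \<otimes>\<^bsub>?Q\<^esub> G \<otimes>\<^bsub>?Q\<^esub> H"
        using multI[OF FG(1) H] relcomp_mono[OF subset_refl multI[OF F G], of H] by (rule order_trans[rotated])
      show "H O (G O F) \<subseteq> F \<otimes>\<^bsub>?Q\<^esub> (G \<otimes>\<^bsub>?Q\<^esub> H)"
        unfolding O_assoc[symmetric]
        using multI[OF F GH(1)] relcomp_mono[OF multI[OF G H] subset_refl, of F] by (rule order_trans[rotated])
    qed
    show "F \<oplus>\<^bsub>?Q\<^esub> G \<oplus>\<^bsub>?Q\<^esub> H = F \<oplus>\<^bsub>?Q\<^esub> (G \<oplus>\<^bsub>?Q\<^esub> H)"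
    proof (rule partial_map_ring_eqI[OF add_closed[OF FG(2) H] add_closed[OF F GH(2)]
          sum[OF sum[OF epm[OF F] epm[OF G]] epm[OF H]]])
      show "graph_sum R (graph_sum R F G) H \<subseteq> F \<oplus>\<^bsub>?Q\<^esub> G \<oplus>\<^bsub>?Q\<^esub> H"
        using addI[OF FG(2) H] sum_mono[OF addI[OF F G] subset_refl, of H] by (rule order_trans[rotated])
      have "graph_sum R (graph_sum R F G) H \<subseteq> graph_sum R F (graph_sum R G H)"
      proof clarify
        fix x v assume "(x, v) \<in> graph_sum R (graph_sum R F G) H"
        then obtain y z w where *: "(x, y) \<in> F" "(x, z) \<in> G" "(x, w) \<in> H" "v = y \<oplus> z \<oplus> w"
          unfolding graph_sum_def by blast
        have "v = y \<oplus> (z \<oplus> w)" using * cl(2)[OF F *(1)] cl(2)[OF G *(2)] cl(2)[OF H *(3)] by (simp add: a_assoc)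
        then show "(x, v) \<in> graph_sum R F (graph_sum R G H)" using * unfolding graph_sum_def by blast
      qed
      also have "\<dots> \<subseteq> F \<oplus>\<^bsub>?Q\<^esub> (G \<oplus>\<^bsub>?Q\<^esub> H)"
        using addI[OF F GH(2)] sum_mono[OF subset_refl addI[OF G H], of F] by (rule order_trans[rotated])
      finally show "graph_sum R (graph_sum R F G) H \<subseteq> F \<oplus>\<^bsub>?Q\<^esub> (G \<oplus>\<^bsub>?Q\<^esub> H)" .
    qed
    show "(F \<oplus>\<^bsub>?Q\<^esub> G) \<otimes>\<^bsub>?Q\<^esub> H = F \<otimes>\<^bsub>?Q\<^esub> H \<oplus>\<^bsub>?Q\<^esub> G \<otimes>\<^bsub>?Q\<^esub> H"
    proof (rule partial_map_ring_eqI[OF mult_closed[OF FG(2) H]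
          add_closed[OF mult_closed[OF F H] mult_closed[OF G H]] comp[OF sum[OF epm[OF F] epm[OF G]] epm[OF H]]])
      show "H O graph_sum R F G \<subseteq> (F \<oplus>\<^bsub>?Q\<^esub> G) \<otimes>\<^bsub>?Q\<^esub> H"
        using multI[OF FG(2) H] relcomp_mono[OF subset_refl addI[OF F G], of H] by (rule order_trans[rotated])
      have "H O graph_sum R F G \<subseteq> graph_sum R (H O F) (H O G)" unfolding graph_sum_def by blast
      also have "\<dots> \<subseteq> F \<otimes>\<^bsub>?Q\<^esub> H \<oplus>\<^bsub>?Q\<^esub> G \<otimes>\<^bsub>?Q\<^esub> H"
        using addI[OF mult_closed[OF F H] mult_closed[OF G H]] sum_mono[OF multI[OF F H] multI[OF G H]]
        by (rule order_trans[rotated])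
      finally show "H O graph_sum R F G \<subseteq> F \<otimes>\<^bsub>?Q\<^esub> H \<oplus>\<^bsub>?Q\<^esub> G \<otimes>\<^bsub>?Q\<^esub> H" .
    qed
    show "H \<otimes>\<^bsub>?Q\<^esub> (F \<oplus>\<^bsub>?Q\<^esub> G) = H \<otimes>\<^bsub>?Q\<^esub> F \<oplus>\<^bsub>?Q\<^esub> H \<otimes>\<^bsub>?Q\<^esub> G"
    proof (rule partial_map_ring_eqI[OF mult_closed[OF H FG(2)]
          add_closed[OF mult_closed[OF H F] mult_closed[OF H G]]
          sum[OF comp[OF epm[OF H] epm[OF F]] comp[OF epm[OF H] epm[OF G]]]])
      have "graph_sum R (F O H) (G O H) \<subseteq> graph_sum R F G O H"
      proof clarify
        fix x v assume "(x, v) \<in> graph_sum R (F O H) (G O H)"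
        then obtain y z y' z' where *: "(x, y) \<in> F" "(y, z) \<in> H" "(x, y') \<in> G" "(y', z') \<in> H" "v = z \<oplus> z'"
          unfolding graph_sum_def by blast
        have "(y \<oplus> y', v) \<in> H"
          unfolding *(5) by (rule graph_add[OF essential_partial_mapD(1)[OF epm[OF H]] *(2,4)])
        then show "(x, v) \<in> graph_sum R F G O H" using *(1,3) unfolding graph_sum_def by blast
      qed
      also have "\<dots> \<subseteq> H \<otimes>\<^bsub>?Q\<^esub> (F \<oplus>\<^bsub>?Q\<^esub> G)"
        using multI[OF H FG(2)] relcomp_mono[OF addI[OF F G] subset_refl, of H] by (rule order_trans[rotated])
      finally show "graph_sum R (F O H) (G O H) \<subseteq> H \<otimes>\<^bsub>?Q\<^esub> (F \<oplus>\<^bsub>?Q\<^esub> G)" .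
      show "graph_sum R (F O H) (G O H) \<subseteq> H \<otimes>\<^bsub>?Q\<^esub> F \<oplus>\<^bsub>?Q\<^esub> H \<otimes>\<^bsub>?Q\<^esub> G"
        using addI[OF mult_closed[OF H F] mult_closed[OF H G]] sum_mono[OF multI[OF H F] multI[OF H G]]
        by (rule order_trans[rotated])
    qed
  qed
qed

text \<open>If \<open>(a, y)\<close> belongs to \<open>q\<close>, then \<open>qa = y\<close> in the ring of partial maps (here \<open>val\<close>), since both sides map
\<open>x\<close> to \<open>yx\<close>.\<close>

lemma partial_map_ring_represents: "represents_partial_maps R (partial_map_ring R) (left_mult_graph R)"
proof -
  let ?Q = "partial_map_ring R" and ?\<iota> = "left_mult_graph R"
  interpret Q: ring ?Q by (rule ring_partial_map_ring)
  note iQ = left_mult_graph_mem_partial_map_ring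
  note epm = partial_map_ring_memD
  have mem: "(x, y) \<in> ?\<iota> a \<longleftrightarrow> x \<in> carrier R \<and> y = a \<otimes> x" for x y a
    by (auto simp: left_mult_graph_def)
  have closed_eq: "graph_closure R G = G" if "G \<in> carrier ?Q" for G
    using that by (simp add: partial_map_ring_simps)
  have hom: "?\<iota> \<in> ring_hom R ?Q"
  proof (rule ring_hom_memI)
    fix a b assume ab: "a \<in> carrier R" "b \<in> carrier R"
    show "?\<iota> a \<in> carrier ?Q" by (rule iQ[OF ab(1)])
    have "?\<iota> b O ?\<iota> a = ?\<iota> (a \<otimes> b)" using ab by (auto simp: mem relcomp_unfold m_assoc)
    then show "?\<iota> (a \<otimes> b) = ?\<iota> a \<otimes>\<^bsub>?Q\<^esub> ?\<iota> b"
      by (simp only: partial_map_ring_simps(2) closed_eq iQ m_closed[OF ab])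
    have "graph_sum R (?\<iota> a) (?\<iota> b) = ?\<iota> (a \<oplus> b)"
      using ab by (auto simp: mem graph_sum_def l_distr)
    then show "?\<iota> (a \<oplus> b) = ?\<iota> a \<oplus>\<^bsub>?Q\<^esub> ?\<iota> b"
      by (simp only: partial_map_ring_simps(5) closed_eq iQ a_closed[OF ab])
  qed (simp only: partial_map_ring_simps)
  have inj: "inj_on ?\<iota> (carrier R)"
  proof (rule inj_onI)
    fix a b assume ab: "a \<in> carrier R" "b \<in> carrier R" "?\<iota> a = ?\<iota> b"
    have "(\<one>, a) \<in> ?\<iota> a" unfolding mem using ab(1) by simp
    then have "a = b \<otimes> \<one>" unfolding ab(3) mem by (rule conjunct2)
    then show "a = b" using ab(2) by simp
  qed
  have val: "q \<otimes>\<^bsub>?Q\<^esub> ?\<iota> a = ?\<iota> y" if q: "q \<in> carrier ?Q" and ay: "(a, y) \<in> q" for q a y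
  proof -
    note q' = essential_partial_mapD[OF epm[OF q]]
    note c = graph_closed[OF q'(1) ay]
    show ?thesis
    proof (rule partial_map_ring_eqI[OF Q.m_closed[OF q iQ[OF c(1)]] iQ[OF c(2)] epm[OF iQ[OF c(2)]] _ subset_refl])
      have "?\<iota> y \<subseteq> ?\<iota> a O q" using graph_mult[OF q'(1) ay] c by (auto simp: mem)
      also have "\<dots> \<subseteq> q \<otimes>\<^bsub>?Q\<^esub> ?\<iota> a"
        unfolding partial_map_ring_simps(2)
        by (rule graph_subset_closure[OF essential_partial_mapD(1)[OF
                essential_partial_map_comp[OF epm[OF q] epm[OF iQ[OF c(1)]]]]])
      finally show "?\<iota> y \<subseteq> q \<otimes>\<^bsub>?Q\<^esub> ?\<iota> a" .
    qed
  qed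
  show ?thesis
    unfolding represents_partial_maps_def
  proof (intro conjI Q.ring_axioms hom inj ballI allI impI)
    fix q assume q: "q \<in> carrier ?Q"
    note q' = essential_partial_mapD[OF epm[OF q]]
    have "q \<otimes>\<^bsub>?Q\<^esub> ?\<iota> a \<in> ?\<iota> ` carrier R" if "a \<in> Domain q" for a
      using that val[OF q] graph_closed[OF q'(1)] by auto
    then show "\<exists>D. essential_right_ideal R D \<and> (\<forall>a\<in>D. q \<otimes>\<^bsub>?Q\<^esub> ?\<iota> a \<in> ?\<iota> ` carrier R)"
      using q'(3) by (intro exI[of _ "Domain q"] conjI ballI)
    fix I assume I: "essential_right_ideal R I \<and> (\<forall>a\<in>I. q \<otimes>\<^bsub>?Q\<^esub> ?\<iota> a = \<zero>\<^bsub>?Q\<^esub>)"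
    let ?D = "I \<inter> Domain q"
    have D: "essential_right_ideal R ?D" using essential_Int[OF conjunct1[OF I] q'(3)] .
    have y0: "y = \<zero>" if "x \<in> I" "(x, y) \<in> q" for x y
    proof -
      have y: "y \<in> carrier R" by (rule graph_closed(2)[OF q'(1) that(2)])
      have "?\<iota> y = ?\<iota> \<zero>" using val[OF q that(2)] I that(1) by (simp add: partial_map_ring_simps(4))
      then show ?thesis using inj_onD[OF inj] y by simp
    qed
    show "q = \<zero>\<^bsub>?Q\<^esub>"
    proof (rule partial_map_ring_eqI[OF q Q.zero_closed essential_partial_map_right_linear[OF D, of "\<lambda>x. \<zero>"]])
      show "right_linear R ?D (\<lambda>x. \<zero>)" by (rule right_linear_onI) auto
      show "{(x, \<zero>) | x. x \<in> ?D} \<subseteq> q" using y0 by blast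
      show "{(x, \<zero>) | x. x \<in> ?D} \<subseteq> \<zero>\<^bsub>?Q\<^esub>"
        using right_ideal_memD[OF essential_imp_right_ideal[OF conjunct1[OF I]]]
        by (auto simp: partial_map_ring_simps(4) mem)
    qed
  next
    fix I h assume Ih: "essential_right_ideal R I \<and> right_linear R I h"
    let ?G = "{(x, h x) | x. x \<in> I}"
    note G = essential_partial_map_right_linear[OF conjunct1[OF Ih] conjunct2[OF Ih]]
    note GQ = closure_mem_partial_map_ring[OF G]
    have "graph_closure R ?G \<otimes>\<^bsub>?Q\<^esub> ?\<iota> a = ?\<iota> (h a)" if "a \<in> I" for a
      by (rule val[OF GQ]) (use that graph_subset_closure[OF essential_partial_mapD(1)[OF G]] in blast)
    then show "\<exists>q\<in>carrier ?Q. \<forall>a\<in>I. q \<otimes>\<^bsub>?Q\<^esub> ?\<iota> a = ?\<iota> (h a)"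
      using GQ by (intro bexI[of _ "graph_closure R ?G"] ballI)
  qed
qed

text \<open>The ring of partial maps is copied along an injection into the type over which the
condition on quotient rings quantifies: a relation is encoded by the map sending each \<open>x\<close> to
the set of indicator functions of its successors.\<close>

lemma partial_automorphisms_extend_if_contains_units:
  assumes "contains_units_of_max_right_quotient_ring R"
  shows "partial_automorphisms_extend R"
proof -
  define enc :: "('a \<times> 'a) set \<Rightarrow> ('a, 'a) hull_elem" where
    "enc G = (\<lambda>x. (\<lambda>y z. if z = y then 1 else 0) ` {y. (x, y) \<in> G})" for G
  have inj': "inj (\<lambda>y z. if z = y then 1 else 0 :: rat)"
    by (rule injI) (metis zero_neq_one)
  have "inj enc"
  proof (rule injI)
    fix G H assume "enc G = enc H"
    then have "{y. (x, y) \<in> G} = {y. (x, y) \<in> H}" for x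
      unfolding enc_def by (metis inj_image_eq_iff[OF inj'])
    then show "G = H" by auto
  qed
  then have "inj_on enc (carrier (partial_map_ring R))" by (rule inj_on_subset) simp
  note rep = represents_partial_maps_image[OF partial_map_ring_represents ring_axioms this]
  have "is_max_right_quotient_ring R (image_ring enc (partial_map_ring R)) (enc \<circ> left_mult_graph R)"
    by (rule represents_partial_maps_imp_max_right_quotient_ring[OF rep])
  then have "Units (image_ring enc (partial_map_ring R)) \<subseteq> (enc \<circ> left_mult_graph R) ` carrier R"
    using assms unfolding contains_units_of_max_right_quotient_ring_def by blast
  then show ?thesis by (rule partial_automorphisms_extend_if_units_represented[OF rep])
qed

end

section \<open>Products of rings\<close>

text \<open>Here \<open>p\<close> is the projection of \<open>R\<close> onto a factor \<open>S\<close> and \<open>j\<close> the embedding of \<open>S\<close>, which does not preserve the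
unit. A partial automorphism \<open>h\<close> commutes with right multiplication by \<open>j 1\<close>, and so it
maps \<open>I \<inter> j S\<close> into \<open>j S\<close> and induces a partial automorphism of \<open>S\<close>.\<close>

lemma partial_automorphism_on_factor:
  assumes R: "ring R" and S: "ring S" and P: "partial_automorphisms_extend S"
    and p: "p \<in> ring_hom R S" and j: "\<And>s. s \<in> carrier S \<Longrightarrow> j s \<in> carrier R"
    and pj: "\<And>s. s \<in> carrier S \<Longrightarrow> p (j s) = s"
    and jadd: "\<And>s t. s \<in> carrier S \<Longrightarrow> t \<in> carrier S \<Longrightarrow> j (s \<oplus>\<^bsub>S\<^esub> t) = j s \<oplus>\<^bsub>R\<^esub> j t"
    and jl: "\<And>a s. a \<in> carrier R \<Longrightarrow> s \<in> carrier S \<Longrightarrow> a \<otimes>\<^bsub>R\<^esub> j s = j (p a \<otimes>\<^bsub>S\<^esub> s)"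
    and jr: "\<And>a s. a \<in> carrier R \<Longrightarrow> s \<in> carrier S \<Longrightarrow> j s \<otimes>\<^bsub>R\<^esub> a = j (s \<otimes>\<^bsub>S\<^esub> p a)"
    and I: "essential_right_ideal R I" and h: "right_linear R I h" and inj: "inj_on h I"
    and im: "essential_right_ideal R (h ` I)"
  obtains s where "s \<in> carrier S" "\<And>x. x \<in> I \<Longrightarrow> p (h x) = s \<otimes>\<^bsub>S\<^esub> p x"
proof -
  interpret R: ring R by (rule R)
  interpret S: ring S by (rule S)
  note rI = R.essential_imp_right_ideal[OF I]
  note IR = R.right_ideal_memD[OF rI]
  note pS = ring_hom_closed[OF p]
  have hR: "h x \<in> carrier R" if "x \<in> I" for x using right_linear_on_closed[OF h that] by simp
  have hmult: "h (x \<otimes>\<^bsub>R\<^esub> a) = h x \<otimes>\<^bsub>R\<^esub> a" if "x \<in> I" "a \<in> carrier R" for x a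
    using right_linear_on_mult[OF h that] by simp
  have j0: "j \<zero>\<^bsub>S\<^esub> = \<zero>\<^bsub>R\<^esub>"
    using jr[OF R.zero_closed S.one_closed] j[OF S.one_closed] ring_hom_zero[OF p R S] by simp
  have jinj: "s = t" if "j s = j t" "s \<in> carrier S" "t \<in> carrier S" for s t
    using that pj by metis
  have jp: "a \<otimes>\<^bsub>R\<^esub> j \<one>\<^bsub>S\<^esub> = j (p a)" if "a \<in> carrier R" for a
    using jl[OF that S.one_closed] pS[OF that] by simp
  have jpI: "j (p x) \<in> I" if "x \<in> I" for x
    using R.right_ideal_mult[OF rI that j[OF S.one_closed]] jp[OF IR[OF that]] by simp
  define J where "J = {s \<in> carrier S. j s \<in> I}"
  define k where "k = (\<lambda>s. p (h (j s)))"
  have hj: "h (j s) = j (k s)" "k s \<in> carrier S" "s \<in> carrier S" "j s \<in> I" if "s \<in> J" for s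
  proof -
    show s: "s \<in> carrier S" "j s \<in> I" using that by (auto simp: J_def)
    then show "k s \<in> carrier S" using hR pS by (simp add: k_def)
    have "h (j s) = h (j s \<otimes>\<^bsub>R\<^esub> j \<one>\<^bsub>S\<^esub>)" using jp[OF j[OF s(1)]] pj[OF s(1)] by simp
    also have "\<dots> = j (k s)" using hmult[OF s(2) j[OF S.one_closed]] jp[OF hR[OF s(2)]] by (simp add: k_def)
    finally show "h (j s) = j (k s)" .
  qed
  have kI: "k s = t" if "s \<in> J" "t \<in> carrier S" "h (j s) = j t" for s t
    using that pj by (simp add: k_def)
  have Jadd: "s \<oplus>\<^bsub>S\<^esub> t \<in> J" if "s \<in> J" "t \<in> J" for s t
    using hj(3,4)[OF that(1)] hj(3,4)[OF that(2)] R.right_ideal_add[OF rI] by (simp add: J_def jadd)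
  have jmult: "j (s \<otimes>\<^bsub>S\<^esub> t) = j s \<otimes>\<^bsub>R\<^esub> j t" if "s \<in> carrier S" "t \<in> carrier S" for s t
    using jr[OF j[OF that(2)] that(1)] pj[OF that(2)] by simp
  have Jmult: "s \<otimes>\<^bsub>S\<^esub> t \<in> J" if "s \<in> J" "t \<in> carrier S" for s t
    using hj(3,4)[OF that(1)] that(2) R.right_ideal_mult[OF rI] j by (simp add: J_def jmult)
  have rJ: "right_ideal S J"
    unfolding S.right_ideal_iff
  proof (intro conjI ballI subsetI)
    show "\<zero>\<^bsub>S\<^esub> \<in> J" using R.right_ideal_zero_mem[OF rI] by (simp add: J_def j0)
  qed (rule hj(3) Jadd Jmult; assumption)+
  have essJ: "essential_right_ideal S J"
    unfolding S.essential_right_ideal_iff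
  proof (intro conjI rJ ballI impI)
    fix s assume s: "s \<in> carrier S" "s \<noteq> \<zero>\<^bsub>S\<^esub>"
    then have "j s \<noteq> \<zero>\<^bsub>R\<^esub>" using jinj[of s "\<zero>\<^bsub>S\<^esub>"] j0 by auto
    then obtain a where a: "a \<in> carrier R" "j s \<otimes>\<^bsub>R\<^esub> a \<noteq> \<zero>\<^bsub>R\<^esub>" "j s \<otimes>\<^bsub>R\<^esub> a \<in> I"
      using I j[OF s(1)] unfolding R.essential_right_ideal_iff by blast
    then show "\<exists>t\<in>carrier S. s \<otimes>\<^bsub>S\<^esub> t \<noteq> \<zero>\<^bsub>S\<^esub> \<and> s \<otimes>\<^bsub>S\<^esub> t \<in> J"
      using jr[OF a(1) s(1)] j0 pS[OF a(1)] s by (intro bexI[of _ "p a"]) (auto simp: J_def)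
  qed
  have kl: "right_linear S J k"
  proof (rule right_linear_onI)
    fix s assume s: "s \<in> J"
    show "k s \<in> carrier (right_regular_module S)" using hj(2)[OF s] by simp
    show "k (s \<oplus>\<^bsub>S\<^esub> t) = k s \<oplus>\<^bsub>right_regular_module S\<^esub> k t" if t: "t \<in> J" for t
    proof -
      have "h (j (s \<oplus>\<^bsub>S\<^esub> t)) = h (j s) \<oplus>\<^bsub>R\<^esub> h (j t)"
        using right_linear_on_add[OF h hj(4)[OF s] hj(4)[OF t]] jadd[OF hj(3)[OF s] hj(3)[OF t]] by simp
      also have "\<dots> = j (k s \<oplus>\<^bsub>S\<^esub> k t)" using hj(1,2)[OF s] hj(1,2)[OF t] by (simp add: jadd)
      finally show ?thesis using kI[OF Jadd[OF s t]] hj(2)[OF s] hj(2)[OF t] by simp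
    qed
    show "k (s \<otimes>\<^bsub>S\<^esub> t) = k s \<star>\<^bsub>right_regular_module S\<^esub> t" if t: "t \<in> carrier S" for t
    proof -
      have "h (j (s \<otimes>\<^bsub>S\<^esub> t)) = h (j s) \<otimes>\<^bsub>R\<^esub> j t"
        using hmult[OF hj(4)[OF s] j[OF t]] jmult[OF hj(3)[OF s] t] by simp
      also have "\<dots> = j (k s \<otimes>\<^bsub>S\<^esub> t)" using hj(1,2)[OF s] t by (simp add: jmult)
      finally show ?thesis using kI[OF Jmult[OF s t]] hj(2)[OF s] t by simp
    qed
  qed
  have kinj: "inj_on k J"
  proof (rule inj_onI)
    fix s t assume st: "s \<in> J" "t \<in> J" "k s = k t"
    then have "h (j s) = h (j t)" using hj(1) by simp
    then have "j s = j t" using inj_onD[OF inj] hj(4) st by blast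
    then show "s = t" using jinj hj(3) st by blast
  qed
  have essk: "essential_right_ideal S (k ` J)"
    unfolding S.essential_right_ideal_iff
  proof (intro conjI S.right_linear_image[OF rJ kl] ballI impI)
    fix s assume s: "s \<in> carrier S" "s \<noteq> \<zero>\<^bsub>S\<^esub>"
    then have "j s \<noteq> \<zero>\<^bsub>R\<^esub>" using jinj[of s "\<zero>\<^bsub>S\<^esub>"] j0 by auto
    then obtain a where a: "a \<in> carrier R" "j s \<otimes>\<^bsub>R\<^esub> a \<noteq> \<zero>\<^bsub>R\<^esub>" "j s \<otimes>\<^bsub>R\<^esub> a \<in> h ` I"
      using im j[OF s(1)] unfolding R.essential_right_ideal_iff by blast
    then obtain x where x: "x \<in> I" "j s \<otimes>\<^bsub>R\<^esub> a = h x" by blast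
    have sa: "s \<otimes>\<^bsub>S\<^esub> p a \<in> carrier S" using s pS[OF a(1)] by simp
    have hx: "h x = j (s \<otimes>\<^bsub>S\<^esub> p a)" using x(2) jr[OF a(1) s(1)] by simp
    have px: "p x \<in> J" using jpI[OF x(1)] pS[OF IR[OF x(1)]] by (simp add: J_def)
    have "h (j (p x)) = h x \<otimes>\<^bsub>R\<^esub> j \<one>\<^bsub>S\<^esub>" using hmult[OF x(1) j[OF S.one_closed]] jp[OF IR[OF x(1)]] by simp
    also have "\<dots> = j (s \<otimes>\<^bsub>S\<^esub> p a)" using jp[OF hR[OF x(1)]] pj[OF sa] hx by simp
    finally have "k (p x) = s \<otimes>\<^bsub>S\<^esub> p a" by (rule kI[OF px sa])
    moreover have "s \<otimes>\<^bsub>S\<^esub> p a \<noteq> \<zero>\<^bsub>S\<^esub>" using a(2) x(2) hx j0 by auto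
    ultimately show "\<exists>t\<in>carrier S. s \<otimes>\<^bsub>S\<^esub> t \<noteq> \<zero>\<^bsub>S\<^esub> \<and> s \<otimes>\<^bsub>S\<^esub> t \<in> k ` J"
      using px pS[OF a(1)] by (intro bexI[of _ "p a"] conjI image_eqI[of _ _ "p x"]) simp_all
  qed
  obtain s where s: "s \<in> carrier S" "\<And>t. t \<in> J \<Longrightarrow> k t = s \<otimes>\<^bsub>S\<^esub> t"
    by (rule partial_automorphisms_extendD[OF P essJ kl kinj essk]) blast
  have "p (h x) = s \<otimes>\<^bsub>S\<^esub> p x" if x: "x \<in> I" for x
  proof -
    have px: "p x \<in> J" using jpI[OF x] pS[OF IR[OF x]] by (simp add: J_def)
    have "j (p (h x)) = h (j (p x))"
      using hmult[OF x j[OF S.one_closed]] jp[OF IR[OF x]] jp[OF hR[OF x]] by simp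
    then have "p (h x) = k (p x)" using hj(1,2)[OF px] jinj pS[OF hR[OF x]] by simp
    then show ?thesis using s(2)[OF px] by simp
  qed
  then show thesis using s(1) that by blast
qed

lemma product_of_partial_automorphism_extending_rings:
  assumes R: "ring R" and S: "ring S" and T: "ring T" and iso: "\<phi> \<in> ring_iso R (RDirProd S T)"
    and PS: "partial_automorphisms_extend S" and PT: "partial_automorphisms_extend T"
  shows "partial_automorphisms_extend R"
  unfolding partial_automorphisms_extend_def
proof (intro allI impI, elim conjE)
  fix I h
  assume I: "essential_right_ideal R I" and h: "right_linear R I h" and inj: "inj_on h I"
    and im: "essential_right_ideal R (h ` I)"
  interpret R: ring R by (rule R)
  interpret S: ring S by (rule S)
  interpret T: ring T by (rule T)
  have hom: "\<phi> \<in> ring_hom R (RDirProd S T)" and bij: "bij_betw \<phi> (carrier R) (carrier S \<times> carrier T)"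
    using iso by (auto simp: ring_iso_def)
  define \<psi> where "\<psi> = inv_into (carrier R) \<phi>"
  have \<psi>: "\<psi> q \<in> carrier R" "\<phi> (\<psi> q) = q" if "q \<in> carrier S \<times> carrier T" for q
    using that bij by (auto simp: \<psi>_def bij_betw_def inv_into_into f_inv_into_f)
  have \<phi>: "\<phi> a \<in> carrier S \<times> carrier T" if "a \<in> carrier R" for a
    using bij that by (auto simp: bij_betw_def)
  have eqI: "a = b" if "\<phi> a = \<phi> b" "a \<in> carrier R" "b \<in> carrier R" for a b
    using bij that by (auto simp: bij_betw_def dest: inj_onD)
  have mult: "\<phi> (a \<otimes>\<^bsub>R\<^esub> b) = (fst (\<phi> a) \<otimes>\<^bsub>S\<^esub> fst (\<phi> b), snd (\<phi> a) \<otimes>\<^bsub>T\<^esub> snd (\<phi> b))"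
    if "a \<in> carrier R" "b \<in> carrier R" for a b
    using ring_hom_mult[OF hom that] by (cases "\<phi> a"; cases "\<phi> b") simp
  have add: "\<phi> (a \<oplus>\<^bsub>R\<^esub> b) = (fst (\<phi> a) \<oplus>\<^bsub>S\<^esub> fst (\<phi> b), snd (\<phi> a) \<oplus>\<^bsub>T\<^esub> snd (\<phi> b))"
    if "a \<in> carrier R" "b \<in> carrier R" for a b
    using ring_hom_add[OF hom that] by (cases "\<phi> a"; cases "\<phi> b") simp
  have fc: "fst (\<phi> a) \<in> carrier S" "snd (\<phi> a) \<in> carrier T" if "a \<in> carrier R" for a
    using \<phi>[OF that] by (auto simp: mem_Times_iff)
  have one: "\<phi> \<one>\<^bsub>R\<^esub> = (\<one>\<^bsub>S\<^esub>, \<one>\<^bsub>T\<^esub>)" using ring_hom_one[OF hom] by simp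
  have homS: "(\<lambda>a. fst (\<phi> a)) \<in> ring_hom R S" and homT: "(\<lambda>a. snd (\<phi> a)) \<in> ring_hom R T"
    by (auto intro!: ring_hom_memI simp: mult add one fc)
  obtain s where s: "s \<in> carrier S" "\<And>x. x \<in> I \<Longrightarrow> fst (\<phi> (h x)) = s \<otimes>\<^bsub>S\<^esub> fst (\<phi> x)"
  proof (rule partial_automorphism_on_factor[OF R S PS homS, of "\<lambda>s. \<psi> (s, \<zero>\<^bsub>T\<^esub>)", OF _ _ _ _ _ I h inj im])
    show "\<psi> (s \<oplus>\<^bsub>S\<^esub> t, \<zero>\<^bsub>T\<^esub>) = \<psi> (s, \<zero>\<^bsub>T\<^esub>) \<oplus>\<^bsub>R\<^esub> \<psi> (t, \<zero>\<^bsub>T\<^esub>)" if "s \<in> carrier S" "t \<in> carrier S" for s t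
      by (rule eqI) (use that in \<open>simp_all add: \<psi> add\<close>)
    show "a \<otimes>\<^bsub>R\<^esub> \<psi> (s, \<zero>\<^bsub>T\<^esub>) = \<psi> (fst (\<phi> a) \<otimes>\<^bsub>S\<^esub> s, \<zero>\<^bsub>T\<^esub>)" if "a \<in> carrier R" "s \<in> carrier S" for a s
      by (rule eqI) (use that fc[OF that(1)] in \<open>simp_all add: \<psi> mult\<close>)
    show "\<psi> (s, \<zero>\<^bsub>T\<^esub>) \<otimes>\<^bsub>R\<^esub> a = \<psi> (s \<otimes>\<^bsub>S\<^esub> fst (\<phi> a), \<zero>\<^bsub>T\<^esub>)" if "a \<in> carrier R" "s \<in> carrier S" for a s
      by (rule eqI) (use that fc[OF that(1)] in \<open>simp_all add: \<psi> mult\<close>)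
  qed (simp_all add: \<psi>)
  obtain t where t: "t \<in> carrier T" "\<And>x. x \<in> I \<Longrightarrow> snd (\<phi> (h x)) = t \<otimes>\<^bsub>T\<^esub> snd (\<phi> x)"
  proof (rule partial_automorphism_on_factor[OF R T PT homT, of "\<lambda>t. \<psi> (\<zero>\<^bsub>S\<^esub>, t)", OF _ _ _ _ _ I h inj im])
    show "\<psi> (\<zero>\<^bsub>S\<^esub>, s \<oplus>\<^bsub>T\<^esub> t) = \<psi> (\<zero>\<^bsub>S\<^esub>, s) \<oplus>\<^bsub>R\<^esub> \<psi> (\<zero>\<^bsub>S\<^esub>, t)" if "s \<in> carrier T" "t \<in> carrier T" for s t
      by (rule eqI) (use that in \<open>simp_all add: \<psi> add\<close>)
    show "a \<otimes>\<^bsub>R\<^esub> \<psi> (\<zero>\<^bsub>S\<^esub>, s) = \<psi> (\<zero>\<^bsub>S\<^esub>, snd (\<phi> a) \<otimes>\<^bsub>T\<^esub> s)" if "a \<in> carrier R" "s \<in> carrier T" for a s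
      by (rule eqI) (use that fc[OF that(1)] in \<open>simp_all add: \<psi> mult\<close>)
    show "\<psi> (\<zero>\<^bsub>S\<^esub>, s) \<otimes>\<^bsub>R\<^esub> a = \<psi> (\<zero>\<^bsub>S\<^esub>, s \<otimes>\<^bsub>T\<^esub> snd (\<phi> a))" if "a \<in> carrier R" "s \<in> carrier T" for a s
      by (rule eqI) (use that fc[OF that(1)] in \<open>simp_all add: \<psi> mult\<close>)
  qed (simp_all add: \<psi>)
  have "h x = \<psi> (s, t) \<otimes>\<^bsub>R\<^esub> x" if x: "x \<in> I" for x
  proof (rule eqI)
    have xR: "x \<in> carrier R" by (rule R.right_ideal_memD[OF R.essential_imp_right_ideal[OF I] x])
    show "h x \<in> carrier R" using right_linear_on_closed[OF h x] by simp
    show "\<psi> (s, t) \<otimes>\<^bsub>R\<^esub> x \<in> carrier R" using \<psi>(1)[of "(s, t)"] s(1) t(1) xR by simp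
    show "\<phi> (h x) = \<phi> (\<psi> (s, t) \<otimes>\<^bsub>R\<^esub> x)"
      using s t x xR \<psi>[of "(s, t)"] by (simp add: mult prod_eq_iff)
  qed
  then show "\<exists>c\<in>carrier R. \<forall>x\<in>I. h x = c \<otimes>\<^bsub>R\<^esub> x"
    using \<psi>(1)[of "(s, t)"] s(1) t(1) by (intro bexI[of _ "\<psi> (s, t)"] ballI) simp_all
qed

lemma product_of_regular_rings:
  assumes R: "ring R" and S: "ring S" and T: "ring T" and iso: "\<phi> \<in> ring_iso R (RDirProd S T)"
    and regS: "regular_ring S" and regT: "regular_ring T"
  shows "regular_ring R"
  unfolding ring.regular_ring_iff[OF R]
proof
  fix a assume a: "a \<in> carrier R"
  interpret R: ring R by (rule R)
  have hom: "\<phi> \<in> ring_hom R (RDirProd S T)" and bij: "bij_betw \<phi> (carrier R) (carrier S \<times> carrier T)"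
    using iso by (auto simp: ring_iso_def)
  obtain s t where st: "s \<in> carrier S" "t \<in> carrier T" "\<phi> a = (s, t)"
    using ring_hom_closed[OF hom a] by auto
  obtain x where x: "x \<in> carrier S" "s \<otimes>\<^bsub>S\<^esub> x \<otimes>\<^bsub>S\<^esub> s = s"
    using regS st(1) unfolding ring.regular_ring_iff[OF S] by blast
  obtain y where y: "y \<in> carrier T" "t \<otimes>\<^bsub>T\<^esub> y \<otimes>\<^bsub>T\<^esub> t = t"
    using regT st(2) unfolding ring.regular_ring_iff[OF T] by blast
  have "(x, y) \<in> \<phi> ` carrier R" using bij x(1) y(1) by (simp add: bij_betw_def)
  then obtain b where b: "b \<in> carrier R" "\<phi> b = (x, y)" by auto
  have "\<phi> (a \<otimes>\<^bsub>R\<^esub> b \<otimes>\<^bsub>R\<^esub> a) = \<phi> a"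
    using a b st x(2) y(2) by (simp add: ring_hom_mult[OF hom])
  then have "a \<otimes>\<^bsub>R\<^esub> b \<otimes>\<^bsub>R\<^esub> a = a"
    using bij a b by (auto simp: bij_betw_def dest: inj_onD)
  then show "\<exists>b\<in>carrier R. a \<otimes>\<^bsub>R\<^esub> b \<otimes>\<^bsub>R\<^esub> a = a" using b by blast
qed

lemma strongly_regular_imp_regular: "strongly_regular_ring R \<Longrightarrow> regular_ring R"
  unfolding strongly_regular_ring_def regular_ring_def central_idempotents_def by blast

lemma (in ring) right_injective_imp_partial_automorphisms_extend:
  assumes "right_injective_ring R" shows "partial_automorphisms_extend R"
  unfolding partial_automorphisms_extend_def
proof (intro allI impI, elim conjE)
  fix I h assume I: "essential_right_ideal R I" and h: "right_linear R I h"
  show "\<exists>c\<in>carrier R. \<forall>x\<in>I. h x = c \<otimes> x"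
    by (rule right_injective_ring_extends[OF assms essential_imp_right_ideal[OF I] h]) blast
qed

section \<open>The characterization\<close>

text \<open>A regular ring is right non-singular, so it suffices to decompose a right non-singular
automorphism-invariant ring and to go back from a decomposition to the second condition.\<close>

theorem theorem1p2:
  fixes A :: "('a, 'r) ring_scheme"
  assumes "ring A" and "\<one>\<^bsub>A\<^esub> \<noteq> \<zero>\<^bsub>A\<^esub>"
  shows
    "(right_automorphism_invariant_ring A \<and> right_nonsingular_ring A
        \<longleftrightarrow> right_automorphism_invariant_ring A \<and> regular_ring A)
     \<and> (right_automorphism_invariant_ring A \<and> regular_ring A
        \<longleftrightarrow> (\<exists>(S :: 'a ring) (T :: 'a ring). ring S \<and> ring T \<and> A \<simeq> RDirProd S T \<and>
              right_injective_ring S \<and> regular_ring S \<and>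
              strongly_regular_ring T \<and> contains_units_of_max_right_quotient_ring T))"
    (is "(?ai \<and> ?ns \<longleftrightarrow> ?ai \<and> ?reg) \<and> (?ai \<and> ?reg \<longleftrightarrow> ?decomp)")
proof -
  interpret A: ring A by fact
  have regular_nonsingular: ?ns if ?reg using A.regular_ring_imp_right_nonsingular[OF that] .
  have decomposition: ?decomp if ai: ?ai and ns: ?ns
  proof -
    interpret N: nonsingular_ring A by (unfold_locales) (rule ns)
    interpret P: partial_automorphism_extending_ring A
      by (unfold_locales) (rule N.partial_automorphisms_extend_if_contains_units
          [OF contains_units_if_automorphism_invariant[OF ai]])
    obtain d e f h where d: "central_idempotent A d" and sf: "square_free_below A d"
      and sum: "\<one>\<^bsub>A\<^esub> \<ominus>\<^bsub>A\<^esub> d = e \<oplus>\<^bsub>A\<^esub> f \<oplus>\<^bsub>A\<^esub> h"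
      and emb: "embeds_in_complement (corner_ring A (\<one>\<^bsub>A\<^esub> \<ominus>\<^bsub>A\<^esub> d)) e"
        "embeds_in_complement (corner_ring A (\<one>\<^bsub>A\<^esub> \<ominus>\<^bsub>A\<^esub> d)) f"
        "embeds_in_complement (corner_ring A (\<one>\<^bsub>A\<^esub> \<ominus>\<^bsub>A\<^esub> d)) h"
      by (rule P.square_free_plus_embedding_decomposition) blast
    interpret d: central_idempotent A d by (rule d)
    let ?c = "\<one>\<^bsub>A\<^esub> \<ominus>\<^bsub>A\<^esub> d"
    interpret c: central_idempotent A ?c by (rule d.complement_central_idempotent)
    interpret S: partial_automorphism_extending_ring "corner_ring A ?c"
      by (rule P.partial_automorphism_extending_corner_ring) (rule c.central_idempotent_axioms)
    interpret T: partial_automorphism_extending_ring "corner_ring A d"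
      by (rule P.partial_automorphism_extending_corner_ring) (rule d)
    have "\<one>\<^bsub>A\<^esub> \<ominus>\<^bsub>A\<^esub> ?c = d" by (simp add: a_minus_def A.minus_add A.r_neg2)
    then have iso: "A \<simeq> RDirProd (corner_ring A ?c) (corner_ring A d)"
      using c.product_decomposition unfolding is_ring_iso_def by auto
    have inj: "right_injective_ring (corner_ring A ?c)"
      by (rule S.right_injective_if_one_is_sum_of_embedding_idempotents[OF _ emb]) (simp add: sum)
    have "strongly_regular_ring (corner_ring A d)"
      by (rule T.square_free_imp_strongly_regular) (simp add: d.square_free_below_corner[OF sf])
    moreover have "contains_units_of_max_right_quotient_ring (corner_ring A d)"
      by (intro contains_units_if_automorphism_invariant
          T.automorphism_invariant_if_partial_automorphisms_extend T.partial_automorphisms_extend)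
    ultimately show ?thesis
      using S.ring_axioms T.ring_axioms iso inj S.right_injective_imp_regular[OF inj] by blast
  qed
  have converse: "?ai \<and> ?reg" if ?decomp
  proof -
    from that obtain S T :: "'a ring" where S: "ring S" and T: "ring T" and iso: "A \<simeq> RDirProd S T"
      and inj: "right_injective_ring S" and regS: "regular_ring S" and regT: "strongly_regular_ring T"
      and units: "contains_units_of_max_right_quotient_ring T"
      by (elim exE conjE)
    obtain \<phi> where \<phi>: "\<phi> \<in> ring_iso A (RDirProd S T)" using iso unfolding is_ring_iso_def by blast
    interpret T: nonsingular_ring T
      by (intro nonsingular_ring.intro nonsingular_ring_axioms.intro T
          ring.regular_ring_imp_right_nonsingular[OF T] strongly_regular_imp_regular[OF regT])
    have reg: ?reg by (rule product_of_regular_rings[OF A.ring_axioms S T \<phi> regS strongly_regular_imp_regular[OF regT]])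
    interpret N: nonsingular_ring A by (unfold_locales) (rule regular_nonsingular[OF reg])
    have "partial_automorphisms_extend A"
      by (rule product_of_partial_automorphism_extending_rings[OF A.ring_axioms S T \<phi>
            ring.right_injective_imp_partial_automorphisms_extend[OF S inj]
            T.partial_automorphisms_extend_if_contains_units[OF units]])
    then show ?thesis using N.automorphism_invariant_if_partial_automorphisms_extend reg by blast
  qed
  show ?thesis using regular_nonsingular decomposition converse by blast
qed

end
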